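(* Let $d\ge 1$ and fix constants $c$ and $\alpha$ such that $0<\sqrt{29}\,\alpha \le c<1$. Let $X=(X_t)_{t\ge 0}$ be an isotropic unimodal Lévy process on $\mathbb{R}^d$ with radial jump density $j$, and suppose there exists a sequence $(R_n)\subseteq(0,\infty)$ such that $$\frac{j(R_n)}{j(cR_n)}\to 0 \qquad\text{and}\qquad \mathbb{P}_0\left(X_{\tau_{B(0,\alpha R_n)}}\in B(0,10R_n)\right)\to 0 .$$ Then $X$ does not satisfy the elliptic Harnack inequality (EHI).
   Context: A Lévy process $X=(X_t)_{t\ge0}$ on $\mathbb{R}^d$ is a stochastic process with independent and stationary increments; it is assumed right-continuous with left limits. $\mathbb{P}_x$ and $\mathbb{E}_x$ denote probability and expectation for the process started at $X_0=x$. $X$ is isotropic unimodal if for every $t>0$ there is a non-increasing $m_t:(0,\infty)\to[0,\infty)$ with $\mathbb{P}(X_t-X_0\in A)=\int_A m_t(|x|)\,dx$ for all measurable $A$ with $0\notin A$. Jump density: for an isotropic unimodal Lévy process there is a non-increasing function $j:(0,\infty)\to[0,\infty)$ such that the Lévy measure of $X$ is $j(|x|)\,dx$ on $\mathbb{R}^d\setminus\{0\}$; that is, for measurable $A\subseteq\mathbb{R}^d\setminus\{0\}$ with $0<\int_A j(|x|)\,dx<\infty$, jumps with displacement in $A$ occur according to a Poisson process of rate $\int_A j(|x|)\,dx$. ($X$ may in addition have a diffusion component.) $B(x_0,r)$ is the open Euclidean ball in $\mathbb{R}^d$. For $U\subseteq\mathbb{R}^d$, $\tau_U:=\inf\{t\ge0:X_t\notin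 U\}$; an event of the form $\{X_{\tau_U}\in A\}$ is understood not to occur if $\tau_U=\infty$. Harmonicity: for open $D\subseteq\mathbb{R}^d$, a function $h:\mathbb{R}^d\to\mathbb{R}$ is harmonic on $D$ (with respect to $X$) if for every open set $E$ whose closure is compact and contained in $D$, $h(x)=\mathbb{E}_x[h(X_{\tau_E})]$ for all $x\in E$. EHI: $X$ satisfies EHI if there exist $C>0$ and $\kappa\in(0,1)$ such that for all $x_0\in\mathbb{R}^d$ and $r>0$, if $h$ is a non-negative function that is harmonic on $B(x_0,r)$, then $h(x)\le C\,h(y)$ for all $x,y\in B(x_0,\kappa r)$. (The validity of EHI does not depend on the choice of $\kappa\in(0,1)$.) *)

theory Defs
  imports "HOL-Probability.Probability"
begin

text \<open>
  Processes have the type \<^typ>\<open>real \<Rightarrow> 'w \<Rightarrow> 'a\<close>; only their values at times in \<open>[0,\<infinity>)\<close> matter.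
\<close>

definition cadlag :: "(real \<Rightarrow> 'a::topological_space) \<Rightarrow> bool" where
  "cadlag y \<longleftrightarrow>
     (\<forall>t\<ge>0. (y \<longlongrightarrow> y t) (at_right t)) \<and>
     (\<forall>t>0. \<exists>l. (y \<longlongrightarrow> l) (at_left t))"

definition levy_process :: "'w measure \<Rightarrow> (real \<Rightarrow> 'w \<Rightarrow> 'a::euclidean_space) \<Rightarrow> bool" where
  "levy_process M X \<longleftrightarrow>
     prob_space M \<and>
     (\<forall>t\<ge>0. X t \<in> borel_measurable M) \<and>
     (\<forall>t :: nat \<Rightarrow> real. 0 \<le> t 0 \<longrightarrow> mono t \<longrightarrow>
        prob_space.indep_vars M (\<lambda>_. borel) (\<lambda>i \<omega>. X (t (Suc i)) \<omega> - X (t i) \<omega>) UNIV) \<and>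
     (\<forall>s\<ge>0. \<forall>t\<ge>0.
        distr M borel (\<lambda>\<omega>. X (s + t) \<omega> - X s \<omega>) = distr M borel (\<lambda>\<omega>. X t \<omega> - X 0 \<omega>)) \<and>
     (\<forall>\<omega>\<in>space M. cadlag (\<lambda>t. X t \<omega>))"

definition isotropic_unimodal :: "'w measure \<Rightarrow> (real \<Rightarrow> 'w \<Rightarrow> 'a::euclidean_space) \<Rightarrow> bool" where
  "isotropic_unimodal M X \<longleftrightarrow>
     (\<forall>t>0. \<exists>m :: real \<Rightarrow> real. antimono_on {0<..} m \<and> (\<forall>r>0. 0 \<le> m r) \<and>
        (\<forall>A \<in> sets borel. 0 \<notin> A \<longrightarrow>
           emeasure M {\<omega> \<in> space M. X t \<omega> - X 0 \<omega> \<in> A} =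
           (\<integral>\<^sup>+ x\<in>A. ennreal (m (norm x)) \<partial>lborel)))"

definition jump :: "(real \<Rightarrow> 'a::real_normed_vector) \<Rightarrow> real \<Rightarrow> 'a" where
  "jump y t = y t - Lim (at_left t) y"

definition jump_times ::
    "(real \<Rightarrow> 'a::real_normed_vector) \<Rightarrow> 'a set \<Rightarrow> real \<Rightarrow> real \<Rightarrow> real set" where
  "jump_times y A s t = {u. s < u \<and> u \<le> t \<and> jump y u \<in> A}"

text \<open>
  The jumps of \<open>X\<close> with displacement in \<open>A\<close> form a Poisson process of rate \<open>\<rho> > 0\<close>. The process is
  described by its increments, the numbers of such jumps in the intervals \<open>(s,t]\<close>.
\<close>

definition poisson_jumps ::
    "'w measure \<Rightarrow> (real \<Rightarrow> 'w \<Rightarrow> 'a::real_normed_vector) \<Rightarrow> 'a set \<Rightarrow> real \<Rightarrow> bool" where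
  "poisson_jumps M X A \<rho> \<longleftrightarrow>
     (let N = (\<lambda>s t \<omega>. card (jump_times (\<lambda>u. X u \<omega>) A s t)) in
      (\<forall>t>0. AE \<omega> in M. finite (jump_times (\<lambda>u. X u \<omega>) A 0 t)) \<and>
      (\<forall>t :: nat \<Rightarrow> real. 0 \<le> t 0 \<longrightarrow> mono t \<longrightarrow>
         prob_space.indep_vars M (\<lambda>_. count_space UNIV) (\<lambda>i. N (t i) (t (Suc i))) UNIV) \<and>
      (\<forall>s\<ge>0. \<forall>t>s.
         distr M (count_space UNIV) (N s t) = measure_pmf (poisson_pmf (\<rho> * (t - s)))))"

text \<open>
  The Levy measure of \<open>X\<close> is \<open>j(|x|) dx\<close> on the complement of the origin. Rate zero is a separate
  clause because \<^const>\<open>poisson_pmf\<close> is only meaningful for positive rates; that clause excludes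
  jumps of any displacement when \<open>j\<close> vanishes identically.
\<close>

definition radial_jump_density ::
    "'w measure \<Rightarrow> (real \<Rightarrow> 'w \<Rightarrow> 'a::euclidean_space) \<Rightarrow> (real \<Rightarrow> real) \<Rightarrow> bool" where
  "radial_jump_density M X j \<longleftrightarrow>
     antimono_on {0<..} j \<and> (\<forall>r>0. 0 \<le> j r) \<and>
     (\<forall>A \<in> sets borel. 0 \<notin> A \<longrightarrow>
        (let \<nu> = (\<integral>\<^sup>+ x\<in>A. ennreal (j (norm x)) \<partial>(lborel :: 'a measure)) in
         (0 < \<nu> \<and> \<nu> < \<infinity> \<longrightarrow> poisson_jumps M X A (enn2real \<nu>)) \<and>
         (\<nu> = 0 \<longrightarrow> (AE \<omega> in M. \<forall>t>0. jump (\<lambda>u. X u \<omega>) t \<notin> A))))"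

text \<open>The path of \<open>X\<close> under \<open>\<bbbP>\<^sub>x\<close>: by translation invariance it is \<open>x + (X - X\<^sub>0)\<close>.\<close>

definition started_at ::
    "'a \<Rightarrow> (real \<Rightarrow> 'w \<Rightarrow> 'a::real_normed_vector) \<Rightarrow> 'w \<Rightarrow> real \<Rightarrow> 'a" where
  "started_at x X \<omega> t = x + (X t \<omega> - X 0 \<omega>)"

definition exit_time :: "(real \<Rightarrow> 'a) \<Rightarrow> 'a set \<Rightarrow> ereal" where
  "exit_time y U = Inf (ereal ` {t. 0 \<le> t \<and> y t \<notin> U})"

definition exit_point :: "(real \<Rightarrow> 'a) \<Rightarrow> 'a set \<Rightarrow> 'a" where
  "exit_point y U = y (real_of_ereal (exit_time y U))"

text \<open>
  Exit times from open sets are measurable only with respect to the completed sigma-algebra, so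
  probabilities and expectations of exit events are taken in \<^term>\<open>completion M\<close>.
  On the event that the exit time is infinite, \<open>h (X\<^sub>\<tau>)\<close> counts as \<open>0\<close>.
\<close>

definition exit_prob ::
    "'w measure \<Rightarrow> (real \<Rightarrow> 'w \<Rightarrow> 'a::real_normed_vector) \<Rightarrow> 'a \<Rightarrow> 'a set \<Rightarrow> 'a set \<Rightarrow> real" where
  "exit_prob M X x U A =
     measure (completion M)
       {\<omega> \<in> space M. exit_time (started_at x X \<omega>) U < \<infinity> \<and> exit_point (started_at x X \<omega>) U \<in> A}"

definition exit_value ::
    "('a \<Rightarrow> real) \<Rightarrow> (real \<Rightarrow> 'a) \<Rightarrow> 'a set \<Rightarrow> real" where
  "exit_value h y U = (if exit_time y U < \<infinity> then h (exit_point y U) else 0)"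

text \<open>
  Borel measurability of \<open>h\<close> and integrability of \<open>h (X\<^sub>\<tau>)\<close> make explicit that the expectation
  exists; the Bochner integral of a non-integrable function is \<open>0\<close>.
\<close>

definition harmonic_on ::
    "'w measure \<Rightarrow> (real \<Rightarrow> 'w \<Rightarrow> 'a::euclidean_space) \<Rightarrow> ('a \<Rightarrow> real) \<Rightarrow> 'a set \<Rightarrow> bool" where
  "harmonic_on M X h D \<longleftrightarrow>
     h \<in> borel_measurable borel \<and>
     (\<forall>E. open E \<and> compact (closure E) \<and> closure E \<subseteq> D \<longrightarrow>
        (\<forall>x\<in>E.
           integrable (completion M) (\<lambda>\<omega>. exit_value h (started_at x X \<omega>) E) \<and>
           h x = (\<integral>\<omega>. exit_value h (started_at x X \<omega>) E \<partial>completion M)))"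

definition EHI :: "'w measure \<Rightarrow> (real \<Rightarrow> 'w \<Rightarrow> 'a::euclidean_space) \<Rightarrow> bool" where
  "EHI M X \<longleftrightarrow>
     (\<exists>C>0. \<exists>\<kappa>. 0 < \<kappa> \<and> \<kappa> < 1 \<and>
        (\<forall>x0 r h. 0 < r \<longrightarrow> (\<forall>x. 0 \<le> h x) \<longrightarrow> harmonic_on M X h (ball x0 r) \<longrightarrow>
           (\<forall>x \<in> ball x0 (\<kappa> * r). \<forall>y \<in> ball x0 (\<kappa> * r). h x \<le> C * h y)))"

end

theory Submission
  imports Defs
begin

text \<open>
  Write \<open>L = \<alpha> R\<close> with \<open>R = R\<^sub>n\<close>, let \<open>A\<close> be the ball of radius \<open>L/10\<close> about \<open>0\<close>, let \<open>D\<close> be the annulus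
  \<open>5L/2 < |z| < 4R\<close> and \<open>h z = \<bbbP>\<^sub>z (X\<^sub>\<tau>\<^sub>D \<in> A)\<close>, which is harmonic on \<open>D\<close> by the strong Markov property.
  If \<open>T\<close> denotes the mean exit time of the process from a ball of radius \<open>L\<close>, then jumping directly into
  \<open>A\<close> from a ball at distance about \<open>s\<close> has probability of order \<open>T |A| j(s)\<close>. Hence \<open>h x \<ge> const T |A| j(c R)\<close>
  for \<open>|x| = 18L/5\<close>, because \<open>5L < c R\<close>. From \<open>|z| \<ge> 2R\<close> the process can reach \<open>A\<close> in three ways: directly, with
  probability \<open>O(T |A| j(R))\<close>; through \<open>|z| < 3L\<close>, where the first jump costs \<open>O(T |A| j(R))\<close> as well; or through
  the rest of \<open>D\<close>, which it hits on leaving the \<open>L\<close>-ball with probability at most \<open>\<epsilon>\<^sub>n \<rightarrow> 0\<close>, and where the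
  Harnack inequality bounds \<open>h\<close> by a multiple of \<open>sup {h z | |z| \<ge> 2R}\<close>. So this supremum is
  \<open>O(T |A| j(R))\<close>, and a Harnack chain from \<open>x\<close> to a point \<open>y\<close> with \<open>|y| = 2R\<close> gives \<open>j(c R) = O(j(R))\<close>, contrary
  to the assumption.
\<close>

section \<open>Measures on path space\<close>

text \<open>The hypotheses give laws of increments and Poisson counts of jumps, not a Levy system
  formula. Jump rates out of a set are therefore recovered from dyadic skeletons:
  \<open>2 ^ k\<close> times the radial density of a step of length \<open>1 / 2 ^ k\<close> lies
  asymptotically between values of \<open>j\<close> at slightly different radii. As \<open>j\<close>
  is merely monotone, each estimate loses a little in the radius, which is why the geometric
  constants leave strict gaps (23/10 < 47/20 < 12/5, or 93/20 < 5). The value of \<open>T\<close>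
  stays unknown; upper and lower bounds contain the same \<open>T\<close> and comparable volumes,
  and these cancel. A second obstacle is measurability: exit times are replaced by a measurable
  functional of the values at rational times, and quasi-left-continuity makes the two agree almost
  surely. The Harnack constant must not depend on \<open>R\<close> although the process need not
  scale; EHI has the same constants for all radii, and all annuli are rescaled to one compact set.
  The number 5 comes from the lower bound: the ball of radius \<open>L\<close> about
  \<open>x\<close> must lie in \<open>D\<close> and yet be closer than \<open>c R\<close> to the
  target.\<close>

lemma (in prob_space) indep_var_PiM_finite:
  fixes U :: "'a \<Rightarrow> 'i \<Rightarrow> 'b" and V :: "'a \<Rightarrow> 'i \<Rightarrow> 'b"
  assumes U: "random_variable (PiM I N) U" and V: "random_variable (PiM K N') V"
    and fin: "\<And>J L. finite J \<Longrightarrow> finite L \<Longrightarrow> J \<subseteq> I \<Longrightarrow> L \<subseteq> K \<Longrightarrow>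
      indep_var (PiM J N) (\<lambda>\<omega>. restrict (U \<omega>) J) (PiM L N') (\<lambda>\<omega>. restrict (V \<omega>) L)"
  shows "indep_var (PiM I N) U (PiM K N') V"
proof -
  have gen: "sigma_sets (space M) {Z -` A \<inter> space M |A. A \<in> sets (PiM I' N'')}
      = sigma_sets (space M) {Z -` A \<inter> space M |A. A \<in> prod_algebra I' N''}"
    if Z: "Z \<in> measurable M (PiM I' N'')" for Z and I' :: "'i set" and N'' :: "'i \<Rightarrow> 'b measure"
  proof -
    have "Z \<in> space M \<rightarrow> (\<Pi>\<^sub>E i\<in>I'. space (N'' i))"
      using measurable_space[OF Z] by (auto simp: space_PiM)
    from sigma_sets_vimage_commute[OF this, of "prod_algebra I' N''"]
    have "{Z -` A \<inter> space M |A. A \<in> sets (PiM I' N'')}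
        = sigma_sets (space M) {Z -` A \<inter> space M |A. A \<in> prod_algebra I' N''}"
      by (simp add: sets_PiM)
    then show ?thesis
      by (simp only:) (rule sigma_sets_sigma_sets_eq, auto)
  qed
  have stable: "Int_stable {Z -` A \<inter> space M |A. A \<in> prod_algebra I' N''}"
    for Z :: "'a \<Rightarrow> 'i \<Rightarrow> 'b" and I' :: "'i set" and N'' :: "'i \<Rightarrow> 'b measure"
  proof (rule Int_stableI, safe)
    fix A B assume "A \<in> prod_algebra I' N''" "B \<in> prod_algebra I' N''"
    then show "\<exists>C. (Z -` A \<inter> space M) \<inter> (Z -` B \<inter> space M) = Z -` C \<inter> space M \<and> C \<in> prod_algebra I' N''"
      using Int_stable_prod_algebra[of I' N''] by (intro exI[of _ "A \<inter> B"]) (auto simp: Int_stable_def)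
  qed
  \<comment> \<open>Preimages of cylinders form intersection-stable generators, so independence need
    only be checked on them, where finitely many coordinates are involved.\<close>
  have "indep_set {U -` A \<inter> space M |A. A \<in> prod_algebra I N} {V -` A \<inter> space M |A. A \<in> prod_algebra K N'}"
    unfolding indep_sets2_eq
  proof (intro conjI ballI subsetI)
    fix a assume "a \<in> {U -` A \<inter> space M |A. A \<in> prod_algebra I N}"
    then show "a \<in> events" using measurable_sets[OF U] by (auto simp: sets_PiM)
  next
    fix a assume "a \<in> {V -` A \<inter> space M |A. A \<in> prod_algebra K N'}"
    then show "a \<in> events" using measurable_sets[OF V] by (auto simp: sets_PiM)
  next
    fix a b assume "a \<in> {U -` A \<inter> space M |A. A \<in> prod_algebra I N}" "b \<in> {V -` A \<inter> space M |A. A \<in> prod_algebra K N'}"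
    then obtain A B where A: "A \<in> prod_algebra I N" "a = U -` A \<inter> space M"
      and B: "B \<in> prod_algebra K N'" "b = V -` B \<inter> space M" by auto
    obtain J E where J: "A = prod_emb I N J (PiE J E)" "finite J" "J \<noteq> {} \<or> I = {}" "J \<subseteq> I" "\<And>i. i \<in> J \<Longrightarrow> E i \<in> sets (N i)"
      by (rule prod_algebraE[OF A(1)], rule that)
    obtain L F where L: "B = prod_emb K N' L (PiE L F)" "finite L" "L \<noteq> {} \<or> K = {}" "L \<subseteq> K" "\<And>i. i \<in> L \<Longrightarrow> F i \<in> sets (N' i)"
      by (rule prod_algebraE[OF B(1)], rule that)
    have a: "a = (\<lambda>\<omega>. restrict (U \<omega>) J) -` PiE J E \<inter> space M"
      using measurable_space[OF U] unfolding A(2) J(1) prod_emb_def by (auto simp: space_PiM)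
    have b: "b = (\<lambda>\<omega>. restrict (V \<omega>) L) -` PiE L F \<inter> space M"
      using measurable_space[OF V] unfolding B(2) L(1) prod_emb_def by (auto simp: space_PiM)
    have E: "PiE J E \<in> sets (PiM J N)" "PiE L F \<in> sets (PiM L N')"
      using J L by (auto intro!: sets_PiM_I_finite)
    have ab: "(\<lambda>\<omega>. (restrict (U \<omega>) J, restrict (V \<omega>) L)) -` (PiE J E \<times> PiE L F) \<inter> space M = a \<inter> b"
      unfolding a b by blast
    show "prob (a \<inter> b) = prob a * prob b"
      using indep_varD[OF fin[OF J(2) L(2) J(4) L(4)] E] unfolding ab by (simp flip: a b)
  qed
  then show ?thesis
    unfolding indep_var_eq gen[OF U] gen[OF V] using U V
    by (auto intro!: indep_set_sigma_sets stable)
qed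

text \<open>Indicators of closed cylinders are limits of products of continuous functions with
  values in [0,1], and closed cylinders generate. Continuous test functions are what
  right-continuity of paths can handle when random times are approximated by dyadic ones.\<close>

lemma measure_eqI_PiM_continuous:
  fixes P Q :: "('i \<Rightarrow> 'a::metric_space) measure"
  assumes P: "sets P = sets (PiM I (\<lambda>_. borel))" and Q: "sets Q = sets (PiM I (\<lambda>_. borel))"
    and fin: "finite_measure P"
    and eq: "\<And>J f. finite J \<Longrightarrow> J \<subseteq> I \<Longrightarrow> (\<And>i. continuous_on UNIV (f i)) \<Longrightarrow>
      (\<And>i z. 0 \<le> f i z \<and> f i z \<le> (1::real)) \<Longrightarrow>
      (\<integral>\<^sup>+w. ennreal (\<Prod>i\<in>J. f i (w i)) \<partial>P) = (\<integral>\<^sup>+w. ennreal (\<Prod>i\<in>J. f i (w i)) \<partial>Q)"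
  shows "P = Q"
proof -
  let ?W = "PiM I (\<lambda>_. borel :: 'a measure)"
  define E where "E = {{f \<in> (\<Pi>\<^sub>E i\<in>I. UNIV). \<forall>i\<in>J. f i \<in> A i} | A J. finite J \<and> J \<subseteq> I \<and> A \<in> J \<rightarrow> Collect (closed :: 'a set \<Rightarrow> bool)}"
  interpret P: finite_measure P by fact
  have spP: "space P = (\<Pi>\<^sub>E i\<in>I. UNIV)" and spQ: "space Q = (\<Pi>\<^sub>E i\<in>I. UNIV)"
    using sets_eq_imp_space_eq[OF P] sets_eq_imp_space_eq[OF Q] by (auto simp: space_PiM)
  have cov: "\<exists>S\<subseteq>Collect (closed :: 'a set \<Rightarrow> bool). countable S \<and> UNIV = \<Union>S"
    by (intro exI[of _ "{UNIV}"]) auto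
  have fin_un: "\<Union>{J. finite J \<and> J \<subseteq> I} = I"
    by (auto intro!: exI[of _ "{x}" for x])
  have "sets (\<Pi>\<^sub>M i\<in>I. sigma UNIV (Collect (closed :: 'a set \<Rightarrow> bool))) =
      sets (sigma (\<Pi>\<^sub>E i\<in>I. UNIV) {{f \<in> \<Pi>\<^sub>E i\<in>I. UNIV. \<forall>i\<in>j. f i \<in> A i} |A j. j \<in> {J. finite J \<and> J \<subseteq> I} \<and> A \<in> j \<rightarrow> Collect closed})"
    using fin_un by (intro sets_PiM_sigma cov) auto
  then have gen: "sets ?W = sigma_sets (\<Pi>\<^sub>E i\<in>I. UNIV) E"
    unfolding E_def borel_eq_closed[symmetric] by (subst (asm) sets_measure_of) (auto simp: conj_ac)
  show ?thesis
  proof (rule measure_eqI_generator_eq)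
    show "Int_stable E"
    proof (rule Int_stableI)
      fix a b assume "a \<in> E" "b \<in> E"
      then obtain A J B K where a: "a = {f \<in> (\<Pi>\<^sub>E i\<in>I. UNIV). \<forall>i\<in>J. f i \<in> A i}" "finite J" "J \<subseteq> I" "A \<in> J \<rightarrow> Collect closed"
        and b: "b = {f \<in> (\<Pi>\<^sub>E i\<in>I. UNIV). \<forall>i\<in>K. f i \<in> B i}" "finite K" "K \<subseteq> I" "B \<in> K \<rightarrow> Collect closed"
        unfolding E_def by auto
      have "a \<inter> b = {f \<in> (\<Pi>\<^sub>E i\<in>I. UNIV). \<forall>i\<in>J \<union> K. f i \<in> (if i \<in> J then A i else UNIV) \<inter> (if i \<in> K then B i else UNIV)}"
        unfolding a(1) b(1) by auto
      moreover have "(\<lambda>i. (if i \<in> J then A i else UNIV) \<inter> (if i \<in> K then B i else UNIV)) \<in> J \<union> K \<rightarrow> Collect closed"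
        using a(4) b(4) by (auto intro!: closed_Int)
      ultimately show "a \<inter> b \<in> E"
        unfolding E_def using a(2,3) b(2,3)
        by (intro CollectI exI[of _ "\<lambda>i. (if i \<in> J then A i else UNIV) \<inter> (if i \<in> K then B i else UNIV)"]
            exI[of _ "J \<union> K"] conjI) simp_all
    qed
    show "E \<subseteq> Pow (\<Pi>\<^sub>E i\<in>I. UNIV)" unfolding E_def by auto
    show "sets P = sigma_sets (\<Pi>\<^sub>E i\<in>I. UNIV) E" "sets Q = sigma_sets (\<Pi>\<^sub>E i\<in>I. UNIV) E"
      using P Q gen by auto
    show "range (\<lambda>_::nat. \<Pi>\<^sub>E i\<in>I. UNIV) \<subseteq> E"
      unfolding E_def by (auto intro!: exI[of _ "{}"])
    show "(\<Union>i::nat. \<Pi>\<^sub>E i\<in>I. UNIV) = (\<Pi>\<^sub>E i\<in>I. UNIV)" by simp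
    show "\<And>i::nat. emeasure P (\<Pi>\<^sub>E i\<in>I. UNIV) \<noteq> \<infinity>" by simp
    have lim: "(\<lambda>n. \<integral>\<^sup>+w. ennreal (\<Prod>i\<in>J. max 0 (1 - real n * infdist (w i) (A i))) \<partial>R) \<longlonglongrightarrow>
        emeasure R {f \<in> (\<Pi>\<^sub>E i\<in>I. UNIV). \<forall>i\<in>J. f i \<in> A i}"
      if R: "sets R = sets ?W" "emeasure R (space R) < \<infinity>" and J: "finite J" "J \<subseteq> I" "\<And>i. i \<in> J \<Longrightarrow> closed (A i)" "\<And>i. i \<in> J \<Longrightarrow> A i \<noteq> {}"
      for R J and A :: "'i \<Rightarrow> 'a set"
    proof -
      note R(1)[measurable_cong]
      have spR: "space R = (\<Pi>\<^sub>E i\<in>I. UNIV)"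
        using sets_eq_imp_space_eq[OF R(1)] by (auto simp: space_PiM)
      have m[measurable]: "(\<lambda>w. w i) \<in> R \<rightarrow>\<^sub>M borel" if "i \<in> J" for i
        using that J(2) by (auto intro: measurable_component_singleton)
      have m2[measurable]: "(\<lambda>w. infdist (w i) (A i)) \<in> borel_measurable R" if "i \<in> J" for i
        using measurable_compose[OF m[OF that] borel_measurable_continuous_onI[OF continuous_on_infdist[OF continuous_on_id]]] .
      have *: "(\<lambda>n. \<Prod>i\<in>J. max 0 (1 - real n * infdist (w i) (A i))) \<longlonglongrightarrow> (\<Prod>i\<in>J. indicator (A i) (w i))" for w
      proof (rule tendsto_prod)
        fix i assume i: "i \<in> J"
        show "(\<lambda>n. max 0 (1 - real n * infdist (w i) (A i))) \<longlonglongrightarrow> indicator (A i) (w i)"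
        proof (cases "w i \<in> A i")
          case False
          then have p: "infdist (w i) (A i) > 0"
            using J(3,4)[OF i] in_closed_iff_infdist_zero infdist_nonneg by (metis less_eq_real_def)
          then obtain N where "1 / infdist (w i) (A i) < real N" using reals_Archimedean2 by blast
          then have "1 \<le> real n * infdist (w i) (A i)" if "n \<ge> N" for n
            using p that by (simp add: field_simps) (smt (verit, best) mult_right_mono of_nat_mono mult.commute)
          then have "max 0 (1 - real n * infdist (w i) (A i)) = 0" if "n \<ge> N" for n
            using that by simp
          then have "eventually (\<lambda>n. max 0 (1 - real n * infdist (w i) (A i)) = 0) sequentially"
            unfolding eventually_sequentially by blast
          then show ?thesis using False by (simp add: tendsto_eventually)
        qed simp
      qed
      have ind: "ennreal (\<Prod>i\<in>J. indicator (A i) (w i)) = indicator {f \<in> (\<Pi>\<^sub>E i\<in>I. UNIV). \<forall>i\<in>J. f i \<in> A i} w"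
        if "w \<in> space R" for w
      proof (cases "\<forall>i\<in>J. w i \<in> A i")
        case True
        then show ?thesis using that by (simp add: spR)
      next
        case False
        then have "(\<Prod>i\<in>J. indicator (A i) (w i)) = (0::real)"
          using J(1) by (intro prod_zero) (auto simp: indicator_def)
        then show ?thesis using False by auto
      qed
      have "(\<lambda>n. \<integral>\<^sup>+w. ennreal (\<Prod>i\<in>J. max 0 (1 - real n * infdist (w i) (A i))) \<partial>R) \<longlonglongrightarrow>
          (\<integral>\<^sup>+w. ennreal (\<Prod>i\<in>J. indicator (A i) (w i)) \<partial>R)"
      proof (rule nn_integral_dominated_convergence[where w="\<lambda>_. 1"])
        show "(\<lambda>w. ennreal (\<Prod>i\<in>J. max 0 (1 - real n * infdist (w i) (A i)))) \<in> borel_measurable R" for n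
          by (intro measurable_compose[OF _ measurable_ennreal] borel_measurable_prod) measurable
        show "(\<lambda>w. ennreal (\<Prod>i\<in>J. indicator (A i) (w i))) \<in> borel_measurable R"
        proof (intro measurable_compose[OF _ measurable_ennreal] borel_measurable_prod)
          fix i assume i: "i \<in> J"
          have "A i \<in> sets borel" using J(3)[OF i] by simp
          then show "(\<lambda>w. indicator (A i) (w i) :: real) \<in> borel_measurable R"
            by (intro measurable_compose[OF m[OF i]] borel_measurable_indicator)
        qed
        show "AE w in R. ennreal (\<Prod>i\<in>J. max 0 (1 - real n * infdist (w i) (A i))) \<le> 1" for n
          proof (intro AE_I2)
            fix w :: "'i \<Rightarrow> 'a"
            have "(\<Prod>i\<in>J. max 0 (1 - real n * infdist (w i) (A i))) \<le> 1"
              by (intro prod_le_1) (simp add: infdist_nonneg)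
            then show "ennreal (\<Prod>i\<in>J. max 0 (1 - real n * infdist (w i) (A i))) \<le> 1"
              by simp
          qed
        show "(\<integral>\<^sup>+ x. 1 \<partial>R) < \<infinity>" using R(2) by simp
        show "AE w in R. (\<lambda>n. ennreal (\<Prod>i\<in>J. max 0 (1 - real n * infdist (w i) (A i)))) \<longlonglongrightarrow> ennreal (\<Prod>i\<in>J. indicator (A i) (w i))"
          by (intro AE_I2 tendsto_ennrealI *)
      qed simp
      also have "(\<integral>\<^sup>+w. ennreal (\<Prod>i\<in>J. indicator (A i) (w i)) \<partial>R) = (\<integral>\<^sup>+w. indicator {f \<in> (\<Pi>\<^sub>E i\<in>I. UNIV). \<forall>i\<in>J. f i \<in> A i} w \<partial>R)"
        by (rule nn_integral_cong) (rule ind)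
      also have "\<dots> = emeasure R {f \<in> (\<Pi>\<^sub>E i\<in>I. UNIV). \<forall>i\<in>J. f i \<in> A i}"
      proof (rule nn_integral_indicator)
        have "{f \<in> space R. \<forall>i\<in>J. f i \<in> A i} \<in> sets R"
        proof (rule sets.sets_Collect_finite_All[OF _ J(1)])
          fix i assume i: "i \<in> J"
          have "A i \<in> sets borel" using J(3)[OF i] by simp
          then show "{f \<in> space R. f i \<in> A i} \<in> sets R"
            using measurable_sets[OF m[OF i], of "A i"] by (simp add: vimage_def Int_def conj_commute)
        qed
        then show "{f \<in> (\<Pi>\<^sub>E i\<in>I. UNIV). \<forall>i\<in>J. f i \<in> A i} \<in> sets R" by (simp add: spR)
      qed
      finally show ?thesis .
    qed
    have tot: "emeasure Q (space Q) < \<infinity>"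
      using eq[of "{}" "\<lambda>_ _. 1"] P.emeasure_finite[of "space P"] by (simp add: less_top)
    fix X assume "X \<in> E"
    then obtain A J where X: "X = {f \<in> (\<Pi>\<^sub>E i\<in>I. UNIV). \<forall>i\<in>J. f i \<in> A i}" "finite J" "J \<subseteq> I" "A \<in> J \<rightarrow> Collect closed"
      unfolding E_def by auto
    show "emeasure P X = emeasure Q X"
    \<comment> \<open>\<open>infdist\<close> to the empty set is 0 by convention, so the
      approximating functions would be 1 there instead of 0.\<close>
    proof (cases "\<exists>i\<in>J. A i = {}")
      case True
      then have "X = {}" using X(1) by auto
      then show ?thesis by simp
    next
      case False
      have "(\<integral>\<^sup>+w. ennreal (\<Prod>i\<in>J. max 0 (1 - real n * infdist (w i) (A i))) \<partial>P) =
          (\<integral>\<^sup>+w. ennreal (\<Prod>i\<in>J. max 0 (1 - real n * infdist (w i) (A i))) \<partial>Q)" for n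
      proof (rule eq[OF X(2,3)])
        show "continuous_on UNIV (\<lambda>z. max 0 (1 - real n * infdist z (A i)))" for i
          by (intro continuous_on_max continuous_on_diff continuous_on_mult continuous_on_const
              continuous_on_infdist continuous_on_id)
        show "0 \<le> max 0 (1 - real n * infdist z (A i)) \<and> max 0 (1 - real n * infdist z (A i)) \<le> 1" for i z
          by (simp add: infdist_nonneg)
      qed
      moreover have "emeasure P (space P) < \<infinity>"
        using P.emeasure_finite[of "space P"] by (simp only: less_top infinity_ennreal_def)
      ultimately show ?thesis
        using lim[OF P _ X(2,3), of A] lim[OF Q tot X(2,3), of A] X(4) False unfolding X(1)
        by (auto simp: Pi_iff intro!: LIMSEQ_unique)
    qed
  qed
qed

section \<open>Levy processes\<close>

text \<open>Independence of increments is postulated along infinite monotone sequences of times; a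
  finite set of times is embedded in one by repeating its largest element forever.\<close>

lemma finite_subset_range_mono:
  fixes G :: "real set"
  assumes "finite G" "G \<subseteq> {0..}" "0 \<in> G"
  shows "\<exists>g :: nat \<Rightarrow> real. mono g \<and> g 0 = 0 \<and> G \<subseteq> range g"
proof -
  define l where "l = sorted_list_of_set G"
  have l: "set l = G" "sorted l" using assms(1) by (auto simp: l_def)
  have ne: "length l > 0" using l(1) assms(3) by auto
  define g where "g i = l ! (min i (length l - 1))" for i
  have "mono g"
  proof (rule monoI)
    fix i k :: nat assume "i \<le> k"
    then have "min i (length l - 1) \<le> min k (length l - 1)" by simp
    moreover have "min k (length l - 1) < length l" using ne by linarith
    ultimately show "g i \<le> g k" unfolding g_def by (rule sorted_nth_mono[OF l(2)])
  qed
  moreover have rng: "G \<subseteq> range g"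
  proof
    fix x assume "x \<in> G"
    then obtain i where "i < length l" "x = l ! i" using l(1) by (metis in_set_conv_nth)
    then have "min i (length l - 1) = i" by linarith
    then have "x = g i" using \<open>x = l ! i\<close> by (simp add: g_def)
    then show "x \<in> range g" by simp
  qed
  moreover have "g 0 = 0"
  proof -
    obtain i where "0 = g i" using assms(3) rng by blast
    then have "g 0 \<le> 0" using monoD[OF \<open>mono g\<close>, of 0 i] by simp
    moreover have "g 0 \<in> G" using ne l(1) by (auto simp: g_def)
    ultimately show ?thesis using assms(2) by auto
  qed
  ultimately show ?thesis by blast
qed

lemma distr_PiM_eqI:
  assumes [measurable]: "U \<in> M \<rightarrow>\<^sub>M PiM I N" "V \<in> M' \<rightarrow>\<^sub>M PiM I N" and M: "finite_measure M"
    and eq: "\<And>J. finite J \<Longrightarrow> J \<subseteq> I \<Longrightarrow>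
      distr M (PiM J N) (\<lambda>\<omega>. restrict (U \<omega>) J) = distr M' (PiM J N) (\<lambda>\<omega>. restrict (V \<omega>) J)"
  shows "distr M (PiM I N) U = distr M' (PiM I N) V"
proof (rule measure_eqI_PiM_infinite)
  interpret finite_measure M by fact
  show "finite_measure (distr M (PiM I N) U)" by (rule finite_measure_distr) fact
  fix A J assume J: "finite J" "J \<subseteq> I" "\<And>i. i \<in> J \<Longrightarrow> A i \<in> sets (N i)"
  have emb: "emeasure (distr R (PiM I N) Z) (prod_emb I N J (Pi\<^sub>E J A))
      = emeasure (distr R (PiM J N) (\<lambda>\<omega>. restrict (Z \<omega>) J)) (Pi\<^sub>E J A)"
    if [measurable]: "Z \<in> R \<rightarrow>\<^sub>M PiM I N" for R Z
  proof -
    have S: "Pi\<^sub>E J A \<in> sets (PiM J N)" using J by (auto intro!: sets_PiM_I_finite)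
    have "(\<lambda>\<omega>. restrict (Z \<omega>) J) \<in> R \<rightarrow>\<^sub>M PiM J N"
      using measurable_compose[OF that measurable_restrict_subset[OF J(2)]] .
    moreover have "Z -` prod_emb I N J (Pi\<^sub>E J A) \<inter> space R = (\<lambda>\<omega>. restrict (Z \<omega>) J) -` Pi\<^sub>E J A \<inter> space R"
      using measurable_space[OF that] by (auto simp: prod_emb_def space_PiM)
    ultimately show ?thesis
      using J S by (simp add: emeasure_distr sets_PiM_I)
  qed
  show "emeasure (distr M (PiM I N) U) (prod_emb I N J (Pi\<^sub>E J A)) = emeasure (distr M' (PiM I N) V) (prod_emb I N J (Pi\<^sub>E J A))"
    by (simp add: emb eq[OF J(1,2)])
qed auto

locale levy =
  fixes M :: "'w measure" and X :: "real \<Rightarrow> 'w \<Rightarrow> 'a::euclidean_space"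
  assumes levy: "levy_process M X"
begin

sublocale prob_space M
  using levy by (simp add: levy_process_def)

definition Y :: "real \<Rightarrow> 'w \<Rightarrow> 'a" where "Y t \<omega> = X t \<omega> - X 0 \<omega>"

abbreviation W :: "(real \<Rightarrow> 'a) measure" where "W \<equiv> PiM {0..} (\<lambda>_. borel)"

text \<open>Stopping the path at \<open>t\<close> instead of restricting it keeps all pasts in the
  one path space \<open>W\<close>. The future is recentred at 0, so that its law is
  \<open>PW\<close> for every \<open>t\<close>.\<close>

definition past :: "real \<Rightarrow> 'w \<Rightarrow> real \<Rightarrow> 'a" where "past t \<omega> = (\<lambda>s\<in>{0..}. Y (min s t) \<omega>)"

definition fut :: "real \<Rightarrow> 'w \<Rightarrow> real \<Rightarrow> 'a" where "fut t \<omega> = (\<lambda>s\<in>{0..}. Y (t + s) \<omega> - Y t \<omega>)"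

definition PW :: "(real \<Rightarrow> 'a) measure" where "PW = distr M W (fut 0)"

lemma Y_measurable[measurable]: "0 \<le> t \<Longrightarrow> Y t \<in> borel_measurable M"
  using levy unfolding Y_def levy_process_def by (intro borel_measurable_diff) simp_all

lemma Y_zero[simp]: "Y 0 \<omega> = 0"
  by (simp add: Y_def)

lemma Y_cadlag: "\<omega> \<in> space M \<Longrightarrow> cadlag (\<lambda>t. Y t \<omega>)"
proof -
  assume "\<omega> \<in> space M"
  then have c: "cadlag (\<lambda>t. X t \<omega>)" using levy by (simp add: levy_process_def)
  show ?thesis
    unfolding cadlag_def Y_def
  proof (intro conjI allI impI)
    fix t :: real
    show "((\<lambda>t. X t \<omega> - X 0 \<omega>) \<longlongrightarrow> X t \<omega> - X 0 \<omega>) (at_right t)" if "0 \<le> t"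
      using c that unfolding cadlag_def by (intro tendsto_diff tendsto_const) auto
    assume "0 < t"
    then obtain l where "((\<lambda>t. X t \<omega>) \<longlongrightarrow> l) (at_left t)"
      using c unfolding cadlag_def by blast
    then have "((\<lambda>t. X t \<omega> - X 0 \<omega>) \<longlongrightarrow> l - X 0 \<omega>) (at_left t)"
      by (intro tendsto_diff tendsto_const)
    then show "\<exists>l. ((\<lambda>t. X t \<omega> - X 0 \<omega>) \<longlongrightarrow> l) (at_left t)" by blast
  qed
qed

lemma Y_right: "\<omega> \<in> space M \<Longrightarrow> 0 \<le> t \<Longrightarrow> ((\<lambda>s. Y s \<omega>) \<longlongrightarrow> Y t \<omega>) (at_right t)"
  using Y_cadlag by (simp add: cadlag_def)

lemma indep_increments:
  "mono g \<Longrightarrow> 0 \<le> g 0 \<Longrightarrow> indep_vars (\<lambda>_. borel) (\<lambda>i \<omega>. Y (g (Suc i)) \<omega> - Y (g i) \<omega>) UNIV"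
  using levy unfolding Y_def levy_process_def by simp

lemma distr_increment:
  "0 \<le> s \<Longrightarrow> 0 \<le> t \<Longrightarrow> distr M borel (\<lambda>\<omega>. Y (s + t) \<omega> - Y s \<omega>) = distr M borel (Y t)"
  using levy unfolding Y_def[abs_def] levy_process_def by simp

lemma past_measurable[measurable]: "0 \<le> t \<Longrightarrow> past t \<in> M \<rightarrow>\<^sub>M W"
  unfolding past_def by (intro measurable_restrict Y_measurable) auto

lemma fut_measurable[measurable]: "0 \<le> t \<Longrightarrow> fut t \<in> M \<rightarrow>\<^sub>M W"
  unfolding fut_def by (intro measurable_restrict borel_measurable_diff Y_measurable) auto

lemma prob_space_PW: "prob_space PW"
  unfolding PW_def by (rule prob_space_distr) (rule fut_measurable[OF order_refl])

lemma sets_PW[measurable_cong]: "sets PW = sets W"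
  by (simp add: PW_def)

text \<open>Increments along a sequence of times are independent and stationarity fixes each of
  their laws, so their joint law is a product that does not see the shift \<open>t\<close>. Finitely
  many path values are partial sums of these increments.\<close>

lemma distr_fut:
  assumes t: "0 \<le> t"
  shows "distr M W (fut t) = PW"
  unfolding PW_def
proof (rule distr_PiM_eqI)
  fix K :: "real set" assume K: "finite K" "K \<subseteq> {0..}"
  obtain g :: "nat \<Rightarrow> real" where g: "mono g" "g 0 = 0" "insert 0 K \<subseteq> range g"
    using finite_subset_range_mono[of "insert 0 K"] K by auto
  have gK: "\<exists>i. u = g i" if "u \<in> K" for u using g(3) that by blast
  then obtain l where l: "\<And>u. u \<in> K \<Longrightarrow> g (l u) = u" by metis
  have g0: "0 \<le> g i" for i using monoD[OF g(1), of 0 i] g(2) by simp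
  define D where "D r i \<omega> = Y (r + g (Suc i)) \<omega> - Y (r + g i) \<omega>" for r i \<omega>
  have Dm: "D r i \<in> borel_measurable M" if "0 \<le> r" for r i
    using that g0 unfolding D_def[abs_def] by (intro borel_measurable_diff Y_measurable) (simp_all add: add_nonneg_nonneg)
  have law: "distr M (PiM UNIV (\<lambda>_. borel)) (\<lambda>\<omega>. \<lambda>i\<in>UNIV. D r i \<omega>) = PiM UNIV (\<lambda>i. distr M borel (Y (g (Suc i) - g i)))"
    if r: "0 \<le> r" for r
  proof -
    have "indep_vars (\<lambda>_. borel) (D r) UNIV"
      using indep_increments[of "\<lambda>i. r + g i"] g r unfolding D_def[abs_def] by (auto simp: mono_def)
    then have "distr M (PiM UNIV (\<lambda>_. borel)) (\<lambda>\<omega>. \<lambda>i\<in>UNIV. D r i \<omega>) = PiM UNIV (\<lambda>i. distr M borel (D r i))"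
      using Dm[OF r] by (subst (asm) indep_vars_iff_distr_eq_PiM) auto
    moreover have "distr M borel (D r i) = distr M borel (Y (g (Suc i) - g i))" for i
      using distr_increment[of "r + g i" "g (Suc i) - g i"] r g0[of i] monoD[OF g(1), of i "Suc i"]
      by (simp add: D_def[abs_def])
    ultimately show ?thesis by simp
  qed
  define \<phi> where "\<phi> d = (\<lambda>u\<in>K. \<Sum>i<l u. d i)" for d :: "nat \<Rightarrow> 'a"
  have \<phi>: "\<phi> \<in> PiM UNIV (\<lambda>_. borel) \<rightarrow>\<^sub>M PiM K (\<lambda>_. borel)"
    unfolding \<phi>_def by (intro measurable_restrict borel_measurable_sum) simp
  have eq: "distr M (PiM K (\<lambda>_. borel)) (\<lambda>\<omega>. restrict (fut r \<omega>) K)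
      = distr (distr M (PiM UNIV (\<lambda>_. borel)) (\<lambda>\<omega>. \<lambda>i\<in>UNIV. D r i \<omega>)) (PiM K (\<lambda>_. borel)) \<phi>" if r: "0 \<le> r" for r
  proof -
    have m: "(\<lambda>\<omega>. \<lambda>i\<in>UNIV. D r i \<omega>) \<in> M \<rightarrow>\<^sub>M PiM UNIV (\<lambda>_. borel)"
      using Dm[OF r] by (intro measurable_restrict)
    have "restrict (fut r \<omega>) K = \<phi> (\<lambda>i\<in>UNIV. D r i \<omega>)" for \<omega>
    proof
      fix u
      have "(\<Sum>i<l u. D r i \<omega>) = Y (r + g (l u)) \<omega> - Y (r + g 0) \<omega>"
        unfolding D_def by (rule sum_lessThan_telescope)
      then show "restrict (fut r \<omega>) K u = \<phi> (\<lambda>i\<in>UNIV. D r i \<omega>) u"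
        using l[of u] g(2) K(2) by (cases "u \<in> K") (auto simp: \<phi>_def fut_def)
    qed
    then show ?thesis by (simp add: distr_distr[OF \<phi> m] comp_def)
  qed
  show "distr M (PiM K (\<lambda>_. borel)) (\<lambda>\<omega>. restrict (fut t \<omega>) K) = distr M (PiM K (\<lambda>_. borel)) (\<lambda>\<omega>. restrict (fut 0 \<omega>) K)"
    by (simp add: eq t law)
qed (rule fut_measurable t order_refl finite_measure_axioms)+

text \<open>All relevant times are placed in one monotone sequence passing through \<open>t\<close>
  at index \<open>p\<close>: the past is a function of the increments before \<open>p\<close>, the
  future of those from \<open>p\<close> on, and the two blocks are independent.\<close>

lemma indep_past_fut:
  assumes t: "0 \<le> t"
  shows "indep_var W (past t) W (fut t)"
proof (rule indep_var_PiM_finite)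
  fix J K :: "real set" assume J: "finite J" "J \<subseteq> {0..}" and K: "finite K" "K \<subseteq> {0..}"
  obtain g :: "nat \<Rightarrow> real" where g: "mono g" "g 0 = 0" "{0, t} \<union> (\<lambda>s. min s t) ` J \<union> (\<lambda>u. t + u) ` K \<subseteq> range g"
    using finite_subset_range_mono[of "{0, t} \<union> (\<lambda>s. min s t) ` J \<union> (\<lambda>u. t + u) ` K"] J K t by force
  have "t \<in> range g" using g(3) by blast
  then obtain p where p: "t = g p" by blast
  have "\<exists>k\<le>p. min s t = g k" if "s \<in> J" for s
  proof -
    have "min s t \<in> range g" using g(3) that by blast
    then obtain k where k: "min s t = g k" by blast
    show ?thesis
    \<comment> \<open>The sequence may repeat values, so the index found can lie beyond
      \<open>p\<close>; the value is then \<open>t\<close> itself and \<open>p\<close> serves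
      instead.\<close>
    proof (cases "k \<le> p")
      case False
      then have "t \<le> min s t" using k p monoD[OF g(1), of p k] by simp
      then have "min s t = g p" using p by simp
      then show ?thesis by blast
    qed (use k in auto)
  qed
  then obtain k where k: "\<And>s. s \<in> J \<Longrightarrow> k s \<le> p \<and> g (k s) = min s t" by metis
  have "\<exists>l\<ge>p. t + u = g l" if "u \<in> K" for u
  proof -
    have "t + u \<in> range g" using g(3) that by blast
    then obtain l where l: "t + u = g l" by blast
    show ?thesis
    proof (cases "p \<le> l")
      case False
      then have "t + u \<le> t" using l p monoD[OF g(1), of l p] by simp
      moreover have "0 \<le> u" using K(2) that by auto
      ultimately have "t + u = g p" using p by simp
      then show ?thesis by blast
    qed (use l in auto)
  qed
  then obtain l where l: "\<And>u. u \<in> K \<Longrightarrow> p \<le> l u \<and> g (l u) = t + u" by metis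
  define D where "D i \<omega> = Y (g (Suc i)) \<omega> - Y (g i) \<omega>" for i \<omega>
  have ind: "indep_vars (\<lambda>_. borel) D UNIV"
    using indep_increments[of g] g unfolding D_def[abs_def] by simp
  define \<phi> where "\<phi> d = (\<lambda>s\<in>J. \<Sum>i<k s. d i)" for d :: "nat \<Rightarrow> 'a"
  define \<psi> where "\<psi> d = (\<lambda>u\<in>K. \<Sum>i=p..<l u. d i)" for d :: "nat \<Rightarrow> 'a"
  have "\<phi> \<in> PiM {..<p} (\<lambda>_. borel) \<rightarrow>\<^sub>M PiM J (\<lambda>_. borel)"
    unfolding \<phi>_def
  proof (intro measurable_restrict borel_measurable_sum measurable_component_singleton)
    fix s i assume "s \<in> J" "i \<in> {..<k s}"
    then show "i \<in> {..<p}" using k[of s] by simp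
  qed
  moreover have "\<psi> \<in> PiM {p..} (\<lambda>_. borel) \<rightarrow>\<^sub>M PiM K (\<lambda>_. borel)"
    unfolding \<psi>_def using l by (auto intro!: measurable_restrict borel_measurable_sum measurable_component_singleton)
  ultimately have "indep_var (PiM J (\<lambda>_. borel)) (\<phi> \<circ> (\<lambda>\<omega>. restrict (\<lambda>i. D i \<omega>) {..<p}))
      (PiM K (\<lambda>_. borel)) (\<psi> \<circ> (\<lambda>\<omega>. restrict (\<lambda>i. D i \<omega>) {p..}))"
    by (intro indep_var_compose[OF indep_var_restrict[OF ind]]) auto
  moreover have "\<phi> \<circ> (\<lambda>\<omega>. restrict (\<lambda>i. D i \<omega>) {..<p}) = (\<lambda>\<omega>. restrict (past t \<omega>) J)"
  proof (intro ext)
    fix \<omega> s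
    have "(\<Sum>i<k s. D i \<omega>) = Y (g (k s)) \<omega> - Y (g 0) \<omega>"
      unfolding D_def by (rule sum_lessThan_telescope)
    moreover have "(\<Sum>i<k s. restrict (\<lambda>i. D i \<omega>) {..<p} i) = (\<Sum>i<k s. D i \<omega>)" if "s \<in> J"
      using k[OF that] by (intro sum.cong) auto
    ultimately show "(\<phi> \<circ> (\<lambda>\<omega>. restrict (\<lambda>i. D i \<omega>) {..<p})) \<omega> s = restrict (past t \<omega>) J s"
      using k[of s] g(2) J(2) by (cases "s \<in> J") (auto simp: \<phi>_def past_def)
  qed
  moreover have "\<psi> \<circ> (\<lambda>\<omega>. restrict (\<lambda>i. D i \<omega>) {p..}) = (\<lambda>\<omega>. restrict (fut t \<omega>) K)"
  proof (intro ext)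
    fix \<omega> u
    have "(\<Sum>i=p..<l u. D i \<omega>) = Y (g (l u)) \<omega> - Y (g p) \<omega>" if "u \<in> K"
      unfolding D_def using l[OF that] by (intro sum_Suc_diff') auto
    then show "(\<psi> \<circ> (\<lambda>\<omega>. restrict (\<lambda>i. D i \<omega>) {p..})) \<omega> u = restrict (fut t \<omega>) K u"
      using l[of u] p K(2) by (cases "u \<in> K") (auto simp: \<psi>_def fut_def)
  qed
  ultimately show "indep_var (PiM J (\<lambda>_. borel)) (\<lambda>\<omega>. restrict (past t \<omega>) J) (PiM K (\<lambda>_. borel)) (\<lambda>\<omega>. restrict (fut t \<omega>) K)"
    by simp
qed (rule past_measurable fut_measurable t)+

lemma nn_integral_past_fut:
  assumes t: "0 \<le> t" and f: "f \<in> borel_measurable (W \<Otimes>\<^sub>M W)"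
  shows "(\<integral>\<^sup>+\<omega>. f (past t \<omega>, fut t \<omega>) \<partial>M) = (\<integral>\<^sup>+\<omega>. (\<integral>\<^sup>+w. f (past t \<omega>, w) \<partial>PW) \<partial>M)"
proof -
  note [measurable] = f
  interpret PW: prob_space PW by (rule prob_space_PW)
  have "distr M W (past t) \<Otimes>\<^sub>M PW = distr M (W \<Otimes>\<^sub>M W) (\<lambda>\<omega>. (past t \<omega>, fut t \<omega>))"
    using indep_past_fut[OF t] unfolding indep_var_distribution_eq distr_fut[OF t] by simp
  then have "(\<integral>\<^sup>+\<omega>. f (past t \<omega>, fut t \<omega>) \<partial>M) = (\<integral>\<^sup>+z. f z \<partial>(distr M W (past t) \<Otimes>\<^sub>M PW))"
    using t by (simp add: nn_integral_distr)
  also have "\<dots> = (\<integral>\<^sup>+p. (\<integral>\<^sup>+w. f (p, w) \<partial>PW) \<partial>distr M W (past t))"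
  proof (rule PW.nn_integral_fst[symmetric])
    show "f \<in> borel_measurable (distr M W (past t) \<Otimes>\<^sub>M PW)"
      using f measurable_cong_sets[OF sets_pair_measure_cong[OF sets_distr sets_PW] refl] by blast
  qed
  also have "\<dots> = (\<integral>\<^sup>+\<omega>. (\<integral>\<^sup>+w. f (past t \<omega>, w) \<partial>PW) \<partial>M)"
    using t by (subst nn_integral_distr) simp_all
  finally show ?thesis .
qed

end

text \<open>Floor plus one, not ceiling: the approximation is strictly larger than \<open>s\<close>
  even at dyadic \<open>s\<close>. Hence it converges within \<open>at_right s\<close>, and for a
  random time S its value is decided by events of the form S < t.\<close>

definition dyc :: "nat \<Rightarrow> real \<Rightarrow> real" where
  "dyc k s = (of_int \<lfloor>2 ^ k * s\<rfloor> + 1) / 2 ^ k"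

lemma dyc_gt: "s < dyc k s"
proof -
  have "2 ^ k * s < of_int \<lfloor>2 ^ k * s\<rfloor> + 1" by linarith
  then show ?thesis by (simp add: dyc_def field_simps)
qed

lemma dyc_le: "dyc k s \<le> s + 1 / 2 ^ k"
proof -
  have "of_int \<lfloor>2 ^ k * s\<rfloor> + 1 \<le> 2 ^ k * s + 1" by linarith
  then have "dyc k s \<le> (2 ^ k * s + 1) / 2 ^ k" unfolding dyc_def by (intro divide_right_mono) auto
  then show ?thesis by (simp add: field_simps)
qed

lemma dyc_eq:
  assumes "0 \<le> s"
  shows "dyc k s = real (nat (\<lfloor>2 ^ k * s\<rfloor> + 1)) / 2 ^ k"
  using assms by (simp add: dyc_def)

lemma filterlim_dyc: "filterlim (\<lambda>k. dyc k s) (at_right s) sequentially"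
  unfolding filterlim_at
proof
  show "\<forall>\<^sub>F k in sequentially. dyc k s \<in> {s<..} \<and> dyc k s \<noteq> s"
    using dyc_gt by (simp add: less_imp_neq[THEN not_sym])
  have "(\<lambda>k. 1 / 2 ^ k :: real) \<longlonglongrightarrow> 0"
    using LIMSEQ_divide_realpow_zero[of 2 1] by simp
  then have "(\<lambda>k. s + 1 / 2 ^ k) \<longlonglongrightarrow> s" using tendsto_add[OF tendsto_const[of s]] by force
  then show "(\<lambda>k. dyc k s) \<longlonglongrightarrow> s"
    by (rule tendsto_sandwich[OF always_eventually always_eventually tendsto_const, rotated 2])
      (simp_all add: dyc_le less_imp_le[OF dyc_gt])
qed

lemma dyc_measurable[measurable]: "dyc k \<in> borel_measurable borel"
  unfolding dyc_def[abs_def] by measurable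

section \<open>Filtration, optional times and the Markov property at dyadic times\<close>

context levy
begin

definition F :: "real \<Rightarrow> 'w measure" where "F t = vimage_algebra (space M) (past t) W"

lemma space_F[simp]: "space (F t) = space M"
  by (simp add: F_def)

lemma past_in_space: "past t \<in> space M \<rightarrow> space W"
  by (auto simp: past_def space_PiM)

lemma sets_F: "sets (F t) = {past t -` V \<inter> space M | V. V \<in> sets W}"
  unfolding F_def by (rule sets_vimage_algebra2[OF past_in_space])

lemma Y_F_measurable: "0 \<le> s \<Longrightarrow> s \<le> t \<Longrightarrow> Y s \<in> borel_measurable (F t)"
proof -
  assume s: "0 \<le> s" "s \<le> t"
  have "past t \<in> F t \<rightarrow>\<^sub>M W"
    unfolding F_def by (rule measurable_vimage_algebra1[OF past_in_space])
  from measurable_compose[OF this measurable_component_singleton[of s]]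
  show ?thesis using s by (simp add: past_def min_def)
qed

lemma F_mono: "0 \<le> s \<Longrightarrow> s \<le> t \<Longrightarrow> sets (F s) \<subseteq> sets (F t)"
proof -
  assume s: "0 \<le> s" "s \<le> t"
  have "past s \<in> F t \<rightarrow>\<^sub>M W"
    unfolding past_def using s by (intro measurable_restrict Y_F_measurable) auto
  then show ?thesis
    unfolding F_def[of s] by (intro sets_image_in_sets) auto
qed

lemma F_subset: "0 \<le> t \<Longrightarrow> sets (F t) \<subseteq> sets M"
  unfolding F_def by (intro sets_image_in_sets) auto

text \<open>The strict inequality makes these the stopping times of the right-continuous enlargement
  of \<open>F\<close>. Entrance times of right-continuous paths into open sets are of this kind, but
  in general not stopping times of \<open>F\<close> itself.\<close>

definition optional_time :: "('w \<Rightarrow> ereal) \<Rightarrow> bool" where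
  "optional_time S \<longleftrightarrow> (\<forall>\<omega>. 0 \<le> S \<omega>) \<and> (\<forall>t\<ge>0. {\<omega> \<in> space M. S \<omega> < ereal t} \<in> sets (F t))"

lemma optional_time_measurable:
  assumes "optional_time S"
  shows "S \<in> borel_measurable M"
proof (rule borel_measurableI_less)
  have *: "{\<omega> \<in> space M. S \<omega> < ereal t} \<in> sets M" for t
  proof (cases "0 \<le> t")
    case True
    then show ?thesis using assms F_subset by (auto simp: optional_time_def)
  next
    case False
    have "\<not> S \<omega> < ereal t" for \<omega>
    proof -
      have "0 \<le> S \<omega>" using assms by (simp add: optional_time_def)
      moreover have "ereal t < 0" using False by simp
      ultimately show ?thesis by (meson less_le_not_le order.strict_trans2 less_imp_le)
    qed
    then show ?thesis by simp
  qed
  fix y :: ereal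
  show "{\<omega> \<in> space M. S \<omega> < y} \<in> sets M"
  proof (cases y)
    case PInf
    have "{\<omega> \<in> space M. S \<omega> < y} = (\<Union>n::nat. {\<omega> \<in> space M. S \<omega> < ereal (real n)})"
    proof safe
      fix \<omega> assume "S \<omega> < y"
      then have "S \<omega> \<noteq> \<infinity>" using PInf by auto
      then show "\<omega> \<in> (\<Union>n::nat. {\<omega> \<in> space M. S \<omega> < ereal (real n)})" if "\<omega> \<in> space M"
        using less_PInf_Ex_of_nat that by blast
    next
      fix \<omega> n assume "S \<omega> < ereal (real n)"
      then show "S \<omega> < y" unfolding PInf by (rule less_trans) simp
    qed
    then show ?thesis using * by auto
  qed (use * in auto)
qed

lemma Y_random_time_measurable:
  assumes [measurable]: "T \<in> borel_measurable M" and T: "\<And>\<omega>. 0 \<le> T \<omega>"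
  shows "(\<lambda>\<omega>. Y (dyc k (T \<omega>)) \<omega>) \<in> borel_measurable M" "(\<lambda>\<omega>. Y (T \<omega>) \<omega>) \<in> borel_measurable M"
proof -
  show 1: "(\<lambda>\<omega>. Y (dyc k (T \<omega>)) \<omega>) \<in> borel_measurable M" for k
    unfolding dyc_eq[OF T]
    by (rule measurable_compose_countable[where f="\<lambda>n \<omega>. Y (real n / 2 ^ k) \<omega>" and g="\<lambda>\<omega>. nat (\<lfloor>2 ^ k * T \<omega>\<rfloor> + 1)"]) (auto intro!: Y_measurable)
  show "(\<lambda>\<omega>. Y (T \<omega>) \<omega>) \<in> borel_measurable M"
    by (rule borel_measurable_LIMSEQ_metric[OF 1])
      (use T in \<open>auto intro!: filterlim_compose[OF Y_right filterlim_dyc]\<close>)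
qed

lemma fut_random_time_measurable:
  assumes [measurable]: "T \<in> borel_measurable M" and T: "\<And>\<omega>. 0 \<le> T \<omega>"
  shows "(\<lambda>\<omega>. fut (dyc k (T \<omega>)) \<omega>) \<in> M \<rightarrow>\<^sub>M W" "(\<lambda>\<omega>. fut (T \<omega>) \<omega>) \<in> M \<rightarrow>\<^sub>M W"
proof -
  have d: "0 \<le> dyc k (T \<omega>)" for k \<omega> using T[of \<omega>] dyc_gt[of "T \<omega>" k] by linarith
  have *: "(\<lambda>\<omega>. fut (R \<omega>) \<omega>) \<in> M \<rightarrow>\<^sub>M W" if [measurable]: "R \<in> borel_measurable M" and R: "\<And>\<omega>. 0 \<le> R \<omega>" for R
    unfolding fut_def using R
    by (intro measurable_restrict borel_measurable_diff Y_random_time_measurable) auto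
  show "(\<lambda>\<omega>. fut (dyc k (T \<omega>)) \<omega>) \<in> M \<rightarrow>\<^sub>M W" "(\<lambda>\<omega>. fut (T \<omega>) \<omega>) \<in> M \<rightarrow>\<^sub>M W"
    using d T by (auto intro!: *)
qed

text \<open>The event says that \<open>S\<close> lies in [(n-1)/2^k, n/2^k), a difference of two
  events of the form S < t. For n = 0 it is empty, because floor plus one is at least 1.\<close>

lemma dyadic_event_F:
  assumes S: "optional_time S"
  shows "{\<omega> \<in> space M. S \<omega> < \<infinity> \<and> nat (\<lfloor>2 ^ k * real_of_ereal (S \<omega>)\<rfloor> + 1) = n} \<in> sets (F (real n / 2 ^ k))"
    (is "?C \<in> _")
proof (cases n)
  case 0
  have "0 \<le> \<lfloor>2 ^ k * real_of_ereal (S \<omega>)\<rfloor>" for \<omega>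
    using S by (simp add: optional_time_def real_of_ereal_pos)
  then have "nat (\<lfloor>2 ^ k * real_of_ereal (S \<omega>)\<rfloor> + 1) \<noteq> 0" for \<omega>
    by (metis add_pos_nonneg add.commute less_irrefl nat_eq_iff2 zero_less_one zero_less_nat_eq)
  then have "?C = {}" using 0 by simp
  then show ?thesis by (metis sets.empty_sets)
next
  case (Suc m)
  have "?C = {\<omega> \<in> space M. S \<omega> < ereal (real n / 2 ^ k)} - {\<omega> \<in> space M. S \<omega> < ereal (real m / 2 ^ k)}"
  proof (rule set_eqI)
    fix \<omega>
    show "\<omega> \<in> ?C \<longleftrightarrow> \<omega> \<in> {\<omega> \<in> space M. S \<omega> < ereal (real n / 2 ^ k)} - {\<omega> \<in> space M. S \<omega> < ereal (real m / 2 ^ k)}"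
    proof (cases "S \<omega>")
      case (real r)
      have r: "0 \<le> r" using S real unfolding optional_time_def by (metis ereal_less_eq(5))
      then have "0 \<le> \<lfloor>2 ^ k * r\<rfloor>" by simp
      then have "nat (\<lfloor>2 ^ k * r\<rfloor> + 1) = n \<longleftrightarrow> \<lfloor>2 ^ k * r\<rfloor> = int m"
        using Suc by linarith
      also have "\<dots> \<longleftrightarrow> real m \<le> 2 ^ k * r \<and> 2 ^ k * r < real m + 1"
        by (simp add: floor_eq_iff)
      finally show ?thesis using real Suc by (auto simp: field_simps)
    qed (use S in \<open>auto simp: optional_time_def\<close>)
  qed
  moreover have "{\<omega> \<in> space M. S \<omega> < ereal (real m / 2 ^ k)} \<in> sets (F (real n / 2 ^ k))"
    using S F_mono[of "real m / 2 ^ k" "real n / 2 ^ k"] Suc by (auto simp: optional_time_def divide_right_mono)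
  moreover have "{\<omega> \<in> space M. S \<omega> < ereal (real n / 2 ^ k)} \<in> sets (F (real n / 2 ^ k))"
    using S by (auto simp: optional_time_def)
  ultimately show ?thesis by auto
qed

text \<open>The dyadic time has countably many values. The event that it takes a given value belongs
  to the past of that value, so the Markov property at a deterministic time applies on each
  piece.\<close>

lemma strong_markov_dyadic:
  fixes S :: "'w \<Rightarrow> ereal"
  defines "T \<equiv> \<lambda>\<omega>. real_of_ereal (S \<omega>)" and "C \<equiv> {\<omega> \<in> space M. S \<omega> < \<infinity>}"
  assumes S: "optional_time S" and g[measurable]: "g \<in> borel_measurable borel" and f[measurable]: "f \<in> borel_measurable W"
  shows "(\<integral>\<^sup>+\<omega>. indicator C \<omega> * (g (Y (dyc k (T \<omega>)) \<omega>) * f (fut (dyc k (T \<omega>)) \<omega>)) \<partial>M) =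
    (\<integral>\<^sup>+\<omega>. indicator C \<omega> * g (Y (dyc k (T \<omega>)) \<omega>) \<partial>M) * (\<integral>\<^sup>+w. f w \<partial>PW)"
proof -
  define D where "D n = {\<omega> \<in> space M. S \<omega> < \<infinity> \<and> nat (\<lfloor>2 ^ k * T \<omega>\<rfloor> + 1) = n}" for n
  have T: "0 \<le> T \<omega>" for \<omega> using S by (simp add: T_def optional_time_def real_of_ereal_pos)
  have DF: "D n \<in> sets (F (real n / 2 ^ k))" for n
    using dyadic_event_F[OF S] unfolding D_def T_def .
  then have D[measurable]: "D n \<in> sets M" for n
    using F_subset[of "real n / 2 ^ k"] by auto
  have sum: "indicator C \<omega> * H (dyc k (T \<omega>)) = (\<Sum>n. indicator (D n) \<omega> * H (real n / 2 ^ k))" if "\<omega> \<in> space M"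
    for H :: "real \<Rightarrow> ennreal" and \<omega>
  proof (cases "\<omega> \<in> C")
    case True
    have "(\<Sum>n. indicator (D n) \<omega> * H (real n / 2 ^ k)) = (\<Sum>n\<in>{nat (\<lfloor>2 ^ k * T \<omega>\<rfloor> + 1)}. indicator (D n) \<omega> * H (real n / 2 ^ k))"
      by (rule suminf_finite) (auto simp: D_def)
    moreover have "\<omega> \<in> D (nat (\<lfloor>2 ^ k * T \<omega>\<rfloor> + 1))" using True by (simp add: C_def D_def)
    ultimately show ?thesis using True by (simp only: dyc_eq[OF T]) simp
  next
    case False
    then have "indicator (D n) \<omega> = (0::ennreal)" for n using that by (auto simp: C_def D_def indicator_def)
    then show ?thesis using False by simp
  qed
  have trm: "(\<integral>\<^sup>+\<omega>. indicator (D n) \<omega> * (g (Y (real n / 2 ^ k) \<omega>) * f (fut (real n / 2 ^ k) \<omega>)) \<partial>M) =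
      (\<integral>\<^sup>+\<omega>. indicator (D n) \<omega> * g (Y (real n / 2 ^ k) \<omega>) \<partial>M) * (\<integral>\<^sup>+w. f w \<partial>PW)" for n
  proof -
    let ?t = "real n / 2 ^ k"
    obtain V where V[measurable]: "V \<in> sets W" and DV: "D n = past ?t -` V \<inter> space M"
      using DF[of n] unfolding sets_F by auto
    have c: "(\<lambda>p. p ?t) \<in> W \<rightarrow>\<^sub>M borel" by (rule measurable_component_singleton) simp
    note [measurable] = c
    let ?f = "\<lambda>z. indicator V (fst z) * (g (fst z ?t) * f (snd z))"
    have m: "?f \<in> borel_measurable (W \<Otimes>\<^sub>M W)" by measurable
    have i: "indicator (D n) \<omega> = (indicator V (past ?t \<omega>) :: ennreal)" "past ?t \<omega> ?t = Y ?t \<omega>" if "\<omega> \<in> space M" for \<omega>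
      using that unfolding DV by (auto simp: past_def indicator_def)
    have "(\<integral>\<^sup>+\<omega>. indicator (D n) \<omega> * (g (Y ?t \<omega>) * f (fut ?t \<omega>)) \<partial>M) = (\<integral>\<^sup>+\<omega>. ?f (past ?t \<omega>, fut ?t \<omega>) \<partial>M)"
      by (rule nn_integral_cong) (simp add: i)
    also have "\<dots> = (\<integral>\<^sup>+\<omega>. (\<integral>\<^sup>+w. ?f (past ?t \<omega>, w) \<partial>PW) \<partial>M)"
      by (rule nn_integral_past_fut[OF _ m]) simp
    also have "\<dots> = (\<integral>\<^sup>+\<omega>. (indicator (D n) \<omega> * g (Y ?t \<omega>)) * (\<integral>\<^sup>+w. f w \<partial>PW) \<partial>M)"
    proof (rule nn_integral_cong)
      fix \<omega> assume w: "\<omega> \<in> space M"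
      have "(\<integral>\<^sup>+w. ?f (past ?t \<omega>, w) \<partial>PW) = (\<integral>\<^sup>+w. (indicator (D n) \<omega> * g (Y ?t \<omega>)) * f w \<partial>PW)"
        by (simp add: i[OF w] mult.assoc)
      also have "\<dots> = (indicator (D n) \<omega> * g (Y ?t \<omega>)) * (\<integral>\<^sup>+w. f w \<partial>PW)"
        by (rule nn_integral_cmult) measurable
      finally show "(\<integral>\<^sup>+w. ?f (past ?t \<omega>, w) \<partial>PW) = (indicator (D n) \<omega> * g (Y ?t \<omega>)) * (\<integral>\<^sup>+w. f w \<partial>PW)" .
    qed
    also have "\<dots> = (\<integral>\<^sup>+\<omega>. indicator (D n) \<omega> * g (Y ?t \<omega>) \<partial>M) * (\<integral>\<^sup>+w. f w \<partial>PW)"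
      by (rule nn_integral_multc) measurable
    finally show ?thesis .
  qed
  have "(\<integral>\<^sup>+\<omega>. indicator C \<omega> * (g (Y (dyc k (T \<omega>)) \<omega>) * f (fut (dyc k (T \<omega>)) \<omega>)) \<partial>M) =
      (\<integral>\<^sup>+\<omega>. (\<Sum>n. indicator (D n) \<omega> * (g (Y (real n / 2 ^ k) \<omega>) * f (fut (real n / 2 ^ k) \<omega>))) \<partial>M)"
  proof (rule nn_integral_cong)
    fix \<omega> assume "\<omega> \<in> space M"
    then show "indicator C \<omega> * (g (Y (dyc k (T \<omega>)) \<omega>) * f (fut (dyc k (T \<omega>)) \<omega>)) =
        (\<Sum>n. indicator (D n) \<omega> * (g (Y (real n / 2 ^ k) \<omega>) * f (fut (real n / 2 ^ k) \<omega>)))"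
      by (rule sum[of \<omega> "\<lambda>t. g (Y t \<omega>) * f (fut t \<omega>)"])
  qed
  also have "\<dots> = (\<Sum>n. (\<integral>\<^sup>+\<omega>. indicator (D n) \<omega> * (g (Y (real n / 2 ^ k) \<omega>) * f (fut (real n / 2 ^ k) \<omega>)) \<partial>M))"
    by (rule nn_integral_suminf) measurable
  also have "\<dots> = (\<Sum>n. (\<integral>\<^sup>+\<omega>. indicator (D n) \<omega> * g (Y (real n / 2 ^ k) \<omega>) \<partial>M) * (\<integral>\<^sup>+w. f w \<partial>PW))"
    by (simp only: trm)
  also have "\<dots> = (\<Sum>n. \<integral>\<^sup>+\<omega>. indicator (D n) \<omega> * g (Y (real n / 2 ^ k) \<omega>) \<partial>M) * (\<integral>\<^sup>+w. f w \<partial>PW)"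
    by (rule ennreal_suminf_multc)
  also have "(\<Sum>n. \<integral>\<^sup>+\<omega>. indicator (D n) \<omega> * g (Y (real n / 2 ^ k) \<omega>) \<partial>M) = (\<integral>\<^sup>+\<omega>. (\<Sum>n. indicator (D n) \<omega> * g (Y (real n / 2 ^ k) \<omega>)) \<partial>M)"
    by (rule nn_integral_suminf[symmetric]) measurable
  also have "\<dots> = (\<integral>\<^sup>+\<omega>. indicator C \<omega> * g (Y (dyc k (T \<omega>)) \<omega>) \<partial>M)"
  proof (rule nn_integral_cong)
    fix \<omega> assume "\<omega> \<in> space M"
    then show "(\<Sum>n. indicator (D n) \<omega> * g (Y (real n / 2 ^ k) \<omega>)) = indicator C \<omega> * g (Y (dyc k (T \<omega>)) \<omega>)"
      by (rule sum[of \<omega> "\<lambda>t. g (Y t \<omega>)", symmetric])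
  qed
  finally show ?thesis .
qed

section \<open>The strong Markov property\<close>

lemma Y_dyc_tendsto:
  assumes "\<omega> \<in> space M" "0 \<le> s" "0 \<le> u"
  shows "(\<lambda>k. Y (dyc k s + u) \<omega>) \<longlonglongrightarrow> Y (s + u) \<omega>"
proof (rule filterlim_compose[OF Y_right])
  have "(\<lambda>k. dyc k s) \<longlonglongrightarrow> s"
    using filterlim_dyc[of s] unfolding filterlim_at by blast
  then have "(\<lambda>k. dyc k s + u) \<longlonglongrightarrow> s + u" by (rule tendsto_add[OF _ tendsto_const])
  then show "filterlim (\<lambda>k. dyc k s + u) (at_right (s + u)) sequentially"
    unfolding filterlim_at using dyc_gt by (simp add: less_imp_neq[THEN not_sym])
qed (use assms in auto)

text \<open>The dyadic times approach \<open>T\<close> from the right, so right-continuity and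
  dominated convergence carry the identity over; this is why the test functions are
  continuous.\<close>

lemma strong_markov_continuous:
  fixes S :: "'w \<Rightarrow> ereal" and g :: "'a \<Rightarrow> real" and f :: "real \<Rightarrow> 'a \<Rightarrow> real"
  defines "T \<equiv> \<lambda>\<omega>. real_of_ereal (S \<omega>)" and "C \<equiv> {\<omega> \<in> space M. S \<omega> < \<infinity>}"
  assumes S: "optional_time S" and J: "finite J" "J \<subseteq> {0..}"
    and g: "continuous_on UNIV g" "\<And>z. 0 \<le> g z \<and> g z \<le> 1"
    and f: "\<And>i. continuous_on UNIV (f i)" "\<And>i z. 0 \<le> f i z \<and> f i z \<le> 1"
  shows "(\<integral>\<^sup>+\<omega>. indicator C \<omega> * (ennreal (g (Y (T \<omega>) \<omega>)) * ennreal (\<Prod>i\<in>J. f i (fut (T \<omega>) \<omega> i))) \<partial>M) =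
    (\<integral>\<^sup>+\<omega>. indicator C \<omega> * ennreal (g (Y (T \<omega>) \<omega>)) \<partial>M) * (\<integral>\<^sup>+w. ennreal (\<Prod>i\<in>J. f i (w i)) \<partial>PW)"
proof -
  interpret PW: prob_space PW by (rule prob_space_PW)
  have Sm[measurable]: "S \<in> borel_measurable M" by (rule optional_time_measurable[OF S])
  have Tm[measurable]: "T \<in> borel_measurable M" unfolding T_def by measurable
  have T: "0 \<le> T \<omega>" for \<omega> using S by (simp add: T_def optional_time_def real_of_ereal_pos)
  have C[measurable]: "C \<in> sets M" unfolding C_def by measurable
  have gm[measurable]: "g \<in> borel_measurable borel" by (rule borel_measurable_continuous_onI[OF g(1)])
  have fm[measurable]: "f i \<in> borel_measurable borel" for i by (rule borel_measurable_continuous_onI[OF f(1)])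
  define h where "h w = ennreal (\<Prod>i\<in>J. f i (w i))" for w
  have h[measurable]: "h \<in> borel_measurable W"
    unfolding h_def
  proof (intro measurable_compose[OF _ measurable_ennreal] borel_measurable_prod)
    fix i assume "i \<in> J"
    then have "(\<lambda>w. w i) \<in> W \<rightarrow>\<^sub>M borel" using J(2) by (intro measurable_component_singleton) auto
    then show "(\<lambda>w. f i (w i)) \<in> borel_measurable W" by (rule measurable_compose) (rule fm)
  qed
  have h1: "h w \<le> 1" for w
    unfolding h_def using f(2) by (metis ennreal_1 ennreal_leI prod_le_1)
  have Ym: "(\<lambda>\<omega>. Y (dyc k (T \<omega>)) \<omega>) \<in> borel_measurable M" "(\<lambda>\<omega>. Y (T \<omega>) \<omega>) \<in> borel_measurable M" for k
    by (rule Y_random_time_measurable[OF Tm T])+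
  have futm: "(\<lambda>\<omega>. fut (dyc k (T \<omega>)) \<omega>) \<in> M \<rightarrow>\<^sub>M W" "(\<lambda>\<omega>. fut (T \<omega>) \<omega>) \<in> M \<rightarrow>\<^sub>M W" for k
    by (rule fut_random_time_measurable[OF Tm T])+
  note [measurable] = Ym futm
  have Ylim: "(\<lambda>k. Y (dyc k (T \<omega>)) \<omega>) \<longlonglongrightarrow> Y (T \<omega>) \<omega>" if "\<omega> \<in> space M" for \<omega>
    using Y_dyc_tendsto[OF that T, of 0] by simp
  have glim: "(\<lambda>k. g (Y (dyc k (T \<omega>)) \<omega>)) \<longlonglongrightarrow> g (Y (T \<omega>) \<omega>)" if "\<omega> \<in> space M" for \<omega>
    by (rule continuous_on_tendsto_compose[OF g(1) Ylim[OF that]]) auto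
  have hlim: "(\<lambda>k. (\<Prod>i\<in>J. f i (fut (dyc k (T \<omega>)) \<omega> i))) \<longlonglongrightarrow> (\<Prod>i\<in>J. f i (fut (T \<omega>) \<omega> i))" if "\<omega> \<in> space M" for \<omega>
  proof (rule tendsto_prod)
    fix i assume i: "i \<in> J"
    then have i0: "0 \<le> i" using J(2) by auto
    have "(\<lambda>k. fut (dyc k (T \<omega>)) \<omega> i) \<longlonglongrightarrow> fut (T \<omega>) \<omega> i"
      using i0 tendsto_diff[OF Y_dyc_tendsto[OF that T i0] Ylim[OF that]] by (simp add: fut_def)
    then show "(\<lambda>k. f i (fut (dyc k (T \<omega>)) \<omega> i)) \<longlonglongrightarrow> f i (fut (T \<omega>) \<omega> i)"
      by (rule continuous_on_tendsto_compose[OF f(1)]) auto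
  qed
  have "(\<lambda>k. \<integral>\<^sup>+\<omega>. indicator C \<omega> * (ennreal (g (Y (dyc k (T \<omega>)) \<omega>)) * h (fut (dyc k (T \<omega>)) \<omega>)) \<partial>M) \<longlonglongrightarrow>
      (\<integral>\<^sup>+\<omega>. indicator C \<omega> * (ennreal (g (Y (T \<omega>) \<omega>)) * h (fut (T \<omega>) \<omega>)) \<partial>M)"
  proof (rule nn_integral_dominated_convergence[where w="\<lambda>_. 1"])
    have b: "indicator C \<omega> * (ennreal (g z) * h w) \<le> 1" for \<omega> z w
    proof -
      have "ennreal (g z) * h w \<le> 1 * 1" using g(2)[of z] h1 by (intro mult_mono) auto
      then show ?thesis by (auto simp: indicator_def)
    qed
    show "AE \<omega> in M. indicator C \<omega> * (ennreal (g (Y (dyc k (T \<omega>)) \<omega>)) * h (fut (dyc k (T \<omega>)) \<omega>)) \<le> 1" for k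
      by (intro AE_I2 b)
    show "AE \<omega> in M. (\<lambda>k. indicator C \<omega> * (ennreal (g (Y (dyc k (T \<omega>)) \<omega>)) * h (fut (dyc k (T \<omega>)) \<omega>)))
        \<longlonglongrightarrow> indicator C \<omega> * (ennreal (g (Y (T \<omega>) \<omega>)) * h (fut (T \<omega>) \<omega>))"
    proof (rule AE_I2)
      fix \<omega> assume w: "\<omega> \<in> space M"
      have "(\<lambda>k. g (Y (dyc k (T \<omega>)) \<omega>) * (\<Prod>i\<in>J. f i (fut (dyc k (T \<omega>)) \<omega> i))) \<longlonglongrightarrow> g (Y (T \<omega>) \<omega>) * (\<Prod>i\<in>J. f i (fut (T \<omega>) \<omega> i))"
        by (rule tendsto_mult[OF glim[OF w] hlim[OF w]])
      then have "(\<lambda>k. ennreal (g (Y (dyc k (T \<omega>)) \<omega>)) * h (fut (dyc k (T \<omega>)) \<omega>)) \<longlonglongrightarrow> ennreal (g (Y (T \<omega>) \<omega>)) * h (fut (T \<omega>) \<omega>)"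
        unfolding h_def using g(2) f(2) by (simp flip: ennreal_mult add: prod_nonneg tendsto_ennrealI)
      then show "(\<lambda>k. indicator C \<omega> * (ennreal (g (Y (dyc k (T \<omega>)) \<omega>)) * h (fut (dyc k (T \<omega>)) \<omega>)))
          \<longlonglongrightarrow> indicator C \<omega> * (ennreal (g (Y (T \<omega>) \<omega>)) * h (fut (T \<omega>) \<omega>))"
        by (cases "\<omega> \<in> C") simp_all
    qed
  qed (measurable, simp add: emeasure_space_1)
  moreover have "(\<lambda>k. (\<integral>\<^sup>+\<omega>. indicator C \<omega> * ennreal (g (Y (dyc k (T \<omega>)) \<omega>)) \<partial>M) * (\<integral>\<^sup>+w. h w \<partial>PW)) \<longlonglongrightarrow>
      (\<integral>\<^sup>+\<omega>. indicator C \<omega> * ennreal (g (Y (T \<omega>) \<omega>)) \<partial>M) * (\<integral>\<^sup>+w. h w \<partial>PW)"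
    unfolding mult.commute[of _ "\<integral>\<^sup>+w. h w \<partial>PW"]
  proof (rule ennreal_tendsto_cmult)
    have "(\<integral>\<^sup>+w. h w \<partial>PW) \<le> (\<integral>\<^sup>+w. 1 \<partial>PW)" by (intro nn_integral_mono h1)
    then show "(\<integral>\<^sup>+w. h w \<partial>PW) < top" using PW.emeasure_space_1 by (simp add: order.strict_trans1)
    show "(\<lambda>k. (\<integral>\<^sup>+\<omega>. indicator C \<omega> * ennreal (g (Y (dyc k (T \<omega>)) \<omega>)) \<partial>M)) \<longlonglongrightarrow> (\<integral>\<^sup>+\<omega>. indicator C \<omega> * ennreal (g (Y (T \<omega>) \<omega>)) \<partial>M)"
    proof (rule nn_integral_dominated_convergence[where w="\<lambda>_. 1"])
      show "AE \<omega> in M. indicator C \<omega> * ennreal (g (Y (dyc k (T \<omega>)) \<omega>)) \<le> 1" for k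
        using g(2) by (intro AE_I2) (simp add: indicator_def)
      show "AE \<omega> in M. (\<lambda>k. indicator C \<omega> * ennreal (g (Y (dyc k (T \<omega>)) \<omega>))) \<longlonglongrightarrow> indicator C \<omega> * ennreal (g (Y (T \<omega>) \<omega>))"
      proof (rule AE_I2)
        fix \<omega> assume w: "\<omega> \<in> space M"
        show "(\<lambda>k. indicator C \<omega> * ennreal (g (Y (dyc k (T \<omega>)) \<omega>))) \<longlonglongrightarrow> indicator C \<omega> * ennreal (g (Y (T \<omega>) \<omega>))"
          using tendsto_ennrealI[OF glim[OF w]] by (cases "\<omega> \<in> C") simp_all
      qed
    qed (measurable, simp add: emeasure_space_1)
  qed
  moreover have "(\<integral>\<^sup>+\<omega>. indicator C \<omega> * (ennreal (g (Y (dyc k (T \<omega>)) \<omega>)) * h (fut (dyc k (T \<omega>)) \<omega>)) \<partial>M) =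
      (\<integral>\<^sup>+\<omega>. indicator C \<omega> * ennreal (g (Y (dyc k (T \<omega>)) \<omega>)) \<partial>M) * (\<integral>\<^sup>+w. h w \<partial>PW)" for k
    unfolding T_def C_def using strong_markov_dyadic[OF S, of "\<lambda>z. ennreal (g z)" h k] h by simp
  ultimately show ?thesis unfolding h_def by (auto dest: LIMSEQ_unique)
qed

text \<open>Both sides are integrals against measures on pairs (position, future path). These
  measures coincide because they agree on products of continuous functions of finitely many
  coordinates.\<close>

lemma strong_markov:
  fixes S :: "'w \<Rightarrow> ereal" and f :: "'a \<times> (real \<Rightarrow> 'a) \<Rightarrow> ennreal"
  defines "T \<equiv> \<lambda>\<omega>. real_of_ereal (S \<omega>)" and "C \<equiv> {\<omega> \<in> space M. S \<omega> < \<infinity>}"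
  assumes S: "optional_time S" and f: "f \<in> borel_measurable (borel \<Otimes>\<^sub>M W)"
  shows "(\<integral>\<^sup>+\<omega>. indicator C \<omega> * f (Y (T \<omega>) \<omega>, fut (T \<omega>) \<omega>) \<partial>M) =
    (\<integral>\<^sup>+\<omega>. indicator C \<omega> * (\<integral>\<^sup>+w. f (Y (T \<omega>) \<omega>, w) \<partial>PW) \<partial>M)"
proof -
  interpret PW: prob_space PW by (rule prob_space_PW)
  have Sm[measurable]: "S \<in> borel_measurable M" by (rule optional_time_measurable[OF S])
  have Tm[measurable]: "T \<in> borel_measurable M" unfolding T_def by measurable
  have T: "0 \<le> T \<omega>" for \<omega> using S by (simp add: T_def optional_time_def real_of_ereal_pos)
  have C[measurable]: "C \<in> sets M" unfolding C_def by measurable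
  have Ym[measurable]: "(\<lambda>\<omega>. Y (T \<omega>) \<omega>) \<in> borel_measurable M"
    by (rule Y_random_time_measurable[OF Tm T])
  have futm[measurable]: "(\<lambda>\<omega>. fut (T \<omega>) \<omega>) \<in> M \<rightarrow>\<^sub>M W"
    by (rule fut_random_time_measurable[OF Tm T])
  \<comment> \<open>The extra index -1 stores the position at time \<open>T\<close>. A pair thus
    becomes a point of a single product space, to which the criterion for product spaces applies;
    \<open>\<iota>\<close> and \<open>\<pi>\<close> translate back and forth.\<close>
  define I where "I = insert (-1) {0::real..}"
  let ?V = "PiM I (\<lambda>_. borel :: 'a measure)"
  define \<iota> where "\<iota> z = (\<lambda>s\<in>I. if s = -1 then fst z else snd z s)" for z :: "'a \<times> (real \<Rightarrow> 'a)"
  define \<pi> where "\<pi> w = (w (-1), restrict w {0..})" for w :: "real \<Rightarrow> 'a"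
  have \<iota>[measurable]: "\<iota> \<in> borel \<Otimes>\<^sub>M W \<rightarrow>\<^sub>M ?V"
    unfolding \<iota>_def
  proof (rule measurable_restrict)
    fix s assume s: "s \<in> I"
    show "(\<lambda>z. if s = -1 then fst z else snd z s) \<in> borel \<Otimes>\<^sub>M W \<rightarrow>\<^sub>M borel"
    proof (cases "s = -1")
      case False
      then have "(\<lambda>w. w s) \<in> W \<rightarrow>\<^sub>M borel" using s by (intro measurable_component_singleton) (auto simp: I_def)
      from measurable_compose[OF measurable_snd this] show ?thesis using False by simp
    qed simp
  qed
  have \<pi>[measurable]: "\<pi> \<in> ?V \<rightarrow>\<^sub>M borel \<Otimes>\<^sub>M W"
    unfolding \<pi>_def by (intro measurable_Pair measurable_component_singleton measurable_restrict_subset) (auto simp: I_def)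
  have \<pi>\<iota>: "\<pi> (\<iota> z) = z" if "snd z \<in> space W" for z
  proof -
    have "restrict (\<iota> z) {0..} = snd z"
      using that by (intro ext) (auto simp: \<iota>_def I_def restrict_def space_PiM PiE_def extensional_def)
    then show ?thesis by (simp add: \<pi>_def \<iota>_def I_def prod_eq_iff)
  qed
  \<comment> \<open>Weighting by the indicator of \<open>C\<close> discards the paths with infinite
    \<open>S\<close> without normalising; only finiteness of the measure matters below.\<close>
  define D where "D = density M (indicator C)"
  have D[measurable_cong]: "sets D = sets M" by (simp add: D_def)
  have spD: "space D = space M" by (simp add: D_def)
  have intD: "(\<integral>\<^sup>+\<omega>. h \<omega> \<partial>D) = (\<integral>\<^sup>+\<omega>. indicator C \<omega> * h \<omega> \<partial>M)" if "h \<in> borel_measurable M" for h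
    unfolding D_def using that by (subst nn_integral_density) auto
  have YD[measurable]: "(\<lambda>\<omega>. Y (T \<omega>) \<omega>) \<in> borel_measurable D"
    using Ym unfolding measurable_cong_sets[OF D refl] .
  have fD[measurable]: "(\<lambda>\<omega>. fut (T \<omega>) \<omega>) \<in> D \<rightarrow>\<^sub>M W"
    using futm unfolding measurable_cong_sets[OF D refl] .
  define L where "L = distr D borel (\<lambda>\<omega>. Y (T \<omega>) \<omega>)"
  have sL[measurable_cong]: "sets (L \<Otimes>\<^sub>M PW) = sets (borel \<Otimes>\<^sub>M W)"
    unfolding L_def by (rule sets_pair_measure_cong[OF sets_distr sets_PW])
  have fub: "(\<integral>\<^sup>+z. h z \<partial>(L \<Otimes>\<^sub>M PW)) = (\<integral>\<^sup>+\<omega>. indicator C \<omega> * (\<integral>\<^sup>+w. h (Y (T \<omega>) \<omega>, w) \<partial>PW) \<partial>M)"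
    if h[measurable]: "h \<in> borel_measurable (borel \<Otimes>\<^sub>M W)" for h
  proof -
    have hm: "h \<in> borel_measurable (L \<Otimes>\<^sub>M PW)" using h unfolding measurable_cong_sets[OF sL refl] .
    have m[measurable]: "(\<lambda>y. \<integral>\<^sup>+w. h (y, w) \<partial>PW) \<in> borel_measurable borel" by measurable
    have "(\<integral>\<^sup>+z. h z \<partial>(L \<Otimes>\<^sub>M PW)) = (\<integral>\<^sup>+y. (\<integral>\<^sup>+w. h (y, w) \<partial>PW) \<partial>L)"
      by (rule PW.nn_integral_fst[symmetric, OF hm])
    also have "\<dots> = (\<integral>\<^sup>+\<omega>. (\<integral>\<^sup>+w. h (Y (T \<omega>) \<omega>, w) \<partial>PW) \<partial>D)"
      unfolding L_def by (rule nn_integral_distr[OF YD]) simp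
    also have "\<dots> = (\<integral>\<^sup>+\<omega>. indicator C \<omega> * (\<integral>\<^sup>+w. h (Y (T \<omega>) \<omega>, w) \<partial>PW) \<partial>M)"
      by (rule intD) (rule measurable_compose[OF Ym m])
    finally show ?thesis .
  qed
  have lhs: "(\<integral>\<^sup>+z. h z \<partial>distr D (borel \<Otimes>\<^sub>M W) (\<lambda>\<omega>. (Y (T \<omega>) \<omega>, fut (T \<omega>) \<omega>))) =
      (\<integral>\<^sup>+\<omega>. indicator C \<omega> * h (Y (T \<omega>) \<omega>, fut (T \<omega>) \<omega>) \<partial>M)"
    if h[measurable]: "h \<in> borel_measurable (borel \<Otimes>\<^sub>M W)" for h
    by (subst nn_integral_distr) (auto intro!: intD)
  let ?P = "distr D (borel \<Otimes>\<^sub>M W) (\<lambda>\<omega>. (Y (T \<omega>) \<omega>, fut (T \<omega>) \<omega>))"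
  have "distr ?P ?V \<iota> = distr (L \<Otimes>\<^sub>M PW) ?V \<iota>"
  proof (rule measure_eqI_PiM_continuous)
    have "finite_measure D"
    proof (rule finite_measureI)
      have "emeasure D (space D) = emeasure M C"
        unfolding D_def by (subst emeasure_density) (auto simp: C_def Int_def intro!: arg_cong2[where f=emeasure])
      then show "emeasure D (space D) \<noteq> \<infinity>" by simp
    qed
    then show "finite_measure (distr ?P ?V \<iota>)"
      by (intro finite_measure.finite_measure_distr) auto
    fix J :: "real set" and k :: "real \<Rightarrow> 'a \<Rightarrow> real"
    assume J: "finite J" "J \<subseteq> I" and k: "\<And>i. continuous_on UNIV (k i)" "\<And>i z. 0 \<le> k i z \<and> k i z \<le> 1"
    define g where "g = (if -1 \<in> J then k (-1) else (\<lambda>_. 1))"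
    have g: "continuous_on UNIV g" "\<And>z. 0 \<le> g z \<and> g z \<le> 1" using k by (auto simp: g_def)
    define J' where "J' = J - {-1}"
    have J': "finite J'" "J' \<subseteq> {0..}" using J by (auto simp: J'_def I_def)
    define H where "H w = ennreal (\<Prod>i\<in>J. k i (w i))" for w
    have H[measurable]: "H \<in> borel_measurable ?V"
      unfolding H_def
    proof (intro measurable_compose[OF _ measurable_ennreal] borel_measurable_prod)
      fix i assume "i \<in> J"
      then have "(\<lambda>w. w i) \<in> ?V \<rightarrow>\<^sub>M borel" using J(2) by (intro measurable_component_singleton) auto
      then show "(\<lambda>w. k i (w i)) \<in> borel_measurable ?V"
        by (rule measurable_compose) (rule borel_measurable_continuous_onI[OF k(1)])
    qed
    have split: "H (\<iota> z) = ennreal (g (fst z)) * ennreal (\<Prod>i\<in>J'. k i (snd z i))" for z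
    proof -
      have "(\<Prod>i\<in>J. k i (\<iota> z i)) = g (fst z) * (\<Prod>i\<in>J'. k i (\<iota> z i))"
      proof (cases "-1 \<in> J")
        case True
        then show ?thesis
          unfolding J'_def g_def using J(1) by (simp add: prod.remove) (simp add: \<iota>_def I_def)
      qed (simp add: J'_def g_def)
      also have "(\<Prod>i\<in>J'. k i (\<iota> z i)) = (\<Prod>i\<in>J'. k i (snd z i))"
        using J' by (intro prod.cong) (auto simp: \<iota>_def I_def)
      finally show ?thesis unfolding H_def using g(2) k(2) by (simp add: ennreal_mult prod_nonneg)
    qed
    have Hi: "(\<lambda>z. H (\<iota> z)) \<in> borel_measurable (borel \<Otimes>\<^sub>M W)" by measurable
    have "(\<integral>\<^sup>+w. H w \<partial>distr ?P ?V \<iota>) = (\<integral>\<^sup>+z. H (\<iota> z) \<partial>?P)"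
      by (rule nn_integral_distr) (simp_all add: H)
    also have "\<dots> = (\<integral>\<^sup>+\<omega>. indicator C \<omega> * H (\<iota> (Y (T \<omega>) \<omega>, fut (T \<omega>) \<omega>)) \<partial>M)"
      by (rule lhs[OF Hi])
    also have "\<dots> = (\<integral>\<^sup>+\<omega>. indicator C \<omega> * ennreal (g (Y (T \<omega>) \<omega>)) \<partial>M) * (\<integral>\<^sup>+w. ennreal (\<Prod>i\<in>J'. k i (w i)) \<partial>PW)"
      unfolding split fst_conv snd_conv T_def C_def
      by (rule strong_markov_continuous[OF S J' g k])
    also have "\<dots> = (\<integral>\<^sup>+\<omega>. (indicator C \<omega> * ennreal (g (Y (T \<omega>) \<omega>))) * (\<integral>\<^sup>+w. ennreal (\<Prod>i\<in>J'. k i (w i)) \<partial>PW) \<partial>M)"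
    proof (rule nn_integral_multc[symmetric])
      have "g \<in> borel_measurable borel" by (rule borel_measurable_continuous_onI[OF g(1)])
      from measurable_compose[OF Ym this] show "(\<lambda>\<omega>. indicator C \<omega> * ennreal (g (Y (T \<omega>) \<omega>))) \<in> borel_measurable M"
        by measurable
    qed
    also have "\<dots> = (\<integral>\<^sup>+\<omega>. indicator C \<omega> * (\<integral>\<^sup>+w. H (\<iota> (Y (T \<omega>) \<omega>, w)) \<partial>PW) \<partial>M)"
    proof (intro nn_integral_cong)
      fix \<omega>
      have m: "(\<lambda>w. ennreal (\<Prod>i\<in>J'. k i (w i))) \<in> borel_measurable PW"
        unfolding measurable_cong_sets[OF sets_PW refl]
      proof (intro measurable_compose[OF _ measurable_ennreal] borel_measurable_prod)
        fix i assume "i \<in> J'"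
        then have "(\<lambda>w. w i) \<in> W \<rightarrow>\<^sub>M borel" using J'(2) by (intro measurable_component_singleton) auto
        then show "(\<lambda>w. k i (w i)) \<in> borel_measurable W"
          by (rule measurable_compose) (rule borel_measurable_continuous_onI[OF k(1)])
      qed
      show "(indicator C \<omega> * ennreal (g (Y (T \<omega>) \<omega>))) * (\<integral>\<^sup>+w. ennreal (\<Prod>i\<in>J'. k i (w i)) \<partial>PW) =
          indicator C \<omega> * (\<integral>\<^sup>+w. H (\<iota> (Y (T \<omega>) \<omega>, w)) \<partial>PW)"
        unfolding split fst_conv snd_conv by (simp only: nn_integral_cmult[OF m] mult.assoc)
    qed
    also have "\<dots> = (\<integral>\<^sup>+z. H (\<iota> z) \<partial>(L \<Otimes>\<^sub>M PW))"
      by (rule fub[OF Hi, symmetric])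
    also have "\<dots> = (\<integral>\<^sup>+w. H w \<partial>distr (L \<Otimes>\<^sub>M PW) ?V \<iota>)"
      using \<iota> H by (subst nn_integral_distr) (simp_all add: measurable_cong_sets[OF sL refl])
    finally show "(\<integral>\<^sup>+w. ennreal (\<Prod>i\<in>J. k i (w i)) \<partial>distr ?P ?V \<iota>) = (\<integral>\<^sup>+w. ennreal (\<Prod>i\<in>J. k i (w i)) \<partial>distr (L \<Otimes>\<^sub>M PW) ?V \<iota>)"
      unfolding H_def .
  qed auto
  then have eq: "(\<integral>\<^sup>+w. f (\<pi> w) \<partial>distr ?P ?V \<iota>) = (\<integral>\<^sup>+w. f (\<pi> w) \<partial>distr (L \<Otimes>\<^sub>M PW) ?V \<iota>)"
    by simp
  have bk: "(\<integral>\<^sup>+w. f (\<pi> w) \<partial>distr Q ?V \<iota>) = (\<integral>\<^sup>+z. f z \<partial>Q)" if Q: "sets Q = sets (borel \<Otimes>\<^sub>M W)" for Q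
  proof -
    have "(\<integral>\<^sup>+w. f (\<pi> w) \<partial>distr Q ?V \<iota>) = (\<integral>\<^sup>+z. f (\<pi> (\<iota> z)) \<partial>Q)"
      using \<iota> measurable_compose[OF \<pi> f] by (intro nn_integral_distr) (simp_all add: measurable_cong_sets[OF Q refl])
    also have "\<dots> = (\<integral>\<^sup>+z. f z \<partial>Q)"
      using sets_eq_imp_space_eq[OF Q] by (intro nn_integral_cong) (auto simp: \<pi>\<iota> space_pair_measure)
    finally show ?thesis .
  qed
  show ?thesis
    using eq unfolding bk[OF sets_distr] bk[OF sL] lhs[OF f] fub[OF f] .
qed

end

section \<open>Exit times of right-continuous paths\<close>

text \<open>
  \<open>sig U y\<close> is the limit of the hitting times of shrinking neighbourhoods of the complement of \<open>U\<close>.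
  Unlike the exit time it is a measurable function of the values of \<open>y\<close> at rational times. It is smaller
  than the exit time only if \<open>y\<close> approaches the complement of \<open>U\<close> from the left without reaching it.
\<close>

definition hit :: "nat \<Rightarrow> 'a::metric_space set \<Rightarrow> (real \<Rightarrow> 'a) \<Rightarrow> ereal" where
  "hit n U y = (INF q\<in>{q\<in>\<rat>. 0 \<le> q}. if infdist (y q) (- U) < inverse (real (Suc n)) then ereal q else \<infinity>)"

definition sig :: "'a::metric_space set \<Rightarrow> (real \<Rightarrow> 'a) \<Rightarrow> ereal" where
  "sig U y = (SUP n. hit n U y)"

text \<open>A relation between path and time avoids a junk exit position for paths that never leave
  \<open>U\<close>.\<close>

definition exits :: "(real \<Rightarrow> 'a) \<Rightarrow> 'a set \<Rightarrow> real \<Rightarrow> bool" where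
  "exits y U t \<longleftrightarrow> 0 \<le> t \<and> y t \<notin> U \<and> (\<forall>s. 0 \<le> s \<and> s < t \<longrightarrow> y s \<in> U)"

definition right_cont :: "(real \<Rightarrow> 'a::topological_space) \<Rightarrow> bool" where
  "right_cont y \<longleftrightarrow> (\<forall>t\<ge>0. (y \<longlongrightarrow> y t) (at_right t))"

lemma hit_less_iff:
  "hit n U y < ereal t \<longleftrightarrow> (\<exists>q\<in>\<rat>. 0 \<le> q \<and> q < t \<and> infdist (y q) (- U) < inverse (real (Suc n)))"
  unfolding hit_def INF_less_iff by (auto split: if_splits)

lemma hit_nonneg: "0 \<le> hit n U y"
  unfolding hit_def by (rule INF_greatest) auto

lemma sig_nonneg: "0 \<le> sig U y"
  unfolding sig_def by (rule SUP_upper2[of 0]) (auto simp: hit_nonneg)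

lemma hit_le_sig: "hit n U y \<le> sig U y"
  unfolding sig_def by (rule SUP_upper) simp

lemma hit_mono: "n \<le> m \<Longrightarrow> hit n U y \<le> hit m U y"
  unfolding hit_def
proof (rule INF_mono)
  fix q assume "n \<le> m" and q: "q \<in> {q \<in> \<rat>. 0 \<le> (q::real)}"
  then have le: "inverse (real (Suc m)) \<le> inverse (real (Suc n))" by (simp add: le_imp_inverse_le)
  have "(if infdist (y q) (- U) < inverse (real (Suc n)) then ereal q else \<infinity>)
      \<le> (if infdist (y q) (- U) < inverse (real (Suc m)) then ereal q else \<infinity>)"
    by (auto simp del: of_nat_Suc dest: order_less_le_trans[OF _ le])
  then show "\<exists>p\<in>{q \<in> \<rat>. 0 \<le> q}. (if infdist (y p) (- U) < inverse (real (Suc n)) then ereal p else \<infinity>)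
      \<le> (if infdist (y q) (- U) < inverse (real (Suc m)) then ereal q else \<infinity>)"
    using q by blast
qed

lemma sig_cong: "(\<And>q. 0 \<le> q \<Longrightarrow> y q = y' q) \<Longrightarrow> sig U y = sig U y'"
  unfolding sig_def hit_def by (intro SUP_cong INF_cong refl) simp

lemma rational_right:
  fixes s :: real
  assumes "eventually P (at_right s)" "s < t"
  obtains q where "q \<in> \<rat>" "s < q" "q < t" "P q"
proof -
  obtain b where b: "b > s" "\<And>u. s < u \<Longrightarrow> u < b \<Longrightarrow> P u"
    using assms(1) unfolding eventually_at_right_field by blast
  obtain q where "q \<in> \<rat>" "s < q" "q < min b t"
    using Rats_dense_in_real[of s "min b t"] b(1) assms(2) by auto
  then show ?thesis using that b(2) by auto
qed

text \<open>\<open>hit\<close> looks at rational times only, but being strictly close to the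
  complement persists for a short while to the right of \<open>s\<close>, and such an interval
  contains rationals.\<close>

lemma hit_le:
  assumes y: "right_cont y" and s: "0 \<le> s" "infdist (y s) (- U) < inverse (real (Suc n))"
  shows "hit n U y \<le> ereal s"
proof (rule ccontr)
  assume "\<not> ?thesis"
  then have "ereal s < hit n U y" by simp
  then obtain t where t: "ereal s < ereal t" "ereal t < hit n U y"
    using ereal_dense2 by blast
  have "((\<lambda>u. infdist (y u) (- U)) \<longlongrightarrow> infdist (y s) (- U)) (at_right s)"
    using y s(1) unfolding right_cont_def by (intro tendsto_infdist) simp
  then have "eventually (\<lambda>u. infdist (y u) (- U) < inverse (real (Suc n))) (at_right s)"
    using s(2) by (rule order_tendstoD)
  moreover have "s < t" using t by simp
  ultimately obtain q where "q \<in> \<rat>" "s < q" "q < t" "infdist (y q) (- U) < inverse (real (Suc n))"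
    by (rule rational_right)
  then have "hit n U y < ereal t" unfolding hit_less_iff using s(1) by (intro bexI[of _ q]) auto
  then show False using t(2) by simp
qed

text \<open>The infimum over rational times need not be attained, so only the weak inequality
  survives; a strict violation would persist to the right of \<open>r\<close> and keep the rational
  hits away from it.\<close>

lemma infdist_at_hit:
  assumes y: "right_cont y" and r: "hit n U y = ereal r"
  shows "infdist (y r) (- U) \<le> inverse (real (Suc n))"
proof (rule ccontr)
  assume "\<not> ?thesis"
  then have gt: "inverse (real (Suc n)) < infdist (y r) (- U)" by simp
  have r0: "0 \<le> r" using hit_nonneg[of n U y] r by simp
  have "((\<lambda>u. infdist (y u) (- U)) \<longlongrightarrow> infdist (y r) (- U)) (at_right r)"
    using y r0 unfolding right_cont_def by (intro tendsto_infdist) simp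
  then have "eventually (\<lambda>u. inverse (real (Suc n)) < infdist (y u) (- U)) (at_right r)"
    using gt by (rule order_tendstoD)
  then obtain b where b: "b > r" "\<And>u. r < u \<Longrightarrow> u < b \<Longrightarrow> inverse (real (Suc n)) < infdist (y u) (- U)"
    unfolding eventually_at_right_field by blast
  have "hit n U y < ereal b" using r b(1) by simp
  then obtain q where q: "q \<in> \<rat>" "0 \<le> q" "q < b" "infdist (y q) (- U) < inverse (real (Suc n))"
    unfolding hit_less_iff by blast
  have "hit n U y \<le> ereal q" by (rule hit_le[OF y q(2,4)])
  then have "r \<le> q" using r by simp
  then show False using b(2)[of q] gt q(3,4) by (cases "q = r") auto
qed

lemma sig_le:
  assumes y: "right_cont y" and s: "0 \<le> s" "y s \<notin> U"
  shows "sig U y \<le> ereal s"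
  unfolding sig_def
proof (rule SUP_least)
  fix n
  have "infdist (y s) (- U) = 0" using s(2) by simp
  then show "hit n U y \<le> ereal s" using hit_le[OF y s(1), of U n] by simp
qed

lemma exits_unique: "exits y U s \<Longrightarrow> exits y U t \<Longrightarrow> s = t"
  unfolding exits_def by (metis linorder_neqE_linordered_idom)

text \<open>The infimum of the times outside \<open>U\<close> is itself such a time: if the path
  were in the open set \<open>U\<close> there, it would remain in \<open>U\<close> a little
  longer.\<close>

lemma exits_exists:
  assumes y: "right_cont y" and U: "open U" and s: "0 \<le> s" "y s \<notin> U"
  shows "\<exists>t. exits y U t"
proof -
  let ?Z = "{t. 0 \<le> t \<and> y t \<notin> U}"
  have ne: "?Z \<noteq> {}" and bd: "bdd_below ?Z" using s by (auto intro: bdd_belowI)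
  define t where "t = Inf ?Z"
  have t0: "0 \<le> t" unfolding t_def using ne by (intro cInf_greatest) auto
  have before: "y u \<in> U" if "0 \<le> u" "u < t" for u
    using that cInf_lower[OF _ bd, of u] unfolding t_def by force
  have "y t \<notin> U"
  proof
    assume "y t \<in> U"
    then have "eventually (\<lambda>u. y u \<in> U) (at_right t)"
      using y t0 U unfolding right_cont_def by (intro topological_tendstoD) auto
    then obtain b where b: "b > t" "\<And>u. t < u \<Longrightarrow> u < b \<Longrightarrow> y u \<in> U"
      unfolding eventually_at_right_field by blast
    have "b \<le> Inf ?Z"
    proof (rule cInf_greatest[OF ne])
      fix u assume u: "u \<in> ?Z"
      then have "t \<le> u" unfolding t_def by (intro cInf_lower bd)
      then show "b \<le> u" using b(2)[of u] u \<open>y t \<in> U\<close> by (cases "u = t") (auto simp: not_le[symmetric])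
    qed
    then show False using b(1) unfolding t_def by simp
  qed
  then show ?thesis unfolding exits_def using t0 before by blast
qed

lemma exit_time_exits:
  assumes "exits y U t"
  shows "exit_time y U = ereal t" "exit_point y U = y t"
proof -
  show "exit_time y U = ereal t"
    unfolding exit_time_def
  proof (rule antisym)
    show "Inf (ereal ` {t. 0 \<le> t \<and> y t \<notin> U}) \<le> ereal t"
      using assms by (intro Inf_lower) (auto simp: exits_def)
    show "ereal t \<le> Inf (ereal ` {t. 0 \<le> t \<and> y t \<notin> U})"
      using assms by (intro Inf_greatest) (auto simp: exits_def not_less[symmetric])
  qed
  then show "exit_point y U = y t" by (simp add: exit_point_def)
qed

lemma exit_time_finite_iff:
  assumes y: "right_cont y" and U: "open U"
  shows "exit_time y U < \<infinity> \<longleftrightarrow> (\<exists>t. exits y U t)"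
proof
  assume "exit_time y U < \<infinity>"
  moreover have "exit_time y U = \<infinity>" if "{t. 0 \<le> t \<and> y t \<notin> U} = {}"
    unfolding exit_time_def that by (simp add: top_ereal_def)
  ultimately have "{t. 0 \<le> t \<and> y t \<notin> U} \<noteq> {}" by force
  then show "\<exists>t. exits y U t" using exits_exists[OF y U] by blast
qed (auto simp: exit_time_exits)

text \<open>\<open>sig\<close> is never later than the first time outside \<open>U\<close>; if the
  path is outside \<open>U\<close> at time \<open>sig\<close>, it is not earlier either.\<close>

lemma exits_iff_sig:
  assumes y: "right_cont y" and U: "open U"
    and reg: "sig U y < \<infinity> \<Longrightarrow> y (real_of_ereal (sig U y)) \<notin> U"
  shows "exits y U t \<longleftrightarrow> sig U y = ereal t"
proof -
  have 1: "exits y U r" if r: "sig U y = ereal r" for r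
    unfolding exits_def
  proof (intro conjI allI impI)
    show "0 \<le> r" using sig_nonneg[of U y] r by simp
    show "y r \<notin> U" using reg r by simp
    fix s assume s: "0 \<le> s \<and> s < r"
    show "y s \<in> U"
    proof (rule ccontr)
      assume "y s \<notin> U"
      then have "sig U y \<le> ereal s" using sig_le[OF y] s by blast
      then show False using s r by simp
    qed
  qed
  show ?thesis
  proof
    assume t: "exits y U t"
    then have "sig U y \<le> ereal t" using sig_le[OF y] by (simp add: exits_def)
    then obtain r where "sig U y = ereal r"
      using sig_nonneg[of U y] by (cases "sig U y") auto
    then show "sig U y = ereal t" using 1 t exits_unique by metis
  qed (rule 1)
qed

lemma exits_shift:
  assumes E: "exits y E s" "E \<subseteq> D"
  shows "exits y D t \<longleftrightarrow> s \<le> t \<and> exits (\<lambda>u. y (s + u)) D (t - s)"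
proof
  assume D: "exits y D t"
  have "s \<le> t"
  proof (rule ccontr)
    assume "\<not> s \<le> t"
    then have "y t \<in> E" using E(1) D by (auto simp: exits_def)
    then show False using E(2) D by (auto simp: exits_def)
  qed
  then show "s \<le> t \<and> exits (\<lambda>u. y (s + u)) D (t - s)"
    using D E by (auto simp: exits_def)
next
  assume *: "s \<le> t \<and> exits (\<lambda>u. y (s + u)) D (t - s)"
  have "y u \<in> D" if "0 \<le> u" "u < t" for u
  proof (cases "u < s")
    case True
    then show ?thesis using E that by (auto simp: exits_def)
  next
    case False
    then have "y (s + (u - s)) \<in> D" using * that unfolding exits_def by (metis diff_ge_0_iff_ge diff_strict_right_mono not_less)
    then show ?thesis by simp
  qed
  then show "exits y D t" using * E(1) by (auto simp: exits_def)
qed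

section \<open>Quasi-left-continuity\<close>

context levy
begin

lemma right_cont_path: "\<omega> \<in> space M \<Longrightarrow> right_cont (\<lambda>t. x + Y t \<omega>)"
  unfolding right_cont_def using Y_right by (auto intro!: tendsto_add)

lemma right_cont_shift: "\<omega> \<in> space M \<Longrightarrow> 0 \<le> s \<Longrightarrow> right_cont (\<lambda>t. x + Y (s + t) \<omega>)"
  unfolding right_cont_def
proof (intro allI impI tendsto_add tendsto_const)
  fix t :: real assume w: "\<omega> \<in> space M" "0 \<le> s" "0 \<le> t"
  have "((\<lambda>u. Y u \<omega>) \<longlongrightarrow> Y (s + t) \<omega>) (at_right (t + s))" using Y_right[OF w(1), of "s + t"] w by (simp add: add.commute)
  then show "((\<lambda>u. Y (s + u) \<omega>) \<longlongrightarrow> Y (s + t) \<omega>) (at_right t)"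
    by (subst (asm) at_right_to_0) (subst at_right_to_0, simp add: filterlim_filtermap ac_simps)
qed

lemma hit_F:
  assumes "0 \<le> t"
  shows "{\<omega> \<in> space M. hit n U (\<lambda>q. x + Y q \<omega>) < ereal t} \<in> sets (F t)"
proof -
  have "{\<omega> \<in> space M. hit n U (\<lambda>q. x + Y q \<omega>) < ereal t} =
      (\<Union>q\<in>{q\<in>\<rat>. 0 \<le> q \<and> q < t}. {\<omega> \<in> space M. infdist (x + Y q \<omega>) (- U) < inverse (real (Suc n))})"
    unfolding hit_less_iff by auto
  also have "\<dots> \<in> sets (F t)"
  proof (rule sets.countable_UN')
    show "countable {q \<in> \<rat>. 0 \<le> q \<and> q < t}" by (rule countable_subset[OF _ countable_rat]) auto
    show "(\<lambda>q. {\<omega> \<in> space M. infdist (x + Y q \<omega>) (- U) < inverse (real (Suc n))}) ` {q \<in> \<rat>. 0 \<le> q \<and> q < t} \<subseteq> sets (F t)"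
    proof (rule image_subsetI)
      fix q assume "q \<in> {q \<in> \<rat>. 0 \<le> q \<and> q < t}"
      then have [measurable]: "Y q \<in> borel_measurable (F t)" by (intro Y_F_measurable) auto
      have "(\<lambda>z. infdist (x + z) (- U)) \<in> borel_measurable borel"
        by (intro borel_measurable_continuous_onI continuous_on_infdist continuous_on_add continuous_on_const continuous_on_id)
      from measurable_compose[OF _ this, of "Y q" "F t"]
      have "(\<lambda>\<omega>. infdist (x + Y q \<omega>) (- U)) \<in> borel_measurable (F t)" by simp
      then have "{\<omega> \<in> space (F t). infdist (x + Y q \<omega>) (- U) < inverse (real (Suc n))} \<in> sets (F t)"
        by measurable
      then show "{\<omega> \<in> space M. infdist (x + Y q \<omega>) (- U) < inverse (real (Suc n))} \<in> sets (F t)" by simp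
    qed
  qed
  finally show ?thesis .
qed

lemma optional_time_hit: "optional_time (\<lambda>\<omega>. hit n U (\<lambda>q. x + Y q \<omega>))"
  unfolding optional_time_def using hit_F hit_nonneg by auto

text \<open>Strict inequalities do not pass to a supremum, hence the intermediate rational
  \<open>r\<close> that bounds all the hitting times at once.\<close>

lemma optional_time_sig: "optional_time (\<lambda>\<omega>. sig U (\<lambda>q. x + Y q \<omega>))"
  unfolding optional_time_def
proof (intro conjI allI impI sig_nonneg)
  fix t :: real assume t: "0 \<le> t"
  let ?h = "\<lambda>n \<omega>. hit n U (\<lambda>q. x + Y q \<omega>)"
  have "{\<omega> \<in> space M. sig U (\<lambda>q. x + Y q \<omega>) < ereal t} =
      (\<Union>r\<in>{r\<in>\<rat>. 0 \<le> r \<and> r < t}. {\<omega> \<in> space M. \<forall>n. ?h n \<omega> < ereal r})"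
  proof (rule set_eqI, rule iffI)
    fix \<omega> assume w: "\<omega> \<in> {\<omega> \<in> space M. sig U (\<lambda>q. x + Y q \<omega>) < ereal t}"
    then obtain s where s: "sig U (\<lambda>q. x + Y q \<omega>) = ereal s" "s < t" "0 \<le> s"
      using sig_nonneg[of U "\<lambda>q. x + Y q \<omega>"] by (cases "sig U (\<lambda>q. x + Y q \<omega>)") auto
    obtain r where r: "r \<in> \<rat>" "s < r" "r < t" using Rats_dense_in_real[OF s(2)] by blast
    have "?h n \<omega> < ereal r" for n
      using hit_le_sig[of n U "\<lambda>q. x + Y q \<omega>"] s(1) r(2) by (simp add: le_less_trans)
    then show "\<omega> \<in> (\<Union>r\<in>{r\<in>\<rat>. 0 \<le> r \<and> r < t}. {\<omega> \<in> space M. \<forall>n. ?h n \<omega> < ereal r})"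
      using w r s(3) by auto
  next
    fix \<omega> assume "\<omega> \<in> (\<Union>r\<in>{r\<in>\<rat>. 0 \<le> r \<and> r < t}. {\<omega> \<in> space M. \<forall>n. ?h n \<omega> < ereal r})"
    then obtain r where r: "r < t" "\<And>n. ?h n \<omega> < ereal r" "\<omega> \<in> space M" by auto
    have "sig U (\<lambda>q. x + Y q \<omega>) \<le> ereal r"
      unfolding sig_def by (rule SUP_least) (rule less_imp_le[OF r(2)])
    then show "\<omega> \<in> {\<omega> \<in> space M. sig U (\<lambda>q. x + Y q \<omega>) < ereal t}"
      using r by (simp add: le_less_trans)
  qed
  also have "\<dots> \<in> sets (F t)"
  proof (rule sets.countable_UN')
    show "countable {q \<in> \<rat>. 0 \<le> q \<and> q < t}" by (rule countable_subset[OF _ countable_rat]) auto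
    show "(\<lambda>r. {\<omega> \<in> space M. \<forall>n. ?h n \<omega> < ereal r}) ` {q \<in> \<rat>. 0 \<le> q \<and> q < t} \<subseteq> sets (F t)"
    proof (rule image_subsetI)
      fix r assume "r \<in> {q \<in> \<rat>. 0 \<le> q \<and> q < t}"
      then have "{\<omega> \<in> space M. ?h n \<omega> < ereal r} \<in> sets (F t)" for n
        using hit_F[of r n U x] F_mono[of r t] by auto
      then have "(\<Inter>n. {\<omega> \<in> space M. ?h n \<omega> < ereal r}) \<in> sets (F t)"
        by (intro sets.countable_INT) auto
      moreover have "{\<omega> \<in> space M. \<forall>n. ?h n \<omega> < ereal r} = (\<Inter>n. {\<omega> \<in> space M. ?h n \<omega> < ereal r})" by auto
      ultimately show "{\<omega> \<in> space M. \<forall>n. ?h n \<omega> < ereal r} \<in> sets (F t)" by simp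
    qed
  qed
  finally show "{\<omega> \<in> space M. sig U (\<lambda>q. x + Y q \<omega>) < ereal t} \<in> sets (F t)" .
qed

lemma component_measurable: "0 \<le> q \<Longrightarrow> (\<lambda>w. w q) \<in> W \<rightarrow>\<^sub>M borel"
  by (rule measurable_component_singleton) simp

lemma fut_prob:
  assumes S: "optional_time S" and V: "V \<in> sets W"
  shows "emeasure M {\<omega> \<in> space M. S \<omega> < \<infinity> \<and> fut (real_of_ereal (S \<omega>)) \<omega> \<in> V} \<le> emeasure PW V"
proof -
  have Sm[measurable]: "S \<in> borel_measurable M" by (rule optional_time_measurable[OF S])
  have T: "0 \<le> real_of_ereal (S \<omega>)" for \<omega> using S by (simp add: optional_time_def real_of_ereal_pos)
  have [measurable]: "(\<lambda>\<omega>. fut (real_of_ereal (S \<omega>)) \<omega>) \<in> M \<rightarrow>\<^sub>M W"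
    using T by (intro fut_random_time_measurable) simp_all
  note [measurable] = V
  let ?C = "{\<omega> \<in> space M. S \<omega> < \<infinity>}"
  have m: "(\<lambda>z. indicator V (snd z) :: ennreal) \<in> borel_measurable (borel \<Otimes>\<^sub>M W)" by measurable
  have "emeasure M {\<omega> \<in> space M. S \<omega> < \<infinity> \<and> fut (real_of_ereal (S \<omega>)) \<omega> \<in> V} =
      (\<integral>\<^sup>+\<omega>. indicator {\<omega> \<in> space M. S \<omega> < \<infinity> \<and> fut (real_of_ereal (S \<omega>)) \<omega> \<in> V} \<omega> \<partial>M)"
    by (rule nn_integral_indicator[symmetric]) measurable
  also have "\<dots> = (\<integral>\<^sup>+\<omega>. indicator ?C \<omega> * indicator V (fut (real_of_ereal (S \<omega>)) \<omega>) \<partial>M)"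
    by (intro nn_integral_cong) (auto simp: indicator_def)
  also have "\<dots> = (\<integral>\<^sup>+\<omega>. indicator ?C \<omega> * (\<integral>\<^sup>+w. indicator V w \<partial>PW) \<partial>M)"
    using strong_markov[OF S m] by simp
  also have "\<dots> = (\<integral>\<^sup>+\<omega>. emeasure PW V * indicator ?C \<omega> \<partial>M)"
    using V by (simp add: sets_PW mult.commute)
  also have "\<dots> = emeasure PW V * emeasure M ?C"
    by (rule nn_integral_cmult_indicator) measurable
  also have "\<dots> \<le> emeasure PW V * 1"
    by (intro mult_left_mono) (simp_all add: emeasure_le_1)
  finally show ?thesis by simp
qed

lemma prob_fut0:
  assumes "Measurable.pred W P"
  shows "emeasure PW {w \<in> space W. P w} = emeasure M {\<omega> \<in> space M. P (fut 0 \<omega>)}"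
proof -
  have "{w \<in> space W. P w} \<in> sets W" using assms by simp
  then have "emeasure PW {w \<in> space W. P w} = emeasure M (fut 0 -` {w \<in> space W. P w} \<inter> space M)"
    unfolding PW_def by (intro emeasure_distr fut_measurable) auto
  also have "fut 0 -` {w \<in> space W. P w} \<inter> space M = {\<omega> \<in> space M. P (fut 0 \<omega>)}"
    using measurable_space[OF fut_measurable[of 0]] by auto
  finally show ?thesis .
qed

lemma large_move_pred: "Measurable.pred W (\<lambda>w. \<exists>q\<in>{q \<in> \<rat>. 0 \<le> q \<and> q < t}. \<rho> < norm (w q))"
  unfolding pred_def
proof -
  have "{w \<in> space W. \<exists>q\<in>{q \<in> \<rat>. 0 \<le> q \<and> q < t}. \<rho> < norm (w q)} =
      (\<Union>q\<in>{q \<in> \<rat>. 0 \<le> q \<and> q < t}. {w \<in> space W. \<rho> < norm (w q)})"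
    by auto
  also have "\<dots> \<in> sets W"
  proof (rule sets.countable_UN')
    show "countable {q \<in> \<rat>. 0 \<le> q \<and> q < t}" by (rule countable_subset[OF _ countable_rat]) auto
    show "(\<lambda>q. {w \<in> space W. \<rho> < norm (w q)}) ` {q \<in> \<rat>. 0 \<le> q \<and> q < t} \<subseteq> sets W"
    proof (rule image_subsetI)
      fix q assume "q \<in> {q \<in> \<rat>. 0 \<le> q \<and> q < t}"
      then have [measurable]: "(\<lambda>w. w q) \<in> W \<rightarrow>\<^sub>M borel" by (intro component_measurable) simp
      show "{w \<in> space W. \<rho> < norm (w q)} \<in> sets W" by measurable
    qed
  qed
  finally show "{w \<in> space W. \<exists>q\<in>{q \<in> \<rat>. 0 \<le> q \<and> q < t}. \<rho> < norm (w q)} \<in> sets W" .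
qed

text \<open>The events decrease in \<open>k\<close>, and right-continuity at time 0 leaves no path
  in all of them.\<close>

lemma small_time_move:
  assumes "0 < \<rho>"
  shows "(\<lambda>k. emeasure PW {w \<in> space W. \<exists>q\<in>{q \<in> \<rat>. 0 \<le> q \<and> q < inverse (real (Suc k))}. \<rho> < norm (w q)}) \<longlonglongrightarrow> 0"
proof -
  let ?B = "\<lambda>k. {\<omega> \<in> space M. \<exists>q\<in>{q \<in> \<rat>. 0 \<le> q \<and> q < inverse (real (Suc k))}. \<rho> < norm (fut 0 \<omega> q)}"
  have "(\<lambda>k. emeasure M (?B k)) \<longlonglongrightarrow> emeasure M (\<Inter>k. ?B k)"
  proof (rule Lim_emeasure_decseq)
    show "range ?B \<subseteq> sets M"
    proof (rule image_subsetI)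
      fix k
      have "fut 0 -` {w \<in> space W. \<exists>q\<in>{q \<in> \<rat>. 0 \<le> q \<and> q < inverse (real (Suc k))}. \<rho> < norm (w q)} \<inter> space M \<in> sets M"
        by (rule measurable_sets[OF fut_measurable]) (use large_move_pred in simp_all)
      moreover have "fut 0 -` {w \<in> space W. \<exists>q\<in>{q \<in> \<rat>. 0 \<le> q \<and> q < inverse (real (Suc k))}. \<rho> < norm (w q)} \<inter> space M = ?B k"
        using measurable_space[OF fut_measurable[of 0]] by auto
      ultimately show "?B k \<in> sets M" by simp
    qed
    show "decseq ?B"
    proof (rule decseq_SucI, rule subsetI)
      fix k \<omega> assume "\<omega> \<in> ?B (Suc k)"
      then obtain q where q: "\<omega> \<in> space M" "q \<in> \<rat>" "0 \<le> q" "q < inverse (real (Suc (Suc k)))" "\<rho> < norm (fut 0 \<omega> q)" by auto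
      have "inverse (real (Suc (Suc k))) \<le> inverse (real (Suc k))" by (rule le_imp_inverse_le) auto
      then have "q < inverse (real (Suc k))" using q(4) by linarith
      then show "\<omega> \<in> ?B k" using q by blast
    qed
  qed simp
  moreover have "(\<Inter>k. ?B k) = {}"
  proof (rule equals0I)
    fix \<omega> assume w: "\<omega> \<in> (\<Inter>k. ?B k)"
    have "((\<lambda>s. norm (Y s \<omega>)) \<longlongrightarrow> norm (Y 0 \<omega>)) (at_right 0)"
      using w by (intro tendsto_norm Y_right) auto
    then have "eventually (\<lambda>s. norm (Y s \<omega>) < \<rho>) (at_right 0)"
      by (rule order_tendstoD) (use assms in simp)
    then obtain b where b: "b > 0" "\<And>u. 0 < u \<Longrightarrow> u < b \<Longrightarrow> norm (Y u \<omega>) < \<rho>"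
      unfolding eventually_at_right_field by blast
    obtain k where k: "inverse (real (Suc k)) < b" using reals_Archimedean[OF b(1)] by blast
    obtain q where q: "0 \<le> q" "q < inverse (real (Suc k))" "\<rho> < norm (fut 0 \<omega> q)" using w by blast
    have "norm (Y q \<omega>) \<le> \<rho>"
      using b(2)[of q] q(1,2) k assms by (cases "q = 0") auto
    then show False using q by (simp add: fut_def)
  qed
  ultimately show ?thesis using prob_fut0[OF large_move_pred] by simp
qed

text \<open>
  The hitting times increasing to \<^const>\<open>sig\<close> are optional, and a move of size \<open>\<rho>\<close> shortly after one
  of them is, by the strong Markov property, as unlikely as one shortly after time \<open>0\<close>.
\<close>

lemma AE_sig_regular:
  assumes U: "open U" "- U \<noteq> {}"
  shows "AE \<omega> in M. sig U (\<lambda>q. x + Y q \<omega>) < \<infinity> \<longrightarrow> x + Y (real_of_ereal (sig U (\<lambda>q. x + Y q \<omega>))) \<omega> \<notin> U"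
proof -
  define S where "S \<omega> = sig U (\<lambda>q. x + Y q \<omega>)" for \<omega>
  define T where "T \<omega> = real_of_ereal (S \<omega>)" for \<omega>
  define H where "H n \<omega> = hit n U (\<lambda>q. x + Y q \<omega>)" for n \<omega>
  have S: "optional_time S" and H: "optional_time (H n)" for n
    unfolding S_def[abs_def] H_def[abs_def] by (rule optional_time_sig optional_time_hit)+
  have Sm[measurable]: "S \<in> borel_measurable M" by (rule optional_time_measurable[OF S])
  have Hm[measurable]: "H n \<in> borel_measurable M" for n by (rule optional_time_measurable[OF H])
  have T: "0 \<le> T \<omega>" for \<omega> unfolding T_def S_def using sig_nonneg by (rule real_of_ereal_pos)
  have [measurable]: "T \<in> borel_measurable M" unfolding T_def[abs_def] by measurable
  have YT[measurable]: "(\<lambda>\<omega>. Y (T \<omega>) \<omega>) \<in> borel_measurable M"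
    by (rule Y_random_time_measurable[OF _ T]) simp
  have inf_m: "(\<lambda>z. infdist (x + z) (- U)) \<in> borel_measurable borel"
    by (intro borel_measurable_continuous_onI continuous_on_infdist continuous_on_add continuous_on_const continuous_on_id)
  have dm[measurable]: "(\<lambda>\<omega>. infdist (x + Y (T \<omega>) \<omega>) (- U)) \<in> borel_measurable M"
    using measurable_compose[OF YT inf_m] by simp
  define N where "N m = {\<omega> \<in> space M. S \<omega> < \<infinity> \<and> inverse (real (Suc m)) < infdist (x + Y (T \<omega>) \<omega>) (- U)}" for m
  have N[measurable]: "N m \<in> sets M" for m unfolding N_def by measurable
  \<comment> \<open>On \<open>N m\<close> the distance to the complement exceeds twice this value at
    the limit time, while at late hitting times it is below \<open>\<rho> m\<close>; the path must
    move by more than \<open>\<rho> m\<close> in between.\<close>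
  define \<rho> where "\<rho> m = inverse (real (Suc m)) / 2" for m
  have \<rho>: "0 < \<rho> m" for m by (simp add: \<rho>_def)
  define V where "V m k = {w \<in> space W. \<exists>q\<in>{q \<in> \<rat>. 0 \<le> q \<and> q < inverse (real (Suc k))}. \<rho> m < norm (w q)}" for m k
  have V: "V m k \<in> sets W" for m k unfolding V_def using large_move_pred by simp
  have le: "emeasure M (N m) \<le> emeasure PW (V m k)" for m k
  proof -
    define E where "E n = {\<omega> \<in> space M. H n \<omega> < \<infinity> \<and> fut (real_of_ereal (H n \<omega>)) \<omega> \<in> V m k}" for n
    have E: "E n \<in> sets M" for n
    proof -
      have T': "0 \<le> real_of_ereal (H n \<omega>)" for \<omega> unfolding H_def using hit_nonneg by (rule real_of_ereal_pos)
      have [measurable]: "(\<lambda>\<omega>. fut (real_of_ereal (H n \<omega>)) \<omega>) \<in> M \<rightarrow>\<^sub>M W"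
        using T' by (intro fut_random_time_measurable) simp_all
      note [measurable] = V
      show ?thesis unfolding E_def by measurable
    qed
    have Ele: "emeasure M (E n) \<le> emeasure PW (V m k)" for n
      unfolding E_def by (rule fut_prob[OF H V])
    have sub: "N m \<subseteq> (\<Union>i. \<Inter>n\<in>{i..}. E n)"
    proof
      fix \<omega> assume w: "\<omega> \<in> N m"
      then have wM: "\<omega> \<in> space M" and fin: "S \<omega> < \<infinity>" and big: "inverse (real (Suc m)) < infdist (x + Y (T \<omega>) \<omega>) (- U)"
        by (auto simp: N_def)
      have ST: "S \<omega> = ereal (T \<omega>)"
        using fin sig_nonneg[of U "\<lambda>q. x + Y q \<omega>"] unfolding T_def S_def by (cases "sig U (\<lambda>q. x + Y q \<omega>)") auto
      define \<delta> where "\<delta> = inverse (real (Suc k))"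
      have "ereal (T \<omega> - \<delta>) < S \<omega>" unfolding ST \<delta>_def by simp
      then obtain n1 where n1: "ereal (T \<omega> - \<delta>) < H n1 \<omega>"
        unfolding S_def sig_def H_def less_SUP_iff by blast
      obtain n2 where n2: "inverse (real (Suc n2)) < \<rho> m" using reals_Archimedean[OF \<rho>] by blast
      have "\<omega> \<in> E n" if n: "n \<ge> max n1 n2" for n
      proof -
        have "H n \<omega> \<le> S \<omega>" unfolding H_def S_def by (rule hit_le_sig)
        moreover have "0 \<le> H n \<omega>" unfolding H_def by (rule hit_nonneg)
        ultimately obtain r where r: "H n \<omega> = ereal r" "r \<le> T \<omega>" "0 \<le> r"
          unfolding ST by (cases "H n \<omega>") auto
        have "H n1 \<omega> \<le> H n \<omega>" unfolding H_def using n by (intro hit_mono) simp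
        then have "ereal (T \<omega> - \<delta>) < ereal r" using n1 r(1) by (metis less_le_trans)
        then have u: "T \<omega> - r < \<delta>" by simp
        have "infdist (x + Y r \<omega>) (- U) \<le> inverse (real (Suc n))"
          using infdist_at_hit[OF right_cont_path[OF wM], of n U x r] r(1) unfolding H_def by simp
        also have "\<dots> \<le> inverse (real (Suc n2))" using n by (intro le_imp_inverse_le) auto
        also have "\<dots> < \<rho> m" by (rule n2)
        finally have "infdist (x + Y r \<omega>) (- U) < \<rho> m" .
        moreover have "infdist (x + Y (T \<omega>) \<omega>) (- U) \<le> infdist (x + Y r \<omega>) (- U) + dist (x + Y (T \<omega>) \<omega>) (x + Y r \<omega>)"
          by (rule infdist_triangle)
        ultimately have "\<rho> m < dist (x + Y (T \<omega>) \<omega>) (x + Y r \<omega>)"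
          using big unfolding \<rho>_def by linarith
        then have mv: "\<rho> m < norm (Y (r + (T \<omega> - r)) \<omega> - Y r \<omega>)" by (simp add: dist_norm)
        have "right_cont (\<lambda>t. - Y r \<omega> + Y (r + t) \<omega>)" by (rule right_cont_shift[OF wM r(3)])
        then have "((\<lambda>t. - Y r \<omega> + Y (r + t) \<omega>) \<longlongrightarrow> - Y r \<omega> + Y (r + (T \<omega> - r)) \<omega>) (at_right (T \<omega> - r))"
          unfolding right_cont_def using r(2) by (metis diff_ge_0_iff_ge)
        then have "((\<lambda>t. norm (- Y r \<omega> + Y (r + t) \<omega>)) \<longlongrightarrow> norm (- Y r \<omega> + Y (r + (T \<omega> - r)) \<omega>)) (at_right (T \<omega> - r))"
          by (rule tendsto_norm)
        then have "eventually (\<lambda>t. \<rho> m < norm (- Y r \<omega> + Y (r + t) \<omega>)) (at_right (T \<omega> - r))"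
          by (rule order_tendstoD) (use mv in simp)
        \<comment> \<open>The move is observed after the possibly irrational delay
          \<open>T \<omega> - r\<close>; right-continuity shifts it to a rational delay slightly
          longer, the only kind that \<open>V\<close> inspects.\<close>
        then obtain q where q: "q \<in> \<rat>" "T \<omega> - r < q" "q < \<delta>" "\<rho> m < norm (- Y r \<omega> + Y (r + q) \<omega>)"
          using u by (rule rational_right)
        have q0: "0 \<le> q" using q(2) r(2) by linarith
        have "fut r \<omega> \<in> V m k"
          unfolding V_def using q q0 measurable_space[OF fut_measurable[OF r(3)] wM]
          by (auto simp: fut_def \<delta>_def intro!: bexI[of _ q])
        then show ?thesis unfolding E_def using wM r(1) by simp
      qed
      then show "\<omega> \<in> (\<Union>i. \<Inter>n\<in>{i..}. E n)" by blast
    qed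
    have INT: "(\<Inter>n\<in>{i..}. E n) \<in> sets M" for i
      by (rule sets.countable_INT') (use E in auto)
    \<comment> \<open>A Fatou argument: \<open>N m\<close> lies in the lower limit of the
      \<open>E n\<close>, each of which is at most as likely as a large move just after time
      0.\<close>
    have "emeasure M (N m) \<le> emeasure M (\<Union>i. \<Inter>n\<in>{i..}. E n)"
      by (intro emeasure_mono sub sets.countable_UN image_subsetI INT)
    also have "\<dots> = (SUP i. emeasure M (\<Inter>n\<in>{i..}. E n))"
    proof (rule SUP_emeasure_incseq[symmetric])
      show "range (\<lambda>i. \<Inter>n\<in>{i..}. E n) \<subseteq> sets M" using INT by blast
      show "incseq (\<lambda>i. \<Inter>n\<in>{i..}. E n)" by (rule incseq_SucI) auto
    qed
    also have "\<dots> \<le> emeasure PW (V m k)"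
    proof (rule SUP_least)
      fix i
      have "emeasure M (\<Inter>n\<in>{i..}. E n) \<le> emeasure M (E i)" using E by (intro emeasure_mono) auto
      then show "emeasure M (\<Inter>n\<in>{i..}. E n) \<le> emeasure PW (V m k)" using Ele[of i] by simp
    qed
    finally show ?thesis .
  qed
  have "emeasure M (N m) = 0" for m
  proof -
    have "emeasure M (N m) \<le> 0"
      by (rule LIMSEQ_le_const[OF small_time_move[OF \<rho>[of m]]]) (use le[of m] in \<open>auto simp: V_def\<close>)
    then show ?thesis by simp
  qed
  then have "AE \<omega> in M. \<forall>m. \<omega> \<notin> N m"
    unfolding AE_all_countable using N by (auto intro!: AE_not_in null_setsI)
  then show ?thesis
  proof (rule AE_mp, intro AE_I2 impI)
    fix \<omega> assume w: "\<omega> \<in> space M" and Nw: "\<forall>m. \<omega> \<notin> N m" and fin: "sig U (\<lambda>q. x + Y q \<omega>) < \<infinity>"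
    show "x + Y (real_of_ereal (sig U (\<lambda>q. x + Y q \<omega>))) \<omega> \<notin> U"
    proof
      assume "x + Y (real_of_ereal (sig U (\<lambda>q. x + Y q \<omega>))) \<omega> \<in> U"
      then have "x + Y (T \<omega>) \<omega> \<in> U" by (simp add: T_def S_def)
      then have "infdist (x + Y (T \<omega>) \<omega>) (- U) \<noteq> 0"
        using in_closed_iff_infdist_zero[of "- U" "x + Y (T \<omega>) \<omega>"] U by auto
      then have "0 < infdist (x + Y (T \<omega>) \<omega>) (- U)" using infdist_nonneg by (metis less_eq_real_def)
      then obtain m where "inverse (real (Suc m)) < infdist (x + Y (T \<omega>) \<omega>) (- U)" using reals_Archimedean by blast
      then have "\<omega> \<in> N m" using w fin by (simp add: N_def S_def)
      then show False using Nw by blast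
    qed
  qed
qed

section \<open>Exit probabilities are harmonic\<close>

text \<open>
  \<open>ev\<close> evaluates a right-continuous path; approximating the time from the right by dyadic numbers makes
  it jointly measurable in the path and the time.
\<close>

definition ev :: "(real \<Rightarrow> 'a) \<Rightarrow> real \<Rightarrow> 'a" where
  "ev w s = lim (\<lambda>k. w (dyc k s))"

text \<open>The exit event as a measurable set of pairs (starting point, path from 0).
  \<open>raw_exit U U\<close> is the irregular event that the path is still inside \<open>U\<close>
  at the limit of the hitting times; for open \<open>U\<close> with nonempty complement it is null,
  and off it this is the true exit event.\<close>

definition raw_exit :: "'a set \<Rightarrow> 'a set \<Rightarrow> 'a \<times> (real \<Rightarrow> 'a) \<Rightarrow> bool" where
  "raw_exit U A z \<longleftrightarrow> sig U (\<lambda>q. fst z + snd z q) < \<infinity> \<and>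
     fst z + ev (snd z) (real_of_ereal (sig U (\<lambda>q. fst z + snd z q))) \<in> A"

lemma component_random_measurable:
  assumes [measurable]: "s \<in> borel_measurable N" "v \<in> N \<rightarrow>\<^sub>M W" and s: "\<And>z. 0 \<le> s z"
  shows "(\<lambda>z. v z (dyc k (s z))) \<in> borel_measurable N"
proof -
  have [measurable]: "(\<lambda>z. v z (real n / 2 ^ k)) \<in> borel_measurable N" for n
    by (rule measurable_compose[OF assms(2) component_measurable]) simp
  show ?thesis
    unfolding dyc_eq[OF s]
    by (rule measurable_compose_countable[where f="\<lambda>n z. v z (real n / 2 ^ k)" and g="\<lambda>z. nat (\<lfloor>2 ^ k * s z\<rfloor> + 1)"]) measurable
qed

lemma sig_measurable: "(\<lambda>z. sig U (\<lambda>q. fst z + snd z q)) \<in> borel_measurable (borel \<Otimes>\<^sub>M W)"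
  unfolding sig_def hit_def
proof (intro borel_measurable_SUP borel_measurable_INF)
  show "countable {q \<in> \<rat>. 0 \<le> (q::real)}" by (rule countable_subset[OF _ countable_rat]) auto
  fix n :: nat and q :: real assume "q \<in> {q \<in> \<rat>. 0 \<le> q}"
  then have "(\<lambda>w. w q) \<in> W \<rightarrow>\<^sub>M borel" by (intro component_measurable) simp
  from measurable_compose[OF measurable_snd this]
  have [measurable]: "(\<lambda>z. fst z + snd z q) \<in> borel_measurable (borel \<Otimes>\<^sub>M W)"
    by (intro borel_measurable_add) auto
  have "(\<lambda>z. infdist z (- U)) \<in> borel_measurable borel"
    by (intro borel_measurable_continuous_onI continuous_on_infdist continuous_on_id)
  from measurable_compose[OF _ this, of "\<lambda>z. fst z + snd z q"]
  have [measurable]: "(\<lambda>z. infdist (fst z + snd z q) (- U)) \<in> borel_measurable (borel \<Otimes>\<^sub>M W)" by simp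
  show "(\<lambda>z. if infdist (fst z + snd z q) (- U) < inverse (real (Suc n)) then ereal q else \<infinity>) \<in> borel_measurable (borel \<Otimes>\<^sub>M W)"
    by measurable
qed simp

lemma raw_exit_pred:
  assumes [measurable]: "A \<in> sets borel"
  shows "Measurable.pred (borel \<Otimes>\<^sub>M W) (raw_exit U A)"
proof -
  note [measurable] = sig_measurable
  have nn: "0 \<le> real_of_ereal (sig U (\<lambda>q. fst z + snd z q))" for z :: "'a \<times> (real \<Rightarrow> 'a)"
    using sig_nonneg by (rule real_of_ereal_pos)
  have [measurable]: "(\<lambda>z. snd z (dyc k (real_of_ereal (sig U (\<lambda>q. fst z + snd z q))))) \<in> borel_measurable (borel \<Otimes>\<^sub>M W)" for k
    by (rule component_random_measurable[OF _ _ nn]) measurable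
  have [measurable]: "(\<lambda>z. ev (snd z) (real_of_ereal (sig U (\<lambda>q. fst z + snd z q)))) \<in> borel_measurable (borel \<Otimes>\<^sub>M W)"
    unfolding ev_def by (rule borel_measurable_lim_metric) measurable
  show ?thesis unfolding raw_exit_def by measurable
qed

lemma ev_fut:
  assumes "\<omega> \<in> space M" "0 \<le> s" "0 \<le> t"
  shows "ev (fut t \<omega>) s = Y (t + s) \<omega> - Y t \<omega>"
proof -
  have "0 \<le> dyc k s" for k using dyc_gt[of s k] assms by linarith
  then have "fut t \<omega> (dyc k s) = Y (dyc k s + t) \<omega> - Y t \<omega>" for k by (simp add: fut_def add.commute)
  moreover have "(\<lambda>k. Y (dyc k s + t) \<omega> - Y t \<omega>) \<longlonglongrightarrow> Y (s + t) \<omega> - Y t \<omega>"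
    by (intro tendsto_diff Y_dyc_tendsto tendsto_const assms)
  ultimately show ?thesis unfolding ev_def by (simp add: limI add.commute)
qed

lemma raw_exit_fut:
  assumes w: "\<omega> \<in> space M" "0 \<le> t"
  shows "raw_exit U A (x + Y t \<omega>, fut t \<omega>) \<longleftrightarrow>
    sig U (\<lambda>q. x + Y (t + q) \<omega>) < \<infinity> \<and> x + Y (t + real_of_ereal (sig U (\<lambda>q. x + Y (t + q) \<omega>))) \<omega> \<in> A"
proof -
  have eq: "sig U (\<lambda>q. x + Y t \<omega> + fut t \<omega> q) = sig U (\<lambda>q. x + Y (t + q) \<omega>)"
    by (rule sig_cong) (simp add: fut_def)
  have "0 \<le> real_of_ereal (sig U (\<lambda>q. x + Y (t + q) \<omega>))" using sig_nonneg by (rule real_of_ereal_pos)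
  then show ?thesis unfolding raw_exit_def fst_conv snd_conv eq by (simp add: ev_fut[OF w(1) _ w(2)])
qed

lemma raw_exit_regular:
  assumes w: "\<omega> \<in> space M" "0 \<le> t" and U: "open U" and reg: "\<not> raw_exit U U (x + Y t \<omega>, fut t \<omega>)"
  shows "raw_exit U A (x + Y t \<omega>, fut t \<omega>) \<longleftrightarrow> (\<exists>s. exits (\<lambda>q. x + Y (t + q) \<omega>) U s \<and> x + Y (t + s) \<omega> \<in> A)"
    and "exits (\<lambda>q. x + Y (t + q) \<omega>) U s \<longleftrightarrow> sig U (\<lambda>q. x + Y (t + q) \<omega>) = ereal s"
proof -
  show eq: "exits (\<lambda>q. x + Y (t + q) \<omega>) U s \<longleftrightarrow> sig U (\<lambda>q. x + Y (t + q) \<omega>) = ereal s" for s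
    using reg unfolding raw_exit_fut[OF w] by (intro exits_iff_sig right_cont_shift w U) auto
  show "raw_exit U A (x + Y t \<omega>, fut t \<omega>) \<longleftrightarrow> (\<exists>s. exits (\<lambda>q. x + Y (t + q) \<omega>) U s \<and> x + Y (t + s) \<omega> \<in> A)"
    unfolding raw_exit_fut[OF w] eq
    using sig_nonneg[of U "\<lambda>q. x + Y (t + q) \<omega>"] by (cases "sig U (\<lambda>q. x + Y (t + q) \<omega>)") auto
qed

lemma raw_exit_event: "A \<in> sets borel \<Longrightarrow> {\<omega> \<in> space M. raw_exit U A (x, fut 0 \<omega>)} \<in> sets M"
proof -
  assume A: "A \<in> sets borel"
  have [measurable]: "fut 0 \<in> M \<rightarrow>\<^sub>M W" by (rule fut_measurable) simp
  have "(\<lambda>\<omega>. (x, fut 0 \<omega>)) \<in> M \<rightarrow>\<^sub>M borel \<Otimes>\<^sub>M W" by measurable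
  from measurable_compose[OF this raw_exit_pred[OF A, of U]] show ?thesis by simp
qed

lemma AE_not_raw_exit:
  assumes U: "open U" "- U \<noteq> {}"
  shows "AE \<omega> in M. \<not> raw_exit U U (x, fut 0 \<omega>)"
  using AE_sig_regular[OF U, of x]
proof (rule AE_mp, intro AE_I2 impI)
  fix \<omega> assume "\<omega> \<in> space M" and "sig U (\<lambda>q. x + Y q \<omega>) < \<infinity> \<longrightarrow> x + Y (real_of_ereal (sig U (\<lambda>q. x + Y q \<omega>))) \<omega> \<notin> U"
  then show "\<not> raw_exit U U (x, fut 0 \<omega>)"
    using raw_exit_fut[of \<omega> 0 U U x] by auto
qed

lemma AE_raw_exit_iff:
  assumes U: "open U" "- U \<noteq> {}"
  shows "AE \<omega> in M. raw_exit U A (x, fut 0 \<omega>) \<longleftrightarrow>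
    exit_time (started_at x X \<omega>) U < \<infinity> \<and> exit_point (started_at x X \<omega>) U \<in> A"
  using AE_not_raw_exit[OF U, of x]
proof (rule AE_mp, intro AE_I2 impI)
  fix \<omega> assume w: "\<omega> \<in> space M" and reg: "\<not> raw_exit U U (x, fut 0 \<omega>)"
  have path: "started_at x X \<omega> = (\<lambda>t. x + Y t \<omega>)" by (simp add: started_at_def Y_def fun_eq_iff)
  have "raw_exit U A (x, fut 0 \<omega>) \<longleftrightarrow> (\<exists>s. exits (\<lambda>q. x + Y q \<omega>) U s \<and> x + Y s \<omega> \<in> A)"
    using raw_exit_regular(1)[OF w order_refl U(1), of x A] reg by simp
  also have "\<dots> \<longleftrightarrow> exit_time (started_at x X \<omega>) U < \<infinity> \<and> exit_point (started_at x X \<omega>) U \<in> A"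
    unfolding path exit_time_finite_iff[OF right_cont_path[OF w] U(1)] by (metis exit_time_exits(2))
  finally show "raw_exit U A (x, fut 0 \<omega>) \<longleftrightarrow>
    exit_time (started_at x X \<omega>) U < \<infinity> \<and> exit_point (started_at x X \<omega>) U \<in> A" .
qed

text \<open>The true exit event differs from a measurable one by a subset of a null set, hence its
  measurability in the completion.\<close>

lemma exit_prob_raw:
  assumes U: "open U" "- U \<noteq> {}" and A: "A \<in> sets borel"
  shows "exit_prob M X x U A = measure M {\<omega> \<in> space M. raw_exit U A (x, fut 0 \<omega>)}"
    and "{\<omega> \<in> space M. exit_time (started_at x X \<omega>) U < \<infinity> \<and> exit_point (started_at x X \<omega>) U \<in> A} \<in> sets (completion M)"
proof -
  let ?B = "{\<omega> \<in> space M. exit_time (started_at x X \<omega>) U < \<infinity> \<and> exit_point (started_at x X \<omega>) U \<in> A}"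
  let ?A = "{\<omega> \<in> space M. raw_exit U A (x, fut 0 \<omega>)}"
  have ev: "?A \<in> sets M" by (rule raw_exit_event[OF A])
  have ae: "AE \<omega> in completion M. \<omega> \<in> ?A \<longleftrightarrow> \<omega> \<in> ?B"
    using AE_completion[OF AE_raw_exit_iff[OF U, of A x]] by (rule AE_mp) (auto intro!: AE_I2)
  show B: "?B \<in> sets (completion M)"
    by (rule completion.in_sets_AE[OF ae]) (use ev in auto)
  have "measure (completion M) ?A = measure (completion M) ?B"
    by (rule measure_eq_AE[OF ae]) (use ev B in auto)
  then show "exit_prob M X x U A = measure M ?A" unfolding exit_prob_def using ev by simp
qed

lemma exit_prob_PW:
  assumes U: "open U" "- U \<noteq> {}" and A: "A \<in> sets borel"
  shows "ennreal (exit_prob M X x U A) = (\<integral>\<^sup>+w. indicator (Collect (raw_exit U A)) (x, w) \<partial>PW)"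
proof -
  have "(\<lambda>w. (x, w)) \<in> W \<rightarrow>\<^sub>M borel \<Otimes>\<^sub>M W" by measurable
  from measurable_compose[OF this raw_exit_pred[OF A, of U]]
  have p: "Measurable.pred W (\<lambda>w. raw_exit U A (x, w))" by simp
  have sp: "space PW = space W" by (rule sets_eq_imp_space_eq[OF sets_PW])
  have "(\<integral>\<^sup>+w. indicator (Collect (raw_exit U A)) (x, w) \<partial>PW) = (\<integral>\<^sup>+w. indicator {w \<in> space W. raw_exit U A (x, w)} w \<partial>PW)"
    by (intro nn_integral_cong) (auto simp: sp indicator_def)
  also have "\<dots> = emeasure PW {w \<in> space W. raw_exit U A (x, w)}"
    using p by (intro nn_integral_indicator) (simp add: sets_PW)
  also have "\<dots> = emeasure M {\<omega> \<in> space M. raw_exit U A (x, fut 0 \<omega>)}" by (rule prob_fut0[OF p])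
  finally show ?thesis by (simp add: exit_prob_raw[OF U A] emeasure_eq_measure)
qed

lemma exit_prob_measurable:
  assumes U: "open U" "- U \<noteq> {}" and A: "A \<in> sets borel"
  shows "(\<lambda>x. exit_prob M X x U A) \<in> borel_measurable borel"
proof -
  interpret PW: prob_space PW by (rule prob_space_PW)
  have "{z \<in> space (borel \<Otimes>\<^sub>M W). raw_exit U A z} \<in> sets (borel \<Otimes>\<^sub>M W)" using raw_exit_pred[OF A] by simp
  then have [measurable]: "(\<lambda>z. indicator {z \<in> space (borel \<Otimes>\<^sub>M W). raw_exit U A z} z :: ennreal) \<in> borel_measurable (borel \<Otimes>\<^sub>M W)"
    by simp
  have "(\<lambda>x. \<integral>\<^sup>+w. indicator {z \<in> space (borel \<Otimes>\<^sub>M W). raw_exit U A z} (x, w) \<partial>PW) \<in> borel_measurable borel"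
    by measurable
  moreover have sp: "space PW = space W" by (rule sets_eq_imp_space_eq[OF sets_PW])
  have "(\<integral>\<^sup>+w. indicator {z \<in> space (borel \<Otimes>\<^sub>M W). raw_exit U A z} (x, w) \<partial>PW) = ennreal (exit_prob M X x U A)" for x
    unfolding exit_prob_PW[OF U A] by (intro nn_integral_cong) (auto simp: sp indicator_def space_pair_measure)
  ultimately have "(\<lambda>x. ennreal (exit_prob M X x U A)) \<in> borel_measurable borel" by simp
  then have "(\<lambda>x. enn2real (ennreal (exit_prob M X x U A))) \<in> borel_measurable borel" by measurable
  then show ?thesis by (simp add: exit_prob_def)
qed

lemma AE_exit_value:
  fixes h :: "'a \<Rightarrow> real"
  assumes E: "open E" "- E \<noteq> {}"
  shows "AE \<omega> in M. exit_value h (started_at x X \<omega>) E =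
    (if sig E (\<lambda>q. x + Y q \<omega>) < \<infinity> then h (x + Y (real_of_ereal (sig E (\<lambda>q. x + Y q \<omega>))) \<omega>) else 0)"
  using AE_not_raw_exit[OF E, of x]
proof (rule AE_mp, intro AE_I2 impI)
  fix \<omega> assume w: "\<omega> \<in> space M" and reg: "\<not> raw_exit E E (x, fut 0 \<omega>)"
  have path: "started_at x X \<omega> = (\<lambda>t. x + Y t \<omega>)" by (simp add: started_at_def Y_def fun_eq_iff)
  have eq: "exits (\<lambda>q. x + Y q \<omega>) E s \<longleftrightarrow> sig E (\<lambda>q. x + Y q \<omega>) = ereal s" for s
    using raw_exit_regular(2)[OF w order_refl E(1), of x s] reg by simp
  show "exit_value h (started_at x X \<omega>) E =
    (if sig E (\<lambda>q. x + Y q \<omega>) < \<infinity> then h (x + Y (real_of_ereal (sig E (\<lambda>q. x + Y q \<omega>))) \<omega>) else 0)"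
  proof (cases "sig E (\<lambda>q. x + Y q \<omega>)")
    case (real s)
    then have ex: "exits (\<lambda>q. x + Y q \<omega>) E s" using eq by simp
    show ?thesis unfolding exit_value_def path exit_time_exits[OF ex] real by simp
  next
    case PInf
    then have "\<not> exit_time (\<lambda>q. x + Y q \<omega>) E < \<infinity>"
      unfolding exit_time_finite_iff[OF right_cont_path[OF w] E(1)] eq by simp
    then show ?thesis unfolding exit_value_def path PInf by simp
  qed (use sig_nonneg[of E "\<lambda>q. x + Y q \<omega>"] in simp)
qed

text \<open>The mean value property. Leaving \<open>D\<close> means leaving \<open>E\<close> and
  then, unless already outside, leaving \<open>D\<close> from the point reached; by the strong
  Markov property at \<open>sig E\<close> the second stage is a fresh copy of the process.\<close>

lemma nn_integral_exit_prob:
  assumes D: "open D" "- D \<noteq> {}" and A: "A \<in> sets borel" and E: "open E" "E \<subseteq> D"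
  shows "(\<integral>\<^sup>+\<omega>. (if sig E (\<lambda>q. x + Y q \<omega>) < \<infinity> then ennreal (exit_prob M X (x + Y (real_of_ereal (sig E (\<lambda>q. x + Y q \<omega>))) \<omega>) D A) else 0) \<partial>M)
    = ennreal (exit_prob M X x D A)"
proof -
  interpret PW: prob_space PW by (rule prob_space_PW)
  define S where "S \<omega> = sig E (\<lambda>q. x + Y q \<omega>)" for \<omega>
  define T where "T \<omega> = real_of_ereal (S \<omega>)" for \<omega>
  have E': "- E \<noteq> {}" using D E by auto
  have S: "optional_time S" unfolding S_def[abs_def] by (rule optional_time_sig)
  have Sm[measurable]: "S \<in> borel_measurable M" by (rule optional_time_measurable[OF S])
  have T: "0 \<le> T \<omega>" for \<omega> unfolding T_def S_def using sig_nonneg by (rule real_of_ereal_pos)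
  let ?C = "{\<omega> \<in> space M. S \<omega> < \<infinity>}"
  let ?Q = "borel \<Otimes>\<^sub>M W :: ('a \<times> (real \<Rightarrow> 'a)) measure"
  have [measurable]: "T \<in> borel_measurable M" unfolding T_def[abs_def] by measurable
  have YT[measurable]: "(\<lambda>\<omega>. Y (T \<omega>) \<omega>) \<in> borel_measurable M"
    by (rule Y_random_time_measurable[OF _ T]) simp
  have fT[measurable]: "(\<lambda>\<omega>. fut (T \<omega>) \<omega>) \<in> M \<rightarrow>\<^sub>M W"
    by (rule fut_random_time_measurable[OF _ T]) simp
  have spPW: "space PW = space W" by (rule sets_eq_imp_space_eq[OF sets_PW])
  have key: "(\<integral>\<^sup>+\<omega>. indicator ?C \<omega> * indicator (Collect (raw_exit D B)) (x + Y (T \<omega>) \<omega>, fut (T \<omega>) \<omega>) \<partial>M) =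
      (\<integral>\<^sup>+\<omega>. indicator ?C \<omega> * (\<integral>\<^sup>+w. indicator (Collect (raw_exit D B)) (x + Y (T \<omega>) \<omega>, w) \<partial>PW) \<partial>M)"
    if B: "B \<in> sets borel" for B
  proof -
    define R where "R = {z \<in> space ?Q. raw_exit D B (x + fst z, snd z)}"
    have "(\<lambda>z. (x + fst z, snd z)) \<in> ?Q \<rightarrow>\<^sub>M ?Q" by measurable
    from measurable_compose[OF this raw_exit_pred[OF B, of D]]
    have R: "R \<in> sets ?Q" unfolding R_def by simp
    then have "(indicator R :: _ \<Rightarrow> ennreal) \<in> borel_measurable ?Q" by simp
    from strong_markov[OF S this]
    have sm: "(\<integral>\<^sup>+\<omega>. indicator ?C \<omega> * indicator R (Y (T \<omega>) \<omega>, fut (T \<omega>) \<omega>) \<partial>M) =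
      (\<integral>\<^sup>+\<omega>. indicator ?C \<omega> * (\<integral>\<^sup>+w. indicator R (Y (T \<omega>) \<omega>, w) \<partial>PW) \<partial>M)"
      unfolding T_def .
    have "(\<integral>\<^sup>+\<omega>. indicator ?C \<omega> * indicator (Collect (raw_exit D B)) (x + Y (T \<omega>) \<omega>, fut (T \<omega>) \<omega>) \<partial>M) =
        (\<integral>\<^sup>+\<omega>. indicator ?C \<omega> * indicator R (Y (T \<omega>) \<omega>, fut (T \<omega>) \<omega>) \<partial>M)"
    proof (intro nn_integral_cong)
      fix \<omega> assume "\<omega> \<in> space M"
      then have "fut (T \<omega>) \<omega> \<in> space W" using measurable_space[OF fT] by blast
      then show "indicator ?C \<omega> * (indicator (Collect (raw_exit D B)) (x + Y (T \<omega>) \<omega>, fut (T \<omega>) \<omega>) :: ennreal) =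
          indicator ?C \<omega> * indicator R (Y (T \<omega>) \<omega>, fut (T \<omega>) \<omega>)"
        by (simp add: R_def space_pair_measure indicator_def)
    qed
    also have "\<dots> = (\<integral>\<^sup>+\<omega>. indicator ?C \<omega> * (\<integral>\<^sup>+w. indicator R (Y (T \<omega>) \<omega>, w) \<partial>PW) \<partial>M)" by (rule sm)
    also have "\<dots> = (\<integral>\<^sup>+\<omega>. indicator ?C \<omega> * (\<integral>\<^sup>+w. indicator (Collect (raw_exit D B)) (x + Y (T \<omega>) \<omega>, w) \<partial>PW) \<partial>M)"
    proof -
      have "(\<integral>\<^sup>+w. indicator R (Y (T \<omega>) \<omega>, w) \<partial>PW) = (\<integral>\<^sup>+w. indicator (Collect (raw_exit D B)) (x + Y (T \<omega>) \<omega>, w) \<partial>PW)" for \<omega>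
        by (intro nn_integral_cong) (simp add: R_def space_pair_measure indicator_def spPW)
      then show ?thesis by simp
    qed
    finally show ?thesis .
  qed
  \<comment> \<open>Regularity is also required of the path restarted at a random point; it follows
    from the statement for each fixed starting point by integrating over the exit position.\<close>
  have null: "AE \<omega> in M. \<omega> \<in> ?C \<longrightarrow> \<not> raw_exit D D (x + Y (T \<omega>) \<omega>, fut (T \<omega>) \<omega>)"
  proof -
    have D0: "(\<integral>\<^sup>+w. indicator (Collect (raw_exit D D)) (z, w) \<partial>PW) = 0" for z
    proof -
      have "exit_prob M X z D D = 0"
      proof -
        have "emeasure M {\<omega> \<in> space M. raw_exit D D (z, fut 0 \<omega>)} = emeasure M {}"
          using AE_not_raw_exit[OF D, of z] raw_exit_event[of D D z] D(1)
          by (intro emeasure_eq_AE) (auto elim!: AE_mp)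
        then show ?thesis unfolding exit_prob_raw[OF D borel_open[OF D(1)]] by (simp add: measure_def)
      qed
      then show ?thesis using exit_prob_PW[OF D borel_open[OF D(1)], of z] by simp
    qed
    define N where "N = {\<omega> \<in> space M. S \<omega> < \<infinity> \<and> raw_exit D D (x + Y (T \<omega>) \<omega>, fut (T \<omega>) \<omega>)}"
    have "(\<lambda>\<omega>. (x + Y (T \<omega>) \<omega>, fut (T \<omega>) \<omega>)) \<in> M \<rightarrow>\<^sub>M ?Q" by measurable
    from measurable_compose[OF this raw_exit_pred[OF borel_open[OF D(1)], of D]]
    have N[measurable]: "N \<in> sets M" unfolding N_def by measurable
    have "emeasure M N = (\<integral>\<^sup>+\<omega>. indicator ?C \<omega> * indicator (Collect (raw_exit D D)) (x + Y (T \<omega>) \<omega>, fut (T \<omega>) \<omega>) \<partial>M)"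
      unfolding nn_integral_indicator[OF N, symmetric] by (intro nn_integral_cong) (simp add: N_def indicator_def)
    also have "\<dots> = 0" unfolding key[OF borel_open[OF D(1)]] D0 by simp
    finally have "AE \<omega> in M. \<omega> \<notin> N" using N by (intro AE_not_in) (auto intro: null_setsI)
    then show ?thesis by (rule AE_mp) (auto simp: N_def intro!: AE_I2)
  qed
  have "(\<integral>\<^sup>+\<omega>. (if S \<omega> < \<infinity> then ennreal (exit_prob M X (x + Y (T \<omega>) \<omega>) D A) else 0) \<partial>M) =
      (\<integral>\<^sup>+\<omega>. indicator ?C \<omega> * (\<integral>\<^sup>+w. indicator (Collect (raw_exit D A)) (x + Y (T \<omega>) \<omega>, w) \<partial>PW) \<partial>M)"
    unfolding exit_prob_PW[OF D A] by (intro nn_integral_cong) (simp add: indicator_def)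
  also have "\<dots> = (\<integral>\<^sup>+\<omega>. indicator ?C \<omega> * indicator (Collect (raw_exit D A)) (x + Y (T \<omega>) \<omega>, fut (T \<omega>) \<omega>) \<partial>M)"
    by (rule key[OF A, symmetric])
  also have "\<dots> = (\<integral>\<^sup>+\<omega>. indicator {\<omega> \<in> space M. raw_exit D A (x, fut 0 \<omega>)} \<omega> \<partial>M)"
  proof (rule nn_integral_cong_AE)
    show "AE \<omega> in M. indicator ?C \<omega> * indicator (Collect (raw_exit D A)) (x + Y (T \<omega>) \<omega>, fut (T \<omega>) \<omega>) =
        (indicator {\<omega> \<in> space M. raw_exit D A (x, fut 0 \<omega>)} \<omega> :: ennreal)"
      using AE_not_raw_exit[OF D, of x] AE_not_raw_exit[OF E(1) E', of x] null AE_space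
    proof eventually_elim
      fix \<omega> assume regD: "\<not> raw_exit D D (x, fut 0 \<omega>)" and regE: "\<not> raw_exit E E (x, fut 0 \<omega>)"
        and regT: "\<omega> \<in> ?C \<longrightarrow> \<not> raw_exit D D (x + Y (T \<omega>) \<omega>, fut (T \<omega>) \<omega>)" and w: "\<omega> \<in> space M"
      let ?y = "\<lambda>q. x + Y q \<omega>"
      have exD: "raw_exit D A (x, fut 0 \<omega>) \<longleftrightarrow> (\<exists>s. exits ?y D s \<and> ?y s \<in> A)"
        using raw_exit_regular(1)[OF w order_refl D(1), of x A] regD by simp
      have exE: "exits ?y E s \<longleftrightarrow> S \<omega> = ereal s" for s
        using raw_exit_regular(2)[OF w order_refl E(1), of x s] regE by (simp add: S_def)
      have "\<omega> \<in> ?C \<and> raw_exit D A (x + Y (T \<omega>) \<omega>, fut (T \<omega>) \<omega>) \<longleftrightarrow> raw_exit D A (x, fut 0 \<omega>)"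
      proof (cases "\<omega> \<in> ?C")
        case True
        then have "S \<omega> = ereal (T \<omega>)"
          using sig_nonneg[of E ?y] unfolding T_def S_def by (cases "sig E ?y") auto
        then have ex: "exits ?y E (T \<omega>)" by (simp add: exE)
        have "raw_exit D A (x + Y (T \<omega>) \<omega>, fut (T \<omega>) \<omega>) \<longleftrightarrow> (\<exists>s. exits (\<lambda>q. ?y (T \<omega> + q)) D s \<and> ?y (T \<omega> + s) \<in> A)"
          by (rule raw_exit_regular(1)[OF w T D(1)]) (use regT True in blast)
        also have "\<dots> \<longleftrightarrow> (\<exists>t. exits ?y D t \<and> ?y t \<in> A)"
        proof
          assume "\<exists>s. exits (\<lambda>q. ?y (T \<omega> + q)) D s \<and> ?y (T \<omega> + s) \<in> A"
          then obtain s where s: "exits (\<lambda>q. ?y (T \<omega> + q)) D s" "?y (T \<omega> + s) \<in> A" by blast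
          then have "0 \<le> s" by (simp add: exits_def)
          then have "exits ?y D (T \<omega> + s)" unfolding exits_shift[OF ex E(2)] using s(1) by simp
          then show "\<exists>t. exits ?y D t \<and> ?y t \<in> A" using s(2) by blast
        next
          assume "\<exists>t. exits ?y D t \<and> ?y t \<in> A"
          then obtain t where t: "exits ?y D t" "?y t \<in> A" by blast
          then have "exits (\<lambda>q. ?y (T \<omega> + q)) D (t - T \<omega>)" using exits_shift[OF ex E(2)] by blast
          then show "\<exists>s. exits (\<lambda>q. ?y (T \<omega> + q)) D s \<and> ?y (T \<omega> + s) \<in> A" using t(2) by (intro exI[of _ "t - T \<omega>"]) simp
        qed
        finally show ?thesis using exD True by simp
      next
        case False
        have "\<not> exits ?y D s" for s
        proof
          assume "exits ?y D s"
          then have "0 \<le> s" "?y s \<notin> E" using E(2) by (auto simp: exits_def)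
          then have "S \<omega> \<le> ereal s" unfolding S_def by (intro sig_le right_cont_path w)
          then show False using False w by auto
        qed
        then show ?thesis using exD False by simp
      qed
      then show "indicator ?C \<omega> * indicator (Collect (raw_exit D A)) (x + Y (T \<omega>) \<omega>, fut (T \<omega>) \<omega>) =
        (indicator {\<omega> \<in> space M. raw_exit D A (x, fut 0 \<omega>)} \<omega> :: ennreal)"
        using w by (auto simp: indicator_def)
    qed
  qed
  also have "\<dots> = emeasure M {\<omega> \<in> space M. raw_exit D A (x, fut 0 \<omega>)}"
    by (rule nn_integral_indicator[OF raw_exit_event[OF A]])
  also have "\<dots> = ennreal (exit_prob M X x D A)"
    by (simp add: exit_prob_raw[OF D A] emeasure_eq_measure)
  finally show ?thesis unfolding S_def T_def .
qed


lemma exit_prob_nonneg[simp]: "0 \<le> exit_prob M X x U A"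
  by (simp add: exit_prob_def)

lemma exit_prob_le_1: 
  assumes "open U" "- U \<noteq> {}" "A \<in> sets borel"
  shows "exit_prob M X x U A \<le> 1"
  unfolding exit_prob_raw[OF assms] by simp

lemma exit_value_integrable:
  fixes h :: "'a \<Rightarrow> real"
  assumes E: "open E" "- E \<noteq> {}" and h[measurable]: "h \<in> borel_measurable borel" and b: "\<And>z. 0 \<le> h z \<and> h z \<le> 1"
  shows "integrable (completion M) (\<lambda>\<omega>. exit_value h (started_at x X \<omega>) E)"
    and "ennreal (\<integral>\<omega>. exit_value h (started_at x X \<omega>) E \<partial>completion M) =
      (\<integral>\<^sup>+\<omega>. (if sig E (\<lambda>q. x + Y q \<omega>) < \<infinity> then ennreal (h (x + Y (real_of_ereal (sig E (\<lambda>q. x + Y q \<omega>))) \<omega>)) else 0) \<partial>M)"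
proof -
  define S where "S \<omega> = sig E (\<lambda>q. x + Y q \<omega>)" for \<omega>
  define T where "T \<omega> = real_of_ereal (S \<omega>)" for \<omega>
  have S: "optional_time S" unfolding S_def[abs_def] by (rule optional_time_sig)
  have Sm[measurable]: "S \<in> borel_measurable M" by (rule optional_time_measurable[OF S])
  have T: "0 \<le> T \<omega>" for \<omega> unfolding T_def S_def using sig_nonneg by (rule real_of_ereal_pos)
  have [measurable]: "T \<in> borel_measurable M" unfolding T_def[abs_def] by measurable
  have YT[measurable]: "(\<lambda>\<omega>. Y (T \<omega>) \<omega>) \<in> borel_measurable M"
    by (rule Y_random_time_measurable[OF _ T]) simp
  define f where "f \<omega> = exit_value h (started_at x X \<omega>) E" for \<omega>
  define g where "g \<omega> = (if S \<omega> < \<infinity> then h (x + Y (T \<omega>) \<omega>) else 0)" for \<omega>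
  have g[measurable]: "g \<in> borel_measurable M" unfolding g_def[abs_def] by measurable
  have gc: "g \<in> borel_measurable (completion M)" by (rule measurable_completion[OF g])
  have g01: "0 \<le> g \<omega> \<and> g \<omega> \<le> 1" for \<omega> using b by (simp add: g_def)
  have fg: "AE \<omega> in completion M. f \<omega> = g \<omega>"
    unfolding f_def g_def S_def T_def by (rule AE_completion[OF AE_exit_value[OF E]])
  have f: "f \<in> borel_measurable (completion M)"
  proof (rule measurableI)
    fix B :: "real set" assume B: "B \<in> sets borel"
    show "f -` B \<inter> space (completion M) \<in> sets (completion M)"
    proof (rule completion.in_sets_AE)
      show "AE \<omega> in completion M. \<omega> \<in> g -` B \<inter> space (completion M) \<longleftrightarrow> \<omega> \<in> f -` B \<inter> space (completion M)"
        using fg by (rule AE_mp) (auto intro!: AE_I2)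
      show "g -` B \<inter> space (completion M) \<in> sets (completion M)" by (rule measurable_sets[OF gc B])
    qed simp
  qed simp
  have gi: "integrable M g"
    using g01 by (intro integrable_const_bound[where B=1]) auto
  have "integrable (completion M) g"
    using integrable_completion[OF g] gi by simp
  then have "integrable (completion M) f"
    using fg f gc by (subst integrable_cong_AE[of f _ g]) auto
  then show "integrable (completion M) (\<lambda>\<omega>. exit_value h (started_at x X \<omega>) E)" unfolding f_def .
  have "(\<integral>\<omega>. f \<omega> \<partial>completion M) = (\<integral>\<omega>. g \<omega> \<partial>completion M)"
    by (rule integral_cong_AE[OF f gc fg])
  also have "\<dots> = (\<integral>\<omega>. g \<omega> \<partial>M)" by (rule integral_completion[OF g])
  finally have "ennreal (\<integral>\<omega>. f \<omega> \<partial>completion M) = (\<integral>\<^sup>+\<omega>. ennreal (g \<omega>) \<partial>M)"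
    using nn_integral_eq_integral[OF gi] g01 by simp
  also have "\<dots> = (\<integral>\<^sup>+\<omega>. (if S \<omega> < \<infinity> then ennreal (h (x + Y (T \<omega>) \<omega>)) else 0) \<partial>M)"
    by (intro nn_integral_cong) (simp add: g_def)
  finally show "ennreal (\<integral>\<omega>. exit_value h (started_at x X \<omega>) E \<partial>completion M) =
      (\<integral>\<^sup>+\<omega>. (if sig E (\<lambda>q. x + Y q \<omega>) < \<infinity> then ennreal (h (x + Y (real_of_ereal (sig E (\<lambda>q. x + Y q \<omega>))) \<omega>)) else 0) \<partial>M)"
    unfolding f_def S_def T_def .
qed

lemma exit_prob_harmonic:
  assumes D: "open D" "- D \<noteq> {}" and A: "A \<in> sets borel" and B: "B \<subseteq> D"
  shows "harmonic_on M X (\<lambda>x. exit_prob M X x D A) B"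
  unfolding harmonic_on_def
proof (intro conjI allI impI ballI)
  show m: "(\<lambda>x. exit_prob M X x D A) \<in> borel_measurable borel" by (rule exit_prob_measurable[OF D A])
  have b: "0 \<le> exit_prob M X z D A \<and> exit_prob M X z D A \<le> 1" for z
    by (simp add: exit_prob_le_1[OF D A])
  fix E x assume E: "open E \<and> compact (closure E) \<and> closure E \<subseteq> B"
  then have ED: "E \<subseteq> D" and Eo: "open E" using B closure_subset[of E] by auto
  then have En: "- E \<noteq> {}" using D by auto
  show "integrable (completion M) (\<lambda>\<omega>. exit_value (\<lambda>x. exit_prob M X x D A) (started_at x X \<omega>) E)"
    by (rule exit_value_integrable[OF Eo En m b])
  let ?I = "\<integral>\<omega>. exit_value (\<lambda>x. exit_prob M X x D A) (started_at x X \<omega>) E \<partial>completion M"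
  have "ennreal ?I = ennreal (exit_prob M X x D A)"
    unfolding exit_value_integrable(2)[OF Eo En m b] by (rule nn_integral_exit_prob[OF D A Eo ED])
  moreover have "0 \<le> ?I" by (intro Bochner_Integration.integral_nonneg) (simp add: exit_value_def)
  ultimately show "exit_prob M X x D A = ?I" by (simp add: ennreal_inj)
qed

text \<open>By the mean value property for \<open>E\<close> it suffices to majorise the exit
  probability off \<open>E\<close> by a step function; integrating the majorant turns each of its
  sets into an exit probability from \<open>E\<close>. The sets \<open>B i\<close> may
  overlap.\<close>

lemma exit_prob_bound:
  assumes D: "open D" "- D \<noteq> {}" and A: "A \<in> sets borel" and E: "open E" "E \<subseteq> D"
    and I: "finite I" and B: "\<And>i. i \<in> I \<Longrightarrow> B i \<in> sets borel" and s: "\<And>i. i \<in> I \<Longrightarrow> 0 \<le> s i"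
    and le: "\<And>z. z \<notin> E \<Longrightarrow> exit_prob M X z D A \<le> (\<Sum>i\<in>I. s i * indicator (B i) z)"
  shows "exit_prob M X x D A \<le> (\<Sum>i\<in>I. s i * exit_prob M X x E (B i))"
proof -
  have En: "- E \<noteq> {}" using D E by auto
  let ?R = "\<lambda>i. {\<omega> \<in> space M. raw_exit E (B i) (x, fut 0 \<omega>)}"
  have "ennreal (exit_prob M X x D A) = (\<integral>\<^sup>+\<omega>. (if sig E (\<lambda>q. x + Y q \<omega>) < \<infinity> then ennreal (exit_prob M X (x + Y (real_of_ereal (sig E (\<lambda>q. x + Y q \<omega>))) \<omega>) D A) else 0) \<partial>M)"
    by (rule nn_integral_exit_prob[OF D A E, symmetric])
  also have "\<dots> \<le> (\<integral>\<^sup>+\<omega>. (\<Sum>i\<in>I. ennreal (s i) * indicator (?R i) \<omega>) \<partial>M)"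
  proof (rule nn_integral_mono_AE)
    show "AE \<omega> in M. (if sig E (\<lambda>q. x + Y q \<omega>) < \<infinity> then ennreal (exit_prob M X (x + Y (real_of_ereal (sig E (\<lambda>q. x + Y q \<omega>))) \<omega>) D A) else 0)
        \<le> (\<Sum>i\<in>I. ennreal (s i) * indicator (?R i) \<omega>)"
      using AE_sig_regular[OF E(1) En, of x]
    proof (rule AE_mp, intro AE_I2 impI)
      fix \<omega> assume w: "\<omega> \<in> space M"
      let ?S = "sig E (\<lambda>q. x + Y q \<omega>)"
      let ?z = "x + Y (real_of_ereal ?S) \<omega>"
      assume reg: "?S < \<infinity> \<longrightarrow> ?z \<notin> E"
      show "(if ?S < \<infinity> then ennreal (exit_prob M X ?z D A) else 0) \<le> (\<Sum>i\<in>I. ennreal (s i) * indicator (?R i) \<omega>)"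
      proof (cases "?S < \<infinity>")
        case True
        have R: "\<omega> \<in> ?R i \<longleftrightarrow> ?z \<in> B i" for i
          using raw_exit_fut[OF w order_refl, of E "B i" x] True w by simp
        have "ennreal (exit_prob M X ?z D A) \<le> ennreal (\<Sum>i\<in>I. s i * indicator (B i) ?z)"
          using le[of ?z] reg True by (intro ennreal_leI) blast
        also have "\<dots> = (\<Sum>i\<in>I. ennreal (s i * indicator (B i) ?z))"
          using s by (intro sum_ennreal[symmetric]) auto
        also have "\<dots> = (\<Sum>i\<in>I. ennreal (s i) * indicator (?R i) \<omega>)"
        proof (rule sum.cong[OF refl])
          fix i
          show "ennreal (s i * indicator (B i) ?z) = ennreal (s i) * indicator (?R i) \<omega>"
            using R[of i] by (cases "?z \<in> B i") (simp_all add: indicator_def)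
        qed
        finally show ?thesis using True by simp
      qed simp
    qed
  qed
  also have "\<dots> = (\<Sum>i\<in>I. (\<integral>\<^sup>+\<omega>. ennreal (s i) * indicator (?R i) \<omega> \<partial>M))"
  proof (rule nn_integral_sum)
    fix i assume i: "i \<in> I"
    show "(\<lambda>\<omega>. ennreal (s i) * indicator (?R i) \<omega>) \<in> borel_measurable M"
      using raw_exit_event[OF B[OF i], of E x] by measurable
  qed
  also have "\<dots> = (\<Sum>i\<in>I. ennreal (s i * exit_prob M X x E (B i)))"
  proof (rule sum.cong[OF refl])
    fix i assume i: "i \<in> I"
    show "(\<integral>\<^sup>+\<omega>. ennreal (s i) * indicator (?R i) \<omega> \<partial>M) = ennreal (s i * exit_prob M X x E (B i))"
      using raw_exit_event[OF B[OF i], of E x] s[OF i]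
      by (simp add: nn_integral_cmult_indicator exit_prob_raw[OF E(1) En B[OF i]] emeasure_eq_measure ennreal_mult)
  qed
  also have "\<dots> = ennreal (\<Sum>i\<in>I. s i * exit_prob M X x E (B i))"
    using s by (intro sum_ennreal) auto
  finally show ?thesis using s by (subst (asm) ennreal_le_iff) (auto intro!: sum_nonneg)
qed

text \<open>Fatou's lemma for events: almost every point of \<open>Z\<close> lies in the lower limit
  of the \<open>E k\<close>. It transfers properties of paths to probabilities on grids.\<close>

lemma eventually_prob_ge:
  assumes Z: "Z \<in> sets M" and E: "\<And>k. E k \<in> sets M"
    and ae: "AE \<omega> in M. \<omega> \<in> Z \<longrightarrow> eventually (\<lambda>k. \<omega> \<in> E k) sequentially" and e: "0 < e"
  shows "eventually (\<lambda>k. prob Z - e \<le> prob (E k)) sequentially"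
proof -
  let ?L = "\<lambda>i. \<Inter>k\<in>{i..}. E k"
  have L: "?L i \<in> sets M" for i by (rule sets.countable_INT') (use E in auto)
  have inc: "incseq ?L" by (rule incseq_SucI) auto
  have "(\<lambda>i. prob (?L i)) \<longlonglongrightarrow> prob (\<Union>i. ?L i)"
    using L by (intro finite_Lim_measure_incseq inc) auto
  moreover have "prob Z \<le> prob (\<Union>i. ?L i)"
  proof (rule finite_measure_mono_AE)
    show "AE \<omega> in M. \<omega> \<in> Z \<longrightarrow> \<omega> \<in> (\<Union>i. ?L i)"
      using ae by (rule AE_mp) (auto intro!: AE_I2 simp: eventually_sequentially)
  qed (use L in auto)
  ultimately have "eventually (\<lambda>i. prob Z - e < prob (?L i)) sequentially"
    using e by (intro order_tendstoD(1)) auto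
  then show ?thesis
  proof (rule eventually_mono)
    fix i assume "prob Z - e < prob (?L i)"
    moreover have "prob (?L i) \<le> prob (E i)" using E by (intro finite_measure_mono) auto
    ultimately show "prob Z - e \<le> prob (E i)" by simp
  qed
qed

end

section \<open>Jump density and small-time transition density\<close>

text \<open>The one-sided limits at \<open>u\<close> control two one-sided neighbourhoods:
  increments within one side are small, increments across \<open>u\<close> are close to the jump. At
  \<open>u = 0\<close> there is no left side and the second claim is vacuous.\<close>

lemma cadlag_near:
  fixes y :: "real \<Rightarrow> 'a::euclidean_space"
  assumes y: "cadlag y" and u: "0 \<le> u" and e: "0 < e"
  obtains d where "0 < d"
    "\<And>a b. 0 \<le> a \<Longrightarrow> a \<le> b \<Longrightarrow> u - d < a \<Longrightarrow> b < u + d \<Longrightarrow> u \<le> a \<or> b < u \<Longrightarrow> norm (y b - y a) < e"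
    "\<And>a b. 0 \<le> a \<Longrightarrow> a < u \<Longrightarrow> u \<le> b \<Longrightarrow> u - d < a \<Longrightarrow> b < u + d \<Longrightarrow> norm (y b - y a - jump y u) < e"
proof -
  have e2: "0 < e / 2" using e by simp
  have "eventually (\<lambda>t. dist (y t) (y u) < e / 2) (at_right u)"
    using y u e2 unfolding cadlag_def by (intro tendstoD) auto
  then obtain b1 where b1: "b1 > u" "\<And>t. u < t \<Longrightarrow> t < b1 \<Longrightarrow> dist (y t) (y u) < e / 2"
    unfolding eventually_at_right_field by blast
  have r: "dist (y t) (y u) < e / 2" if "u \<le> t" "t < b1" for t
    using b1(2)[of t] that e2 by (cases "t = u") auto
  show ?thesis
  proof (cases "u = 0")
    case True
    show ?thesis
    proof (rule that[of "b1 - u"])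
      show "0 < b1 - u" using b1 by simp
      fix a b assume "0 \<le> a" "a \<le> b" "b < u + (b1 - u)" "u \<le> a \<or> b < u"
      then have "dist (y b) (y u) < e / 2" "dist (y a) (y u) < e / 2" using r True by auto
      then have "dist (y b) (y a) < e" by (rule dist_triangle_half_l)
      then show "norm (y b - y a) < e" by (simp add: dist_norm)
    qed (use True in auto)
  next
    case False
    then obtain l where l: "(y \<longlongrightarrow> l) (at_left u)" using y u unfolding cadlag_def by force
    then have jl: "jump y u = y u - l" unfolding jump_def by (simp add: tendsto_Lim)
    have "eventually (\<lambda>t. dist (y t) l < e / 2) (at_left u)"
      using l e2 by (intro tendstoD)
    then obtain b2 where b2: "b2 < u" "\<And>t. b2 < t \<Longrightarrow> t < u \<Longrightarrow> dist (y t) l < e / 2"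
      unfolding eventually_at_left_field by blast
    show ?thesis
    proof (rule that[of "min (b1 - u) (u - b2)"])
      show "0 < min (b1 - u) (u - b2)" using b1 b2 by simp
      fix a b :: real
      assume ab: "0 \<le> a" "a \<le> b" "u - min (b1 - u) (u - b2) < a" "b < u + min (b1 - u) (u - b2)" "u \<le> a \<or> b < u"
      have "dist (y b) (y a) < e"
      proof (cases "u \<le> a")
        case True
        then have "dist (y b) (y u) < e / 2" "dist (y a) (y u) < e / 2"
          using ab by (intro r; simp)+
        then show ?thesis by (rule dist_triangle_half_l)
      next
        case False
        then have "dist (y b) l < e / 2" "dist (y a) l < e / 2"
          using ab by (intro b2(2); simp)+
        then show ?thesis by (rule dist_triangle_half_l)
      qed
      then show "norm (y b - y a) < e" by (simp add: dist_norm)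
    next
      fix a b :: real
      assume ab: "0 \<le> a" "a < u" "u \<le> b" "u - min (b1 - u) (u - b2) < a" "b < u + min (b1 - u) (u - b2)"
      have "norm (y b - y u) < e / 2" "norm (y a - l) < e / 2"
        using r[of b] b2(2)[of a] ab by (simp_all add: dist_norm)
      then have "norm ((y b - y u) - (y a - l)) < e"
        using norm_triangle_ineq4[of "y b - y u" "y a - l"] by linarith
      then show "norm (y b - y a - jump y u) < e" unfolding jl by (simp add: algebra_simps)
    qed
  qed
qed

lemma mesh_eventually: "0 < d \<Longrightarrow> eventually (\<lambda>k. 1 / 2 ^ k < (d::real)) sequentially"
proof -
  assume "0 < d"
  have "(\<lambda>k. 1 / 2 ^ k :: real) \<longlonglongrightarrow> 0"
    using LIMSEQ_divide_realpow_zero[of 2 1] by simp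
  then show ?thesis using \<open>0 < d\<close> by (rule order_tendstoD)
qed

text \<open>By compactness of [0,1], intervals of ever finer grids with increments in
  \<open>K\<close> would accumulate at some \<open>u\<close>. Their increments are close to 0 or,
  across \<open>u\<close>, to the jump at \<open>u\<close>, and neither point lies in the closed set
  \<open>K\<close>.\<close>

lemma no_jump_imp_no_increment:
  fixes y :: "real \<Rightarrow> 'a::euclidean_space"
  assumes y: "cadlag y" and K: "closed K" "0 \<notin> K" and nj: "\<And>u. 0 < u \<Longrightarrow> u \<le> 1 \<Longrightarrow> jump y u \<notin> K"
  shows "eventually (\<lambda>k. \<forall>i<2^k. y (real (Suc i) / 2 ^ k) - y (real i / 2 ^ k) \<notin> K) sequentially"
proof (rule ccontr)
  assume "\<not> ?thesis"
  then have "\<forall>N. \<exists>k\<ge>N. \<exists>i<2^k. y (real (Suc i) / 2 ^ k) - y (real i / 2 ^ k) \<in> K"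
    unfolding eventually_sequentially by blast
  then obtain k i where ki: "\<And>N. N \<le> k N" "\<And>N. i N < 2 ^ k N"
      "\<And>N. y (real (Suc (i N)) / 2 ^ k N) - y (real (i N) / 2 ^ k N) \<in> K"
    by metis
  define a where "a N = real (i N) / 2 ^ k N" for N
  have a01: "a N \<in> {0..1}" for N
  proof -
    have "real (i N) \<le> 2 ^ k N" using ki(2)[of N] by (metis less_imp_le of_nat_le_iff of_nat_numeral of_nat_power)
    then show ?thesis by (simp add: a_def)
  qed
  then obtain u s where u: "u \<in> {0..1}" "strict_mono s" "(a \<circ> s) \<longlonglongrightarrow> u"
    using compact_Icc[of 0 "1::real"] unfolding compact_def by metis
  have ball: "\<exists>e>0. ball 0 e \<inter> K = {} \<and> (0 < u \<longrightarrow> ball (jump y u) e \<inter> K = {})"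
  proof -
    have oK: "open (- K)" using K by (simp add: open_Compl)
    obtain e1 where e1: "0 < e1" "ball 0 e1 \<subseteq> - K" using oK K(2) unfolding open_contains_ball by blast
    show ?thesis
    proof (cases "0 < u")
      case True
      then have "jump y u \<in> - K" using nj u(1) by simp
      then obtain e2 where e2: "0 < e2" "ball (jump y u) e2 \<subseteq> - K" using oK unfolding open_contains_ball by blast
      have "ball 0 (min e1 e2) \<subseteq> ball 0 e1" "ball (jump y u) (min e1 e2) \<subseteq> ball (jump y u) e2"
        by (auto intro: subset_ball)
      then show ?thesis using e1 e2 by (intro exI[of _ "min e1 e2"]) auto
    qed (use e1 in auto)
  qed
  then obtain e where e: "0 < e" "ball 0 e \<inter> K = {}" "0 < u \<Longrightarrow> ball (jump y u) e \<inter> K = {}" by blast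
  have u0: "0 \<le> u" using u(1) by simp
  obtain d where d: "0 < d"
    "\<And>a b. 0 \<le> a \<Longrightarrow> a \<le> b \<Longrightarrow> u - d < a \<Longrightarrow> b < u + d \<Longrightarrow> u \<le> a \<or> b < u \<Longrightarrow> norm (y b - y a) < e"
    "\<And>a b. 0 \<le> a \<Longrightarrow> a < u \<Longrightarrow> u \<le> b \<Longrightarrow> u - d < a \<Longrightarrow> b < u + d \<Longrightarrow> norm (y b - y a - jump y u) < e"
    using cadlag_near[OF y u0 e(1)] by blast
  have d2: "0 < d / 2" using d(1) by simp
  have "eventually (\<lambda>N. dist ((a \<circ> s) N) u < d / 2) sequentially" by (rule tendstoD[OF u(3) d2])
  moreover have "eventually (\<lambda>N. 1 / 2 ^ N < d / 2) sequentially" by (rule mesh_eventually[OF d2])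
  ultimately have "eventually (\<lambda>N. dist ((a \<circ> s) N) u < d / 2 \<and> 1 / 2 ^ N < d / 2) sequentially"
    by (rule eventually_conj)
  then obtain N where N: "dist ((a \<circ> s) N) u < d / 2" "1 / 2 ^ N < d / 2"
    unfolding eventually_sequentially by blast
  let ?a = "a (s N)" and ?b = "real (Suc (i (s N))) / 2 ^ k (s N)"
  have "N \<le> k (s N)" using ki(1)[of "s N"] seq_suble[OF u(2), of N] by linarith
  then have "1 / 2 ^ k (s N) \<le> (1 / 2 ^ N :: real)" by (simp add: frac_le)
  moreover have b: "?b = ?a + 1 / 2 ^ k (s N)" by (simp add: a_def add_divide_distrib)
  moreover have "\<bar>?a - u\<bar> < d / 2" using N(1) by (simp add: dist_real_def)
  moreover have "0 < 1 / (2::real) ^ k (s N)" by simp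
  ultimately have b': "?b < u + d" "u - d < ?a" "?a < ?b"
    using N(2) by linarith+
  have a0: "0 \<le> ?a" using a01 by simp
  have inK: "y ?b - y ?a \<in> K" using ki(3)[of "s N"] by (simp add: a_def)
  show False
  proof (cases "u \<le> ?a \<or> ?b < u")
    case True
    then have "norm (y ?b - y ?a) < e" using d(2)[of ?a ?b] a0 b' by simp
    then have "y ?b - y ?a \<in> ball 0 e" by simp
    then show False using e(2) inK by blast
  next
    case False
    then have "norm (y ?b - y ?a - jump y u) < e" using d(3)[of ?a ?b] a0 b' by simp
    then have "y ?b - y ?a \<in> ball (jump y u) e" by (simp add: dist_norm norm_minus_commute)
    then show False using e(3) inK False a0 by fastforce
  qed
qed

lemma jump_imp_increment:
  fixes y :: "real \<Rightarrow> 'a::euclidean_space"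
  assumes y: "cadlag y" and G: "open G" and u: "0 < u" "u \<le> 1" "jump y u \<in> G"
  shows "eventually (\<lambda>k. \<exists>i<2^k. y (real (Suc i) / 2 ^ k) - y (real i / 2 ^ k) \<in> G) sequentially"
proof -
  obtain e where e: "0 < e" "ball (jump y u) e \<subseteq> G" using G u(3) unfolding open_contains_ball by blast
  obtain d where d: "0 < d"
    "\<And>a b. 0 \<le> a \<Longrightarrow> a < u \<Longrightarrow> u \<le> b \<Longrightarrow> u - d < a \<Longrightarrow> b < u + d \<Longrightarrow> norm (y b - y a - jump y u) < e"
    using cadlag_near[OF y _ e(1), of u] u(1) by (metis less_imp_le)
  show ?thesis
    using mesh_eventually[OF d(1)]
  proof (rule eventually_mono)
    fix k :: nat assume k: "1 / 2 ^ k < d"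
    \<comment> \<open>Ceiling minus one puts \<open>u\<close> into the interval (i/2^k, (i+1)/2^k],
      closed on the right, so that the increment includes the jump at \<open>u\<close>.\<close>
    define n where "n = \<lceil>u * 2 ^ k\<rceil> - 1"
    have n: "real_of_int n < u * 2 ^ k" "u * 2 ^ k \<le> real_of_int n + 1" unfolding n_def by linarith+
    have "0 < u * 2 ^ k" using u by simp
    then have n0: "0 \<le> n" unfolding n_def by linarith
    define i where "i = nat n"
    have i: "real i < u * 2 ^ k" "u * 2 ^ k \<le> real i + 1" using n n0 by (auto simp: i_def)
    have "u * 2 ^ k \<le> 2 ^ k" using u by simp
    then have "real i < 2 ^ k" using i by linarith
    then have "i < 2 ^ k" by (metis of_nat_less_iff of_nat_numeral of_nat_power)
    moreover have "norm (y (real (Suc i) / 2 ^ k) - y (real i / 2 ^ k) - jump y u) < e"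
    proof (rule d(2))
      show "real i / 2 ^ k < u" "u \<le> real (Suc i) / 2 ^ k" using i by (simp_all add: field_simps)
      have "real (Suc i) / 2 ^ k = real i / 2 ^ k + 1 / 2 ^ k" by (simp add: add_divide_distrib)
      then show "u - d < real i / 2 ^ k" "real (Suc i) / 2 ^ k < u + d"
        using \<open>real i / 2 ^ k < u\<close> \<open>u \<le> real (Suc i) / 2 ^ k\<close> k by linarith+
    qed simp
    then have "y (real (Suc i) / 2 ^ k) - y (real i / 2 ^ k) \<in> ball (jump y u) e"
      by (simp add: dist_norm norm_minus_commute)
    ultimately show "\<exists>i<2^k. y (real (Suc i) / 2 ^ k) - y (real i / 2 ^ k) \<in> G" using e(2) by blast
  qed
qed

context levy
begin

lemma X_cadlag: "\<omega> \<in> space M \<Longrightarrow> cadlag (\<lambda>t. X t \<omega>)"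
  using levy by (simp add: levy_process_def)

lemma increment_events:
  assumes B: "B \<in> sets borel"
  shows "{\<omega> \<in> space M. \<forall>i<2^k. X (real (Suc i) / 2 ^ k) \<omega> - X (real i / 2 ^ k) \<omega> \<notin> B} \<in> sets M"
    and "prob {\<omega> \<in> space M. \<forall>i<2^k. X (real (Suc i) / 2 ^ k) \<omega> - X (real i / 2 ^ k) \<omega> \<notin> B} =
      (1 - prob {\<omega> \<in> space M. Y (1 / 2 ^ k) \<omega> \<in> B}) ^ (2 ^ k)"
proof -
  define g where "g i = real i / 2 ^ k" for i
  define D where "D i \<omega> = Y (g (Suc i)) \<omega> - Y (g i) \<omega>" for i \<omega>
  have D: "D i \<omega> = X (real (Suc i) / 2 ^ k) \<omega> - X (real i / 2 ^ k) \<omega>" for i \<omega>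
    by (simp add: D_def Y_def g_def)
  have ind: "indep_vars (\<lambda>_. borel) D UNIV"
    unfolding D_def[abs_def] by (rule indep_increments) (auto simp: g_def mono_def divide_right_mono)
  have Dm[measurable]: "D i \<in> borel_measurable M" for i
    unfolding D_def[abs_def] g_def by (intro borel_measurable_diff Y_measurable) auto
  have "0 \<in> {..<(2::nat) ^ k}" by simp
  then have ne: "{..<(2::nat) ^ k} \<noteq> {}" by blast
  have eq: "{\<omega> \<in> space M. \<forall>i<2^k. X (real (Suc i) / 2 ^ k) \<omega> - X (real i / 2 ^ k) \<omega> \<notin> B} =
      (\<Inter>i\<in>{..<2^k}. D i -` (- B) \<inter> space M)"
    unfolding D[symmetric] using ne by blast
  have ev: "D i -` (- B) \<inter> space M \<in> sets M" for i
    using measurable_sets[OF Dm, of "- B" i] B by auto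
  show "{\<omega> \<in> space M. \<forall>i<2^k. X (real (Suc i) / 2 ^ k) \<omega> - X (real i / 2 ^ k) \<omega> \<notin> B} \<in> sets M"
    unfolding eq by (rule sets.finite_INT[OF _ ne ev]) simp
  have "prob (\<Inter>i\<in>{..<2^k}. D i -` (- B) \<inter> space M) = (\<Prod>i\<in>{..<2^k}. prob (D i -` (- B) \<inter> space M))"
    by (rule indep_varsD[OF ind ne]) (use B in auto)
  also have "\<dots> = (\<Prod>i\<in>{..<(2::nat)^k}. 1 - prob {\<omega> \<in> space M. Y (1 / 2 ^ k) \<omega> \<in> B})"
  proof (rule prod.cong[OF refl])
    fix i
    have "distr M borel (D i) = distr M borel (Y (1 / 2 ^ k))"
      using distr_increment[of "g i" "1 / 2 ^ k"] by (simp add: D_def[abs_def] g_def add_divide_distrib add.commute)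
    then have "measure (distr M borel (D i)) (- B) = measure (distr M borel (Y (1 / 2 ^ k))) (- B)" by simp
    then have "prob (D i -` (- B) \<inter> space M) = prob (Y (1 / 2 ^ k) -` (- B) \<inter> space M)"
      using B by (simp add: measure_distr)
    also have "\<dots> = prob (space M - {\<omega> \<in> space M. Y (1 / 2 ^ k) \<omega> \<in> B})"
      by (rule arg_cong[where f=prob]) auto
    also have "\<dots> = 1 - prob {\<omega> \<in> space M. Y (1 / 2 ^ k) \<omega> \<in> B}"
    proof (rule prob_compl)
      have "Y (1 / 2 ^ k) -` B \<inter> space M \<in> sets M" by (rule measurable_sets[OF Y_measurable B]) simp
      then show "{\<omega> \<in> space M. Y (1 / 2 ^ k) \<omega> \<in> B} \<in> sets M" by (simp add: vimage_def Int_def conj_commute)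
    qed
    finally show "prob (D i -` (- B) \<inter> space M) = 1 - prob {\<omega> \<in> space M. Y (1 / 2 ^ k) \<omega> \<in> B}" .
  qed
  finally show "prob {\<omega> \<in> space M. \<forall>i<2^k. X (real (Suc i) / 2 ^ k) \<omega> - X (real i / 2 ^ k) \<omega> \<notin> B} =
      (1 - prob {\<omega> \<in> space M. Y (1 / 2 ^ k) \<omega> \<in> B}) ^ (2 ^ k)"
    unfolding eq by simp
qed

end

locale levy_jumps = levy M X
  for M :: "'w measure" and X :: "real \<Rightarrow> 'w \<Rightarrow> 'a::euclidean_space" +
  fixes j :: "real \<Rightarrow> real"
  assumes jd: "radial_jump_density M X j"
begin

definition rate :: "'a set \<Rightarrow> ennreal" where
  "rate B = (\<integral>\<^sup>+ x\<in>B. ennreal (j (norm x)) \<partial>lborel)"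

lemma j_antimono: "0 < r \<Longrightarrow> r \<le> s \<Longrightarrow> j s \<le> j r"
  using jd unfolding radial_jump_density_def monotone_on_def by auto

lemma j_nonneg: "0 < r \<Longrightarrow> 0 \<le> j r"
  using jd unfolding radial_jump_density_def by auto

text \<open>The void probability of the Poisson count on (0,1]. A measurable set \<open>Z\<close> is
  delivered because the set of paths without jumps in \<open>B\<close> is only known to agree with
  one almost surely. Rate zero is covered by the separate clause of
  \<open>radial_jump_density\<close>.\<close>

lemma no_jump_prob:
  assumes B: "B \<in> sets borel" "0 \<notin> B" and fin: "rate B < \<infinity>"
  obtains Z where "Z \<in> sets M" "prob Z = exp (- enn2real (rate B))"
    "AE \<omega> in M. \<omega> \<in> Z \<longleftrightarrow> (\<forall>u. 0 < u \<and> u \<le> 1 \<longrightarrow> jump (\<lambda>t. X t \<omega>) u \<notin> B)"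
proof (cases "rate B = 0")
  case True
  then have "AE \<omega> in M. \<forall>t>0. jump (\<lambda>u. X u \<omega>) t \<notin> B"
    using jd B unfolding radial_jump_density_def rate_def by (auto simp: Let_def)
  then have "AE \<omega> in M. \<omega> \<in> space M \<longleftrightarrow> (\<forall>u. 0 < u \<and> u \<le> 1 \<longrightarrow> jump (\<lambda>t. X t \<omega>) u \<notin> B)"
    by (rule AE_mp) (auto intro!: AE_I2)
  then show ?thesis using True prob_space by (intro that[of "space M"]) auto
next
  case False
  define \<nu> where "\<nu> = enn2real (rate B)"
  have \<nu>: "0 < \<nu>" using False fin unfolding \<nu>_def by (simp add: enn2real_positive_iff zero_less_iff_neq_zero)
  define N where "N \<omega> = card (jump_times (\<lambda>u. X u \<omega>) B 0 1)" for \<omega>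
  have pj: "poisson_jumps M X B \<nu>"
    using jd B False fin unfolding radial_jump_density_def rate_def \<nu>_def by (auto simp: Let_def zero_less_iff_neq_zero)
  then have fin1: "AE \<omega> in M. finite (jump_times (\<lambda>u. X u \<omega>) B 0 1)"
    and dist: "distr M (count_space UNIV) N = measure_pmf (poisson_pmf \<nu>)"
    unfolding poisson_jumps_def Let_def N_def[abs_def] by (auto dest!: spec[of _ 0] spec[of _ "1::real"])
  have Nm: "N \<in> M \<rightarrow>\<^sub>M count_space UNIV"
  proof -
    have "\<forall>t :: nat \<Rightarrow> real. 0 \<le> t 0 \<longrightarrow> mono t \<longrightarrow>
         indep_vars (\<lambda>_. count_space UNIV) (\<lambda>i \<omega>. card (jump_times (\<lambda>u. X u \<omega>) B (t i) (t (Suc i)))) UNIV"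
      using pj unfolding poisson_jumps_def Let_def by blast
    from this[rule_format, of real]
    have "indep_vars (\<lambda>_. count_space UNIV) (\<lambda>i \<omega>. card (jump_times (\<lambda>u. X u \<omega>) B (real i) (real (Suc i)))) UNIV"
      by (simp add: mono_def)
    then have "(\<lambda>\<omega>. card (jump_times (\<lambda>u. X u \<omega>) B (real 0) (real (Suc 0)))) \<in> M \<rightarrow>\<^sub>M count_space UNIV"
      unfolding indep_vars_def by blast
    then show ?thesis by (simp add: N_def[abs_def])
  qed
  show ?thesis
  proof (rule that)
    show "N -` {0} \<inter> space M \<in> sets M" by (rule measurable_sets[OF Nm]) simp
    have "prob (N -` {0} \<inter> space M) = measure (distr M (count_space UNIV) N) {0}"
      by (rule measure_distr[symmetric, OF Nm]) simp
    also have "\<dots> = exp (- \<nu>)"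
      unfolding dist using \<nu> by (simp add: measure_pmf_single)
    finally show "prob (N -` {0} \<inter> space M) = exp (- enn2real (rate B))" by (simp add: \<nu>_def)
    show "AE \<omega> in M. \<omega> \<in> N -` {0} \<inter> space M \<longleftrightarrow> (\<forall>u. 0 < u \<and> u \<le> 1 \<longrightarrow> jump (\<lambda>t. X t \<omega>) u \<notin> B)"
      using fin1
    proof (rule AE_mp, intro AE_I2 impI)
      fix \<omega> assume w: "\<omega> \<in> space M" and f: "finite (jump_times (\<lambda>u. X u \<omega>) B 0 1)"
      \<comment> \<open>Finiteness matters here: \<open>card\<close> of an infinite set is 0 as
        well.\<close>
      have "N \<omega> = 0 \<longleftrightarrow> jump_times (\<lambda>u. X u \<omega>) B 0 1 = {}" unfolding N_def using f by simp
      also have "\<dots> \<longleftrightarrow> (\<forall>u. 0 < u \<and> u \<le> 1 \<longrightarrow> jump (\<lambda>t. X t \<omega>) u \<notin> B)" by (auto simp: jump_times_def)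
      finally show "\<omega> \<in> N -` {0} \<inter> space M \<longleftrightarrow> (\<forall>u. 0 < u \<and> u \<le> 1 \<longrightarrow> jump (\<lambda>t. X t \<omega>) u \<notin> B)" using w by simp
    qed
  qed
qed

text \<open>A path without jumps in the closed set \<open>B\<close> has no increment in
  \<open>B\<close> on fine grids. So exp(-rate) is asymptotically at most (1-p)^(2^k), which in turn
  is at most exp(-2^k p).\<close>

lemma increment_rate_upper:
  assumes B: "closed B" "0 \<notin> B" and fin: "rate B < \<infinity>" and e: "0 < e"
  shows "eventually (\<lambda>k. 2 ^ k * prob {\<omega> \<in> space M. Y (1 / 2 ^ k) \<omega> \<in> B} \<le> enn2real (rate B) + e) sequentially"
proof -
  let ?\<nu> = "enn2real (rate B)"
  let ?E = "\<lambda>k. {\<omega> \<in> space M. \<forall>i<2^k. X (real (Suc i) / 2 ^ k) \<omega> - X (real i / 2 ^ k) \<omega> \<notin> B}"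
  have Bs: "B \<in> sets borel" using B by simp
  obtain Z where Z: "Z \<in> sets M" "prob Z = exp (- ?\<nu>)"
    "AE \<omega> in M. \<omega> \<in> Z \<longleftrightarrow> (\<forall>u. 0 < u \<and> u \<le> 1 \<longrightarrow> jump (\<lambda>t. X t \<omega>) u \<notin> B)"
    by (rule no_jump_prob[OF Bs B(2) fin])
  have ae: "AE \<omega> in M. \<omega> \<in> Z \<longrightarrow> eventually (\<lambda>k. \<omega> \<in> ?E k) sequentially"
    using Z(3)
  proof (rule AE_mp, intro AE_I2 impI)
    fix \<omega> assume w: "\<omega> \<in> space M" and "\<omega> \<in> Z \<longleftrightarrow> (\<forall>u. 0 < u \<and> u \<le> 1 \<longrightarrow> jump (\<lambda>t. X t \<omega>) u \<notin> B)" "\<omega> \<in> Z"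
    then show "eventually (\<lambda>k. \<omega> \<in> ?E k) sequentially"
      using no_jump_imp_no_increment[OF X_cadlag[OF w] B] by simp
  qed
  \<comment> \<open>With this margin the lower bound for the probability is exactly exp(-rate - e),
    so that taking logarithms gives the claim.\<close>
  have "0 < exp (- ?\<nu>) - exp (- ?\<nu> - e)" using e by simp
  from eventually_prob_ge[OF Z(1) increment_events(1)[OF Bs] ae this]
  show ?thesis
  proof (rule eventually_mono)
    fix k assume k: "prob Z - (exp (- ?\<nu>) - exp (- ?\<nu> - e)) \<le> prob (?E k)"
    let ?p = "prob {\<omega> \<in> space M. Y (1 / 2 ^ k) \<omega> \<in> B}"
    have "exp (- ?\<nu> - e) \<le> (1 - ?p) ^ (2 ^ k)" using k unfolding Z(2) increment_events(2)[OF Bs] by simp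
    also have "\<dots> \<le> exp (- ?p) ^ (2 ^ k)"
      using exp_ge_add_one_self[of "- ?p"] prob_le_1[of "{\<omega> \<in> space M. Y (1 / 2 ^ k) \<omega> \<in> B}"] by (intro power_mono) auto
    also have "\<dots> = exp (2 ^ k * (- ?p))" by (simp add: exp_of_nat_mult[symmetric])
    finally show "2 ^ k * ?p \<le> ?\<nu> + e" by simp
  qed
qed

text \<open>A jump in the open set \<open>B\<close> shows up as an increment in \<open>B\<close> on
  all fine grids, so (1-p)^(2^k) is asymptotically at most exp(-rate). If 2^k p were below
  \<open>\<mu>\<close>, that power would be at least (1-\<mu>/2^k)^(2^k), which tends to the larger
  number exp(-\<mu>).\<close>

lemma increment_rate_lower:
  assumes B: "open B" "0 \<notin> B" and fin: "rate B < \<infinity>" and e: "0 < e"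
  shows "eventually (\<lambda>k. enn2real (rate B) - e \<le> 2 ^ k * prob {\<omega> \<in> space M. Y (1 / 2 ^ k) \<omega> \<in> B}) sequentially"
proof (cases "enn2real (rate B) - e \<le> 0")
  case True
  have "enn2real (rate B) - e \<le> 2 ^ k * prob {\<omega> \<in> space M. Y (1 / 2 ^ k) \<omega> \<in> B}" for k
    using True by (rule order_trans) simp
  then show ?thesis by simp
next
  case False
  let ?\<nu> = "enn2real (rate B)"
  define \<mu> where "\<mu> = ?\<nu> - e"
  have \<mu>: "0 < \<mu>" "\<mu> < ?\<nu>" using False e by (auto simp: \<mu>_def)
  let ?N = "\<lambda>k. {\<omega> \<in> space M. \<forall>i<2^k. X (real (Suc i) / 2 ^ k) \<omega> - X (real i / 2 ^ k) \<omega> \<notin> B}"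
  have Bs: "B \<in> sets borel" using B by simp
  obtain Z where Z: "Z \<in> sets M" "prob Z = exp (- ?\<nu>)"
    "AE \<omega> in M. \<omega> \<in> Z \<longleftrightarrow> (\<forall>u. 0 < u \<and> u \<le> 1 \<longrightarrow> jump (\<lambda>t. X t \<omega>) u \<notin> B)"
    by (rule no_jump_prob[OF Bs B(2) fin])
  have N: "?N k \<in> sets M" for k by (rule increment_events(1)[OF Bs])
  have ae: "AE \<omega> in M. \<omega> \<in> space M - Z \<longrightarrow> eventually (\<lambda>k. \<omega> \<in> space M - ?N k) sequentially"
    using Z(3)
  proof (rule AE_mp, intro AE_I2 impI)
    fix \<omega> assume w: "\<omega> \<in> space M" and *: "\<omega> \<in> Z \<longleftrightarrow> (\<forall>u. 0 < u \<and> u \<le> 1 \<longrightarrow> jump (\<lambda>t. X t \<omega>) u \<notin> B)" "\<omega> \<in> space M - Z"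
    then obtain u where u: "0 < u" "u \<le> 1" "jump (\<lambda>t. X t \<omega>) u \<in> B" by blast
    from jump_imp_increment[OF X_cadlag[OF w] B(1) u]
    show "eventually (\<lambda>k. \<omega> \<in> space M - ?N k) sequentially"
      by (rule eventually_mono) (use w in auto)
  qed
  define \<eta> where "\<eta> = (exp (- \<mu>) - exp (- ?\<nu>)) / 2"
  have \<eta>: "0 < \<eta>" using \<mu> by (simp add: \<eta>_def)
  have "eventually (\<lambda>k. prob (space M - Z) - \<eta> \<le> prob (space M - ?N k)) sequentially"
    by (rule eventually_prob_ge[OF sets.Diff[OF sets.top Z(1)] sets.Diff[OF sets.top N] ae \<eta>])
  moreover have "eventually (\<lambda>k. exp (- ?\<nu>) + \<eta> < (1 + (- \<mu>) / real (2 ^ k)) ^ (2 ^ k)) sequentially"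
  proof -
    have "(\<lambda>n. (1 + (- \<mu>) / real n) ^ n) \<longlonglongrightarrow> exp (- \<mu>)" by (rule tendsto_exp_limit_sequentially)
    then have "eventually (\<lambda>n. exp (- ?\<nu>) + \<eta> < (1 + (- \<mu>) / real n) ^ n) sequentially"
    proof (rule order_tendstoD)
      have mid: "a + (b - a) / 2 < b" if "a < b" for a b :: real using that by (simp add: field_simps)
      have "exp (- ?\<nu>) < exp (- \<mu>)" using \<mu> by simp
      then show "exp (- ?\<nu>) + \<eta> < exp (- \<mu>)" unfolding \<eta>_def by (rule mid)
    qed
    moreover have "filterlim (\<lambda>k. 2 ^ k :: nat) sequentially sequentially"
      by (rule filterlim_subseq) (simp add: strict_mono_def)
    ultimately show ?thesis by (rule eventually_compose_filterlim)
  qed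
  \<comment> \<open>Ensures \<open>\<mu> / 2 ^ k < 1\<close>, so that the base of the power is
    nonnegative.\<close>
  moreover have "eventually (\<lambda>k. 1 / 2 ^ k < 1 / \<mu>) sequentially"
    by (rule mesh_eventually) (use \<mu> in simp)
  ultimately show ?thesis
  proof eventually_elim
    fix k assume 1: "prob (space M - Z) - \<eta> \<le> prob (space M - ?N k)"
      and 2: "exp (- ?\<nu>) + \<eta> < (1 + (- \<mu>) / real (2 ^ k)) ^ (2 ^ k)" and 3: "1 / 2 ^ k < 1 / \<mu>"
    let ?p = "prob {\<omega> \<in> space M. Y (1 / 2 ^ k) \<omega> \<in> B}"
    have "(1 - ?p) ^ (2 ^ k) \<le> exp (- ?\<nu>) + \<eta>"
      using 1 unfolding prob_compl[OF Z(1)] prob_compl[OF N] Z(2) increment_events(2)[OF Bs] by linarith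
    show "?\<nu> - e \<le> 2 ^ k * ?p"
    proof (rule ccontr)
      assume "\<not> ?thesis"
      then have "?p < \<mu> / 2 ^ k" by (simp add: \<mu>_def field_simps)
      moreover have "\<mu> / 2 ^ k < 1" using 3 \<mu> by (simp add: field_simps)
      ultimately have "(1 + (- \<mu>) / real (2 ^ k)) ^ (2 ^ k) \<le> (1 - ?p) ^ (2 ^ k)"
        by (intro power_mono) auto
      then show False using 2 \<open>(1 - ?p) ^ (2 ^ k) \<le> exp (- ?\<nu>) + \<eta>\<close> by linarith
    qed
  qed
qed

end

section \<open>Dyadic skeletons\<close>

lemma emeasure_lborel_bounded: "bounded B \<Longrightarrow> emeasure lborel B = ennreal (measure lborel B)"
  using emeasure_bounded_finite[of B] by (intro emeasure_eq_ennreal_measure) auto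

lemma emeasure_lborel_translate:
  fixes B :: "'a::euclidean_space set"
  assumes "B \<in> sets borel"
  shows "emeasure lborel ((\<lambda>v. u + v) -` B) = emeasure lborel B"
proof -
  have "emeasure lborel B = emeasure (distr lborel borel ((+) u)) B" by (simp add: lborel_distr_plus)
  also have "\<dots> = emeasure lborel ((+) u -` B \<inter> space lborel)"
    using assms by (intro emeasure_distr) auto
  finally show ?thesis by simp
qed

lemma shell_measure_pos:
  assumes "0 < r" "r < s"
  shows "0 < measure lborel {v :: 'a::euclidean_space. r < norm v \<and> norm v < s}"
proof -
  obtain e :: 'a where e: "norm e = (r + s) / 2" using vector_choose_size[of "(r + s) / 2"] assms by auto
  have sub: "ball e ((s - r) / 2) \<subseteq> {v. r < norm v \<and> norm v < s}"
  proof
    fix v assume "v \<in> ball e ((s - r) / 2)"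
    then have d: "norm (e - v) < (s - r) / 2" by (simp add: dist_norm)
    moreover have "norm v \<le> norm e + norm (e - v)" by (metis norm_minus_commute norm_triangle_sub)
    moreover have "norm e \<le> norm v + norm (e - v)" by (metis norm_triangle_sub)
    ultimately show "v \<in> {v. r < norm v \<and> norm v < s}" using e by (simp add: field_simps)
  qed
  have bd: "bounded {v :: 'a. r < norm v \<and> norm v < s}" by (rule boundedI[of _ s]) auto
  have "open {v :: 'a. r < norm v \<and> norm v < s}"
    by (intro open_Collect_conj open_Collect_less continuous_intros)
  then have m: "{v :: 'a. r < norm v \<and> norm v < s} \<in> sets lborel" by simp
  have "0 < measure lborel (ball e ((s - r) / 2))" using assms content_ball_pos[of "(s - r) / 2" e] by simp
  also have "\<dots> \<le> measure lborel {v :: 'a. r < norm v \<and> norm v < s}"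
  proof (rule measure_mono_fmeasurable[OF sub])
    show "{v :: 'a. r < norm v \<and> norm v < s} \<in> fmeasurable lborel"
      using m emeasure_bounded_finite[OF bd] by (simp add: fmeasurable_def)
  qed simp
  finally show ?thesis .
qed

locale unimodal_levy = levy_jumps M X j
  for M :: "'w measure" and X :: "real \<Rightarrow> 'w \<Rightarrow> 'a::euclidean_space" and j :: "real \<Rightarrow> real" +
  assumes iso: "isotropic_unimodal M X"
begin

text \<open>A choice of radial density for one grid step. The law of a step may have an atom at 0,
  about which the density says nothing.\<close>

definition dens :: "nat \<Rightarrow> real \<Rightarrow> real" where
  "dens k = (SOME m. antimono_on {0<..} m \<and> (\<forall>r>0. 0 \<le> m r) \<and>
     (\<forall>A \<in> sets borel. 0 \<notin> A \<longrightarrow> emeasure M {\<omega> \<in> space M. Y (1 / 2 ^ k) \<omega> \<in> A} =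
       (\<integral>\<^sup>+ x\<in>A. ennreal (m (norm x)) \<partial>lborel)))"

lemma dens:
  shows dens_antimono: "0 < r \<Longrightarrow> r \<le> s \<Longrightarrow> dens k s \<le> dens k r"
    and dens_nonneg: "0 < r \<Longrightarrow> 0 \<le> dens k r"
    and dens_emeasure: "A \<in> sets borel \<Longrightarrow> 0 \<notin> A \<Longrightarrow>
      emeasure M {\<omega> \<in> space M. Y (1 / 2 ^ k) \<omega> \<in> A} = (\<integral>\<^sup>+ x\<in>A. ennreal (dens k (norm x)) \<partial>lborel)"
proof -
  have "\<exists>m. antimono_on {0<..} m \<and> (\<forall>r>0. 0 \<le> m r) \<and>
     (\<forall>A \<in> sets borel. 0 \<notin> A \<longrightarrow> emeasure M {\<omega> \<in> space M. Y (1 / 2 ^ k) \<omega> \<in> A} =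
       (\<integral>\<^sup>+ x\<in>A. ennreal (m (norm x)) \<partial>lborel))"
    using iso unfolding isotropic_unimodal_def Y_def by simp
  from someI_ex[OF this]
  have *: "antimono_on {0<..} (dens k) \<and> (\<forall>r>0. 0 \<le> dens k r) \<and>
     (\<forall>A \<in> sets borel. 0 \<notin> A \<longrightarrow> emeasure M {\<omega> \<in> space M. Y (1 / 2 ^ k) \<omega> \<in> A} =
       (\<integral>\<^sup>+ x\<in>A. ennreal (dens k (norm x)) \<partial>lborel))"
    unfolding dens_def .
  show "0 < r \<Longrightarrow> r \<le> s \<Longrightarrow> dens k s \<le> dens k r"
    using * unfolding monotone_on_def by auto
  show "0 < r \<Longrightarrow> 0 \<le> dens k r" using * by blast
  show "A \<in> sets borel \<Longrightarrow> 0 \<notin> A \<Longrightarrow>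
      emeasure M {\<omega> \<in> space M. Y (1 / 2 ^ k) \<omega> \<in> A} = (\<integral>\<^sup>+ x\<in>A. ennreal (dens k (norm x)) \<partial>lborel)"
    using * by blast
qed

lemma step_upper:
  assumes B: "B \<in> sets borel" and r: "0 < r" "\<And>v. v \<in> B \<Longrightarrow> r \<le> norm v"
  shows "emeasure M {\<omega> \<in> space M. Y (1 / 2 ^ k) \<omega> \<in> B} \<le> ennreal (dens k r) * emeasure lborel B"
proof -
  have "0 \<notin> B" using r by force
  then have "emeasure M {\<omega> \<in> space M. Y (1 / 2 ^ k) \<omega> \<in> B} = (\<integral>\<^sup>+ x\<in>B. ennreal (dens k (norm x)) \<partial>lborel)"
    by (rule dens_emeasure[OF B])
  also have "\<dots> \<le> (\<integral>\<^sup>+ x. ennreal (dens k r) * indicator B x \<partial>lborel)"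
    using r by (intro nn_integral_mono) (auto simp: indicator_def intro!: ennreal_leI dens_antimono)
  also have "\<dots> = ennreal (dens k r) * emeasure lborel B"
    using B by (intro nn_integral_cmult_indicator) simp
  finally show ?thesis .
qed

lemma step_lower:
  assumes B: "B \<in> sets borel" "0 \<notin> B" and r: "\<And>v. v \<in> B \<Longrightarrow> norm v \<le> r"
  shows "ennreal (dens k r) * emeasure lborel B \<le> emeasure M {\<omega> \<in> space M. Y (1 / 2 ^ k) \<omega> \<in> B}"
proof -
  have "ennreal (dens k r) * emeasure lborel B = (\<integral>\<^sup>+ x. ennreal (dens k r) * indicator B x \<partial>lborel)"
    using B by (intro nn_integral_cmult_indicator[symmetric]) simp
  also have "\<dots> \<le> (\<integral>\<^sup>+ x\<in>B. ennreal (dens k (norm x)) \<partial>lborel)"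
  proof (intro nn_integral_mono)
    fix x
    show "ennreal (dens k r) * indicator B x \<le> ennreal (dens k (norm x)) * indicator B x"
    proof (cases "x \<in> B")
      case True
      then have "0 < norm x" using B(2) by auto
      then show ?thesis using True r by (auto intro!: ennreal_leI dens_antimono)
    qed simp
  qed
  also have "\<dots> = emeasure M {\<omega> \<in> space M. Y (1 / 2 ^ k) \<omega> \<in> B}"
    by (rule dens_emeasure[OF B, symmetric])
  finally show ?thesis .
qed

lemma rate_upper:
  assumes B: "B \<in> sets borel" "bounded B" and r: "0 < r" "\<And>v. v \<in> B \<Longrightarrow> r \<le> norm v"
  shows "rate B \<le> ennreal (j r * measure lborel B)"
proof -
  have "rate B \<le> (\<integral>\<^sup>+ x. ennreal (j r) * indicator B x \<partial>lborel)"
    unfolding rate_def using r by (intro nn_integral_mono) (auto simp: indicator_def intro!: ennreal_leI j_antimono)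
  also have "\<dots> = ennreal (j r) * emeasure lborel B"
    using B by (intro nn_integral_cmult_indicator) simp
  finally show ?thesis using emeasure_lborel_bounded[OF B(2)] j_nonneg[OF r(1)] by (simp add: ennreal_mult)
qed

lemma rate_lower:
  assumes B: "B \<in> sets borel" "bounded B" "0 \<notin> B" and r: "0 < r" "\<And>v. v \<in> B \<Longrightarrow> norm v \<le> r"
  shows "ennreal (j r * measure lborel B) \<le> rate B"
proof -
  have "ennreal (j r * measure lborel B) = ennreal (j r) * emeasure lborel B"
    using emeasure_lborel_bounded[OF B(2)] j_nonneg[OF r(1)] by (simp add: ennreal_mult)
  also have "\<dots> = (\<integral>\<^sup>+ x. ennreal (j r) * indicator B x \<partial>lborel)"
    using B by (intro nn_integral_cmult_indicator[symmetric]) simp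
  also have "\<dots> \<le> rate B"
    unfolding rate_def
  proof (intro nn_integral_mono)
    fix x
    show "ennreal (j r) * indicator B x \<le> ennreal (j (norm x)) * indicator B x"
    proof (cases "x \<in> B")
      case True
      then have "0 < norm x" using B(3) by auto
      then show ?thesis using True r by (auto intro!: ennreal_leI j_antimono)
    qed simp
  qed
  finally show ?thesis .
qed

text \<open>On the shell between the two radii, unimodality keeps the step density above its value
  at \<open>r\<close>, while the jump rate of the shell is at most \<open>j r'\<close> times its
  volume. The radii differ because the shell must have positive volume.\<close>

lemma dens_upper:
  assumes r: "0 < r'" "r' < r" and e: "0 < e"
  shows "eventually (\<lambda>k. 2 ^ k * dens k r \<le> j r' + e) sequentially"
proof -
  let ?B = "{v :: 'a. r' \<le> norm v \<and> norm v \<le> r}"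
  define V where "V = measure lborel ?B"
  have cl: "closed ?B" by (intro closed_Collect_conj closed_Collect_le continuous_intros)
  then have Bs: "?B \<in> sets borel" by simp
  have bd: "bounded ?B" by (rule boundedI[of _ r]) auto
  have "0 < measure lborel {v :: 'a. r' < norm v \<and> norm v < r}" by (rule shell_measure_pos[OF r])
  also have "\<dots> \<le> V"
    unfolding V_def
  proof (rule measure_mono_fmeasurable)
    have "open {v :: 'a. r' < norm v \<and> norm v < r}"
      by (intro open_Collect_conj open_Collect_less continuous_intros)
    then show "{v :: 'a. r' < norm v \<and> norm v < r} \<in> sets lborel" by simp
    show "?B \<in> fmeasurable lborel" using emeasure_bounded_finite[OF bd] Bs by (simp add: fmeasurable_def)
  qed auto
  finally have V: "0 < V" .
  have n0: "0 \<notin> ?B" using r by auto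
  have ru: "rate ?B \<le> ennreal (j r' * V)" unfolding V_def by (rule rate_upper[OF Bs bd r(1)]) auto
  then have fin: "rate ?B < \<infinity>" by (rule order.strict_trans1) simp
  have ru': "enn2real (rate ?B) \<le> j r' * V" using ru V j_nonneg[OF r(1)] by (simp add: enn2real_leI)
  have "eventually (\<lambda>k. 2 ^ k * prob {\<omega> \<in> space M. Y (1 / 2 ^ k) \<omega> \<in> ?B} \<le> enn2real (rate ?B) + e * V) sequentially"
    by (rule increment_rate_upper[OF cl n0 fin]) (use e V in simp)
  then show ?thesis
  proof (rule eventually_mono)
    fix k assume k: "2 ^ k * prob {\<omega> \<in> space M. Y (1 / 2 ^ k) \<omega> \<in> ?B} \<le> enn2real (rate ?B) + e * V"
    have "ennreal (dens k r * V) \<le> emeasure M {\<omega> \<in> space M. Y (1 / 2 ^ k) \<omega> \<in> ?B}"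
      using step_lower[OF Bs n0, of r k] emeasure_lborel_bounded[OF bd] dens_nonneg[of r k] r
      by (simp add: ennreal_mult V_def)
    then have "dens k r * V \<le> prob {\<omega> \<in> space M. Y (1 / 2 ^ k) \<omega> \<in> ?B}"
      by (simp add: emeasure_eq_measure)
    then have "2 ^ k * (dens k r * V) \<le> 2 ^ k * prob {\<omega> \<in> space M. Y (1 / 2 ^ k) \<omega> \<in> ?B}"
      by (intro mult_left_mono) auto
    also have "\<dots> \<le> j r' * V + e * V" using k ru' by linarith
    finally have "(2 ^ k * dens k r) * V \<le> (j r' + e) * V" by (simp add: algebra_simps)
    then show "2 ^ k * dens k r \<le> j r' + e" using V by simp
  qed
qed

text \<open>The mirror image of the upper bound, with an open shell because the lower estimate of
  step probabilities is for open sets.\<close>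

lemma dens_lower:
  assumes r: "0 < r" "r < r'" and e: "0 < e"
  shows "eventually (\<lambda>k. j r' - e \<le> 2 ^ k * dens k r) sequentially"
proof -
  let ?B = "{v :: 'a. r < norm v \<and> norm v < r'}"
  define V where "V = measure lborel ?B"
  have op: "open ?B" by (intro open_Collect_conj open_Collect_less continuous_intros)
  then have Bs: "?B \<in> sets borel" by simp
  have bd: "bounded ?B" by (rule boundedI[of _ r']) auto
  have V: "0 < V" unfolding V_def by (rule shell_measure_pos[OF r])
  have n0: "0 \<notin> ?B" using r by auto
  have "rate ?B \<le> ennreal (j r * V)" unfolding V_def by (rule rate_upper[OF Bs bd r(1)]) auto
  then have fin: "rate ?B < \<infinity>" by (rule order.strict_trans1) simp
  have "ennreal (j r' * V) \<le> rate ?B"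
    unfolding V_def by (rule rate_lower[OF Bs bd n0]) (use r in auto)
  then have rl: "j r' * V \<le> enn2real (rate ?B)"
    using fin V j_nonneg[of r'] r by (metis enn2real_ennreal enn2real_mono infinity_ennreal_def mult_nonneg_nonneg less_imp_le less_trans)
  have "eventually (\<lambda>k. enn2real (rate ?B) - e * V \<le> 2 ^ k * prob {\<omega> \<in> space M. Y (1 / 2 ^ k) \<omega> \<in> ?B}) sequentially"
    by (rule increment_rate_lower[OF op n0 fin]) (use e V in simp)
  then show ?thesis
  proof (rule eventually_mono)
    fix k assume k: "enn2real (rate ?B) - e * V \<le> 2 ^ k * prob {\<omega> \<in> space M. Y (1 / 2 ^ k) \<omega> \<in> ?B}"
    have "emeasure M {\<omega> \<in> space M. Y (1 / 2 ^ k) \<omega> \<in> ?B} \<le> ennreal (dens k r * V)"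
      using step_upper[OF Bs r(1), of k] emeasure_lborel_bounded[OF bd] dens_nonneg[of r k] r
      by (simp add: ennreal_mult V_def)
    then have "prob {\<omega> \<in> space M. Y (1 / 2 ^ k) \<omega> \<in> ?B} \<le> dens k r * V"
      using dens_nonneg[of r k] r V by (simp add: emeasure_eq_measure)
    then have "2 ^ k * prob {\<omega> \<in> space M. Y (1 / 2 ^ k) \<omega> \<in> ?B} \<le> 2 ^ k * (dens k r * V)"
      by (intro mult_left_mono) auto
    then have "j r' * V - e * V \<le> 2 ^ k * (dens k r * V)" using k rl by linarith
    then have "(j r' - e) * V \<le> (2 ^ k * dens k r) * V" by (simp add: algebra_simps)
    then show "j r' - e \<le> 2 ^ k * dens k r" using V by simp
  qed
qed

section \<open>Exits observed along a dyadic grid\<close>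

definition stay :: "'a \<Rightarrow> 'a set \<Rightarrow> nat \<Rightarrow> nat \<Rightarrow> 'w set" where
  "stay x G k i = {\<omega> \<in> space M. \<forall>l\<le>i. x + Y (real l / 2 ^ k) \<omega> \<in> G}"

definition grid_exit :: "'a \<Rightarrow> 'a set \<Rightarrow> 'a set \<Rightarrow> nat \<Rightarrow> nat \<Rightarrow> 'w set" where
  "grid_exit x G B k i = {\<omega> \<in> stay x G k i. x + Y (real (Suc i) / 2 ^ k) \<omega> \<in> B}"

text \<open>\<open>\<Theta> L k\<close> is the mean exit time from a ball of radius \<open>L\<close> observed along the grid of mesh \<open>2\<^sup>-\<^sup>k\<close>.\<close>

definition \<Theta> :: "real \<Rightarrow> nat \<Rightarrow> ennreal" where
  "\<Theta> L k = (\<Sum>i. emeasure M (stay 0 (ball 0 L) k i)) * ennreal (1 / 2 ^ k)"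

lemma stay_measurable[measurable]: "G \<in> sets borel \<Longrightarrow> stay x G k i \<in> sets M"
proof -
  assume G: "G \<in> sets borel"
  have "stay x G k i = (\<Inter>l\<in>{..i}. {\<omega> \<in> space M. x + Y (real l / 2 ^ k) \<omega> \<in> G})"
    unfolding stay_def by auto
  also have "\<dots> \<in> sets M"
  proof (rule sets.finite_INT)
    fix l
    have [measurable]: "Y (real l / 2 ^ k) \<in> borel_measurable M" by (rule Y_measurable) simp
    note [measurable] = G
    show "{\<omega> \<in> space M. x + Y (real l / 2 ^ k) \<omega> \<in> G} \<in> sets M" by measurable
  qed auto
  finally show ?thesis .
qed

lemma grid_exit_measurable[measurable]:
  assumes [measurable]: "G \<in> sets borel" "B \<in> sets borel"
  shows "grid_exit x G B k i \<in> sets M"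
proof -
  have [measurable]: "Y (real (Suc i) / 2 ^ k) \<in> borel_measurable M" by (rule Y_measurable) simp
  have "grid_exit x G B k i = stay x G k i \<inter> {\<omega> \<in> space M. x + Y (real (Suc i) / 2 ^ k) \<omega> \<in> B}"
    unfolding grid_exit_def stay_def by auto
  then show ?thesis by simp
qed

lemma stay_mono:
  assumes "G \<subseteq> ball x L"
  shows "stay x G k i \<subseteq> stay 0 (ball 0 L) k i"
proof
  fix \<omega> assume w: "\<omega> \<in> stay x G k i"
  have "0 + Y (real l / 2 ^ k) \<omega> \<in> ball 0 L" if "l \<le> i" for l
  proof -
    have "x + Y (real l / 2 ^ k) \<omega> \<in> ball x L" using w that assms unfolding stay_def by blast
    then show ?thesis by (simp add: dist_norm)
  qed
  then show "\<omega> \<in> stay 0 (ball 0 L) k i" using w unfolding stay_def by blast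
qed

lemma stay_ball: "stay x (ball x L) k i = stay 0 (ball 0 L) k i"
  unfolding stay_def by (auto simp: dist_norm)

lemma emeasure_grid_exit:
  assumes G: "G \<in> sets borel" and B: "B \<in> sets borel"
  shows "emeasure M (grid_exit x G B k i) =
    (\<integral>\<^sup>+\<omega>. indicator (stay x G k i) \<omega> * emeasure M {\<omega>' \<in> space M. Y (1 / 2 ^ k) \<omega>' \<in> (\<lambda>v. (x + Y (real i / 2 ^ k) \<omega>) + v) -` B} \<partial>M)"
proof -
  interpret PW: prob_space PW by (rule prob_space_PW)
  let ?t = "real i / 2 ^ k" and ?d = "1 / 2 ^ k :: real"
  note [measurable] = G B
  have c[measurable]: "(\<lambda>w. w (real l / 2 ^ k)) \<in> W \<rightarrow>\<^sub>M borel" for l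
    by (rule component_measurable) simp
  have cd[measurable]: "(\<lambda>w. w ?d) \<in> W \<rightarrow>\<^sub>M borel" by (rule component_measurable) simp
  define P where "P = {p \<in> space W. \<forall>l\<in>{..i}. x + p (real l / 2 ^ k) \<in> G}"
  have P[measurable]: "P \<in> sets W" unfolding P_def by measurable
  define f where "f z = indicator P (fst z) * (indicator B ((x + fst z ?t) + snd z ?d) :: ennreal)" for z
  have f: "f \<in> borel_measurable (W \<Otimes>\<^sub>M W)" unfolding f_def by measurable
  have pP: "past ?t \<omega> \<in> P \<longleftrightarrow> \<omega> \<in> stay x G k i" if "\<omega> \<in> space M" for \<omega>
  proof -
    have "past ?t \<omega> (real l / 2 ^ k) = Y (real l / 2 ^ k) \<omega>" if "l \<le> i" for l
      using that by (simp add: past_def min_def divide_right_mono)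
    then show ?thesis using that past_in_space[of ?t] by (auto simp: P_def stay_def)
  qed
  have pt: "past ?t \<omega> ?t = Y ?t \<omega>" for \<omega> by (simp add: past_def)
  have sum: "?t + ?d = real (Suc i) / 2 ^ k" by (simp add: add_divide_distrib)
  have fd: "fut ?t \<omega> ?d = Y (real (Suc i) / 2 ^ k) \<omega> - Y ?t \<omega>" for \<omega>
    unfolding sum[symmetric] by (simp add: fut_def)
  have "emeasure M (grid_exit x G B k i) = (\<integral>\<^sup>+\<omega>. indicator (grid_exit x G B k i) \<omega> \<partial>M)"
    by (rule nn_integral_indicator[symmetric]) measurable
  also have "\<dots> = (\<integral>\<^sup>+\<omega>. f (past ?t \<omega>, fut ?t \<omega>) \<partial>M)"
  proof (rule nn_integral_cong)
    fix \<omega> assume w: "\<omega> \<in> space M"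
    have e: "(x + past ?t \<omega> ?t) + fut ?t \<omega> ?d = x + Y (real (Suc i) / 2 ^ k) \<omega>" unfolding pt fd by simp
    show "indicator (grid_exit x G B k i) \<omega> = f (past ?t \<omega>, fut ?t \<omega>)"
      unfolding f_def fst_conv snd_conv e using pP[OF w] by (auto simp: indicator_def grid_exit_def)
  qed
  also have "\<dots> = (\<integral>\<^sup>+\<omega>. (\<integral>\<^sup>+w. f (past ?t \<omega>, w) \<partial>PW) \<partial>M)" by (rule nn_integral_past_fut[OF _ f]) simp
  also have "\<dots> = (\<integral>\<^sup>+\<omega>. indicator (stay x G k i) \<omega> * emeasure M {\<omega>' \<in> space M. Y ?d \<omega>' \<in> (\<lambda>v. (x + Y ?t \<omega>) + v) -` B} \<partial>M)"
  proof (rule nn_integral_cong)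
    fix \<omega> assume w: "\<omega> \<in> space M"
    have pr: "Measurable.pred W (\<lambda>w. (x + Y ?t \<omega>) + w ?d \<in> B)" by measurable
    have sp: "space PW = space W" by (rule sets_eq_imp_space_eq[OF sets_PW])
    have "(\<integral>\<^sup>+w. f (past ?t \<omega>, w) \<partial>PW) =
        (\<integral>\<^sup>+w. indicator (stay x G k i) \<omega> * indicator {w \<in> space W. (x + Y ?t \<omega>) + w ?d \<in> B} w \<partial>PW)"
      unfolding f_def fst_conv snd_conv pt using pP[OF w] by (intro nn_integral_cong) (auto simp: indicator_def sp)
    also have "\<dots> = indicator (stay x G k i) \<omega> * emeasure PW {w \<in> space W. (x + Y ?t \<omega>) + w ?d \<in> B}"
      using pr by (intro nn_integral_cmult_indicator) (simp add: sets_PW)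
    also have "emeasure PW {w \<in> space W. (x + Y ?t \<omega>) + w ?d \<in> B} = emeasure M {\<omega>' \<in> space M. (x + Y ?t \<omega>) + fut 0 \<omega>' ?d \<in> B}"
      by (rule prob_fut0[OF pr])
    also have "{\<omega>' \<in> space M. (x + Y ?t \<omega>) + fut 0 \<omega>' ?d \<in> B} = {\<omega>' \<in> space M. Y ?d \<omega>' \<in> (\<lambda>v. (x + Y ?t \<omega>) + v) -` B}"
      by (simp add: fut_def)
    finally show "(\<integral>\<^sup>+w. f (past ?t \<omega>, w) \<partial>PW) =
        indicator (stay x G k i) \<omega> * emeasure M {\<omega>' \<in> space M. Y ?d \<omega>' \<in> (\<lambda>v. (x + Y ?t \<omega>) + v) -` B}" .
  qed
  finally show ?thesis .
qed

lemma mesh_rescale: "0 \<le> d \<Longrightarrow> S * ennreal (1 / 2 ^ k) * ennreal (2 ^ k * d) = S * ennreal d"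
proof -
  assume "0 \<le> d"
  then have "ennreal (1 / 2 ^ k) * ennreal (2 ^ k * d) = ennreal d"
    by (simp flip: ennreal_mult)
  then show ?thesis by (simp add: mult.assoc)
qed

text \<open>A discrete Levy system bound: sum over the steps the probability of still being in
  \<open>G\<close> times the chance that the next step reaches \<open>B\<close>, which is at most
  the density at distance \<open>r\<close> times the volume of \<open>B\<close>. The powers of 2 in
  \<open>\<Theta>\<close> and next to \<open>dens\<close> cancel.\<close>

lemma grid_exit_upper:
  assumes G: "G \<in> sets borel" "G \<subseteq> ball x L" and B: "B \<in> sets borel"
    and r: "0 < r" "\<And>u v. u \<in> G \<Longrightarrow> v \<in> B \<Longrightarrow> r \<le> dist u v"
  shows "emeasure M (\<Union>i. grid_exit x G B k i) \<le> \<Theta> L k * ennreal (2 ^ k * dens k r) * emeasure lborel B"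
proof -
  have step: "emeasure M (grid_exit x G B k i) \<le> emeasure M (stay 0 (ball 0 L) k i) * (ennreal (dens k r) * emeasure lborel B)" for i
  proof -
    let ?c = "ennreal (dens k r) * emeasure lborel B"
    have "emeasure M (grid_exit x G B k i) \<le> (\<integral>\<^sup>+\<omega>. ?c * indicator (stay x G k i) \<omega> \<partial>M)"
      unfolding emeasure_grid_exit[OF G(1) B]
    proof (rule nn_integral_mono)
      fix \<omega>
      let ?u = "x + Y (real i / 2 ^ k) \<omega>"
      have "emeasure M {\<omega>' \<in> space M. Y (1 / 2 ^ k) \<omega>' \<in> (\<lambda>v. ?u + v) -` B} \<le> ?c" if "\<omega> \<in> stay x G k i"
      proof -
        have u: "?u \<in> G" using that unfolding stay_def by blast
        have "(\<lambda>v. ?u + v) -` B \<inter> space borel \<in> sets borel" by (rule measurable_sets[OF _ B]) simp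
        then have "(\<lambda>v. ?u + v) -` B \<in> sets borel" by simp
        moreover have "r \<le> norm v" if "v \<in> (\<lambda>v. ?u + v) -` B" for v
          using r(2)[OF u, of "?u + v"] that by (simp add: dist_norm)
        ultimately have "emeasure M {\<omega>' \<in> space M. Y (1 / 2 ^ k) \<omega>' \<in> (\<lambda>v. ?u + v) -` B} \<le>
            ennreal (dens k r) * emeasure lborel ((\<lambda>v. ?u + v) -` B)"
          by (rule step_upper[OF _ r(1)])
        then show ?thesis by (simp add: emeasure_lborel_translate[OF B])
      qed
      then show "indicator (stay x G k i) \<omega> * emeasure M {\<omega>' \<in> space M. Y (1 / 2 ^ k) \<omega>' \<in> (\<lambda>v. ?u + v) -` B}
          \<le> ?c * indicator (stay x G k i) \<omega>"
        by (simp add: indicator_def)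
    qed
    also have "\<dots> = ?c * emeasure M (stay x G k i)"
      by (rule nn_integral_cmult_indicator) (rule stay_measurable[OF G(1)])
    also have "\<dots> \<le> ?c * emeasure M (stay 0 (ball 0 L) k i)"
      by (intro mult_left_mono emeasure_mono stay_mono G(2) stay_measurable) auto
    finally show ?thesis by (simp add: mult.commute)
  qed
  have "emeasure M (\<Union>i. grid_exit x G B k i) \<le> (\<Sum>i. emeasure M (grid_exit x G B k i))"
    by (rule emeasure_subadditive_countably) (use grid_exit_measurable[OF G(1) B] in auto)
  also have "\<dots> \<le> (\<Sum>i. emeasure M (stay 0 (ball 0 L) k i) * (ennreal (dens k r) * emeasure lborel B))"
    by (rule suminf_le[OF step]) auto
  also have "\<dots> = (\<Sum>i. emeasure M (stay 0 (ball 0 L) k i)) * (ennreal (dens k r) * emeasure lborel B)"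
    by (rule ennreal_suminf_multc)
  also have "\<dots> = \<Theta> L k * ennreal (2 ^ k * dens k r) * emeasure lborel B"
    unfolding \<Theta>_def by (simp add: mesh_rescale dens_nonneg r mult.assoc[symmetric])
  finally show ?thesis .
qed

lemma grid_exit_lower:
  assumes B: "B \<in> sets borel" "B \<inter> ball x L = {}"
    and r: "0 < r" "\<And>u v. u \<in> ball x L \<Longrightarrow> v \<in> B \<Longrightarrow> dist u v \<le> r"
  shows "\<Theta> L k * ennreal (2 ^ k * dens k r) * emeasure lborel B \<le> emeasure M (\<Union>i. grid_exit x (ball x L) B k i)"
proof -
  let ?G = "ball x L"
  have G: "?G \<in> sets borel" by simp
  have step: "emeasure M (stay 0 (ball 0 L) k i) * (ennreal (dens k r) * emeasure lborel B) \<le> emeasure M (grid_exit x ?G B k i)" for i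
  proof -
    let ?c = "ennreal (dens k r) * emeasure lborel B"
    have "?c * emeasure M (stay x ?G k i) = (\<integral>\<^sup>+\<omega>. ?c * indicator (stay x ?G k i) \<omega> \<partial>M)"
      by (rule nn_integral_cmult_indicator[symmetric]) (rule stay_measurable[OF G])
    also have "\<dots> \<le> emeasure M (grid_exit x ?G B k i)"
      unfolding emeasure_grid_exit[OF G B(1)]
    proof (rule nn_integral_mono)
      fix \<omega>
      let ?u = "x + Y (real i / 2 ^ k) \<omega>"
      have "?c \<le> emeasure M {\<omega>' \<in> space M. Y (1 / 2 ^ k) \<omega>' \<in> (\<lambda>v. ?u + v) -` B}" if "\<omega> \<in> stay x ?G k i"
      proof -
        have u: "?u \<in> ?G" using that unfolding stay_def by blast
        have "(\<lambda>v. ?u + v) -` B \<inter> space borel \<in> sets borel" by (rule measurable_sets[OF _ B(1)]) simp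
        then have m: "(\<lambda>v. ?u + v) -` B \<in> sets borel" by simp
        have n0: "0 \<notin> (\<lambda>v. ?u + v) -` B" using u B(2) by auto
        have "norm v \<le> r" if "v \<in> (\<lambda>v. ?u + v) -` B" for v
          using r(2)[OF u, of "?u + v"] that by (simp add: dist_norm)
        from step_lower[OF m n0 this, of k] show ?thesis by (simp add: emeasure_lborel_translate[OF B(1)])
      qed
      then show "?c * indicator (stay x ?G k i) \<omega> \<le>
          indicator (stay x ?G k i) \<omega> * emeasure M {\<omega>' \<in> space M. Y (1 / 2 ^ k) \<omega>' \<in> (\<lambda>v. ?u + v) -` B}"
        by (simp add: indicator_def)
    qed
    finally show ?thesis unfolding stay_ball[of x] by (subst mult.commute)
  qed
  \<comment> \<open>Since \<open>B\<close> misses the ball, only the first step out of the ball can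
    be a grid exit into \<open>B\<close>; so the probabilities add up to that of the union.\<close>
  have disj: "disjoint_family (\<lambda>i. grid_exit x ?G B k i)"
  proof -
    have "grid_exit x ?G B k m \<inter> grid_exit x ?G B k n = {}" if "m < n" for m n
    proof (rule equals0I)
      fix \<omega> assume w: "\<omega> \<in> grid_exit x ?G B k m \<inter> grid_exit x ?G B k n"
      then have "x + Y (real (Suc m) / 2 ^ k) \<omega> \<in> B" by (simp add: grid_exit_def)
      moreover have "x + Y (real (Suc m) / 2 ^ k) \<omega> \<in> ?G"
      proof -
        have "Suc m \<le> n" using that by simp
        then show ?thesis using w unfolding grid_exit_def stay_def by blast
      qed
      ultimately show False using B(2) by blast
    qed
    then show ?thesis unfolding disjoint_family_on_def by (metis Int_commute linorder_neqE_nat)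
  qed
  have "\<Theta> L k * ennreal (2 ^ k * dens k r) * emeasure lborel B =
      (\<Sum>i. emeasure M (stay 0 (ball 0 L) k i)) * (ennreal (dens k r) * emeasure lborel B)"
    unfolding \<Theta>_def by (simp add: mesh_rescale dens_nonneg r mult.assoc[symmetric])
  also have "\<dots> = (\<Sum>i. emeasure M (stay 0 (ball 0 L) k i) * (ennreal (dens k r) * emeasure lborel B))"
    by (rule ennreal_suminf_multc[symmetric])
  also have "\<dots> \<le> (\<Sum>i. emeasure M (grid_exit x ?G B k i))"
    by (rule suminf_le[OF step]) auto
  also have "\<dots> = emeasure M (\<Union>i. grid_exit x ?G B k i)"
    by (rule suminf_emeasure[OF _ disj]) (use grid_exit_measurable[OF G B(1)] in auto)
  finally show ?thesis .
qed

end

section \<open>Passage from the grid to continuous time\<close>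

lemma frequently_gt_limsup:
  fixes f :: "nat \<Rightarrow> 'a::complete_linorder"
  assumes "c < limsup f"
  shows "frequently (\<lambda>k. c < f k) sequentially"
proof (rule ccontr)
  assume "\<not> ?thesis"
  then have "eventually (\<lambda>k. f k \<le> c) sequentially" by (simp add: frequently_def not_less)
  then have "limsup f \<le> c" by (rule Limsup_bounded)
  then show False using assms by simp
qed

context unimodal_levy
begin

text \<open>By right-continuity the path is still in the open set \<open>B\<close> shortly after
  \<open>t\<close>. So the first grid point at or after \<open>t\<close> lies in \<open>B\<close>
  for fine grids, and all earlier grid points come before \<open>t\<close>.\<close>

lemma exits_imp_grid_exit:
  assumes w: "\<omega> \<in> space M" and x: "x \<in> G" and ex: "exits (\<lambda>t. x + Y t \<omega>) G t" and B: "open B" "x + Y t \<omega> \<in> B"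
  shows "eventually (\<lambda>k. \<omega> \<in> (\<Union>i. grid_exit x G B k i)) sequentially"
proof -
  have "t \<noteq> 0" using ex x by (auto simp: exits_def)
  then have t: "0 < t" using ex by (simp add: exits_def)
  have "((\<lambda>t. x + Y t \<omega>) \<longlongrightarrow> x + Y t \<omega>) (at_right t)"
    using right_cont_path[OF w, of x] t unfolding right_cont_def by simp
  then have "eventually (\<lambda>s. x + Y s \<omega> \<in> B) (at_right t)" by (rule topological_tendstoD[OF _ B])
  then obtain b where b: "b > t" "\<And>s. t < s \<Longrightarrow> s < b \<Longrightarrow> x + Y s \<omega> \<in> B"
    unfolding eventually_at_right_field by blast
  have "0 < b - t" using b by simp
  from mesh_eventually[OF this] show ?thesis
  proof (rule eventually_mono)
    fix k :: nat assume k: "1 / 2 ^ k < b - t"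
    define n where "n = \<lceil>t * 2 ^ k\<rceil> - 1"
    have n: "real_of_int n < t * 2 ^ k" "t * 2 ^ k \<le> real_of_int n + 1" unfolding n_def by linarith+
    have "0 < t * 2 ^ k" using t by simp
    then have n0: "0 \<le> n" unfolding n_def by linarith
    define i where "i = nat n"
    have i: "real i < t * 2 ^ k" "t * 2 ^ k \<le> real i + 1" using n n0 by (auto simp: i_def)
    have 1: "real i / 2 ^ k < t" "t \<le> real (Suc i) / 2 ^ k" using i by (simp_all add: field_simps)
    have "real (Suc i) / 2 ^ k = real i / 2 ^ k + 1 / 2 ^ k" by (simp add: add_divide_distrib)
    then have 2: "real (Suc i) / 2 ^ k < b" using 1 k by linarith
    have "x + Y (real (Suc i) / 2 ^ k) \<omega> \<in> B"
    proof (cases "real (Suc i) / 2 ^ k = t")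
      case True
      show ?thesis unfolding True by (rule B(2))
    next
      case False
      then show ?thesis using 1 2 by (intro b(2)) simp_all
    qed
    moreover have "x + Y (real l / 2 ^ k) \<omega> \<in> G" if "l \<le> i" for l
    proof -
      have "real l / 2 ^ k \<le> real i / 2 ^ k" using that by (simp add: divide_right_mono)
      then have "0 \<le> real l / 2 ^ k \<and> real l / 2 ^ k < t" using 1 by simp
      then show ?thesis using ex unfolding exits_def by blast
    qed
    ultimately have "\<omega> \<in> grid_exit x G B k i" using w by (simp add: grid_exit_def stay_def)
    then show "\<omega> \<in> (\<Union>i. grid_exit x G B k i)" by blast
  qed
qed

text \<open>The candidate \<open>t\<close> is the infimum of the dyadic times outside
  \<open>G\<close>. Grid exits on fine grids come no later than any given such time, so they occur
  at \<open>t\<close> or arbitrarily close to its right, and closedness of \<open>B\<close> gives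
  the position at \<open>t\<close>. At non-dyadic times the path may touch the boundary, hence
  \<open>closure G\<close>.\<close>

lemma frequently_grid_exit:
  assumes w: "\<omega> \<in> space M" and B: "closed B" "B \<inter> G = {}"
    and fr: "frequently (\<lambda>k. \<omega> \<in> (\<Union>i. grid_exit x G B k i)) sequentially"
  shows "\<exists>t\<ge>0. x + Y t \<omega> \<in> B \<and> (\<forall>s. 0 \<le> s \<and> s < t \<longrightarrow> x + Y s \<omega> \<in> closure G)"
proof -
  let ?y = "\<lambda>t. x + Y t \<omega>"
  define Z where "Z = {q. \<exists>k n. q = real n / 2 ^ k \<and> ?y q \<notin> G}"
  have fr': "\<exists>k\<ge>N. \<exists>i. \<omega> \<in> grid_exit x G B k i" for N
    using fr unfolding frequently_sequentially by blast
  have ZI: "real (Suc i) / 2 ^ k \<in> Z" if "\<omega> \<in> grid_exit x G B k i" for k i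
  proof -
    have "?y (real (Suc i) / 2 ^ k) \<notin> G" using that B(2) by (auto simp: grid_exit_def)
    then show ?thesis unfolding Z_def by blast
  qed
  have ne: "Z \<noteq> {}" using fr'[of 0] ZI by blast
  have Z0: "0 \<le> q" if "q \<in> Z" for q using that by (auto simp: Z_def)
  then have bd: "bdd_below Z" by (auto intro: bdd_belowI[of _ 0])
  define t where "t = Inf Z"
  have t0: "0 \<le> t" unfolding t_def using Z0 by (intro cInf_greatest[OF ne])
  \<comment> \<open>On any grid containing \<open>q\<close> the skeleton is outside at
    \<open>q\<close>, so a grid exit recorded there happens at \<open>q\<close> or before.\<close>
  have first: "real (Suc i) / 2 ^ k \<le> q" if e: "\<omega> \<in> grid_exit x G B k i" and q: "q = real n / 2 ^ m" "?y q \<notin> G" and m: "m \<le> k" for i k q n m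
  proof -
    have "real n / 2 ^ m = real (n * 2 ^ (k - m)) / 2 ^ k"
      using m by (simp add: field_simps flip: power_add)
    then have q': "q = real (n * 2 ^ (k - m)) / 2 ^ k" using q by simp
    have "i < n * 2 ^ (k - m)"
    proof (rule ccontr)
      assume "\<not> ?thesis"
      then have "?y (real (n * 2 ^ (k - m)) / 2 ^ k) \<in> G" using e unfolding grid_exit_def stay_def by (simp del: of_nat_mult)
      then show False using q(2) q' by simp
    qed
    then have "real (Suc i) \<le> real (n * 2 ^ (k - m))" by (simp only: of_nat_le_iff Suc_le_eq)
    then show ?thesis unfolding q' by (rule divide_right_mono) simp
  qed
  have yB: "?y t \<in> B"
  proof (rule ccontr)
    assume nB: "?y t \<notin> B"
    have "(?y \<longlongrightarrow> ?y t) (at_right t)"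
      using right_cont_path[OF w, of x] t0 unfolding right_cont_def by simp
    then have "eventually (\<lambda>s. ?y s \<in> - B) (at_right t)"
      by (rule topological_tendstoD) (use B nB in auto)
    then obtain b where b: "b > t" "\<And>s. t < s \<Longrightarrow> s < b \<Longrightarrow> ?y s \<in> - B"
      unfolding eventually_at_right_field by blast
    have "Inf Z < b" using b(1) by (simp add: t_def)
    then obtain q where q: "q \<in> Z" "q < b" using cInf_lessD[OF ne] by blast
    then obtain m n where mn: "q = real n / 2 ^ m" "?y q \<notin> G" by (auto simp: Z_def)
    obtain k i where ki: "m \<le> k" "\<omega> \<in> grid_exit x G B k i" using fr'[of m] by blast
    let ?t = "real (Suc i) / 2 ^ k"
    have "?t \<le> q" by (rule first[OF ki(2) mn ki(1)])
    moreover have "t \<le> ?t" unfolding t_def by (rule cInf_lower[OF ZI[OF ki(2)] bd])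
    moreover have "?y ?t \<in> B" using ki(2) by (simp add: grid_exit_def)
    ultimately show False using b(2)[of ?t] nB q(2) by (cases "t = ?t") auto
  qed
  have "?y s \<in> closure G" if s: "0 \<le> s" "s < t" for s
  proof (rule ccontr)
    assume n: "?y s \<notin> closure G"
    have "(?y \<longlongrightarrow> ?y s) (at_right s)"
      using right_cont_path[OF w, of x] s unfolding right_cont_def by simp
    then have "eventually (\<lambda>u. ?y u \<in> - closure G) (at_right s)"
      by (rule topological_tendstoD) (use n in auto)
    moreover have "eventually (\<lambda>u. u < t) (at_right s)"
      unfolding eventually_at_right_field using s by blast
    ultimately have "eventually (\<lambda>u. ?y u \<in> - closure G \<and> u < t) (at_right s)" by (rule eventually_conj)
    then have "eventually (\<lambda>k. ?y (dyc k s) \<in> - closure G \<and> dyc k s < t) sequentially"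
      by (rule eventually_compose_filterlim[OF _ filterlim_dyc])
    then obtain k where k: "?y (dyc k s) \<notin> closure G" "dyc k s < t"
      unfolding eventually_sequentially by blast
    have "?y (dyc k s) \<notin> G" using k(1) closure_subset by blast
    then have "dyc k s \<in> Z" unfolding Z_def using dyc_eq[OF s(1), of k] by blast
    then have "t \<le> dyc k s" unfolding t_def by (rule cInf_lower[OF _ bd])
    then show False using k(2) by simp
  qed
  then show ?thesis using t0 yB by blast
qed

lemma grid_union_measurable:
  "G \<in> sets borel \<Longrightarrow> B \<in> sets borel \<Longrightarrow> (\<Union>i. grid_exit x G B k i) \<in> sets M"
  using grid_exit_measurable by (intro sets.countable_UN) auto

text \<open>Exits of the path into an open set are seen by all fine grids, so the grid bound passes
  to the limit. The radius drops from \<open>r\<close> to \<open>r'\<close> because step densities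
  are compared with \<open>j\<close> only after a shift of the radius.\<close>

lemma exit_upper:
  assumes G: "open G" "G \<subseteq> ball x L" and x: "x \<in> G" and B: "open B" "bounded B"
    and r: "0 < r'" "r' < r" "\<And>u v. u \<in> G \<Longrightarrow> v \<in> B \<Longrightarrow> r \<le> dist u v"
    and T: "0 \<le> T" "eventually (\<lambda>k. \<Theta> L k \<le> ennreal T) sequentially"
  shows "exit_prob M X x G B \<le> T * j r' * measure lborel B"
proof -
  have "bounded G" using G(2) bounded_ball bounded_subset by blast
  then have "- G \<noteq> {}" by (metis Compl_empty_eq double_compl not_bounded_UNIV)
  note Gn = G(1) this
  have Bs: "B \<in> sets borel" and Gs: "G \<in> sets borel" using B G by auto
  define V where "V = measure lborel B"
  have V0: "0 \<le> V" by (simp add: V_def)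
  have rp: "0 < r" using r by simp
  let ?Z = "{\<omega> \<in> space M. raw_exit G B (x, fut 0 \<omega>)}"
  let ?E = "\<lambda>k. \<Union>i. grid_exit x G B k i"
  have ae: "AE \<omega> in M. \<omega> \<in> ?Z \<longrightarrow> eventually (\<lambda>k. \<omega> \<in> ?E k) sequentially"
    using AE_not_raw_exit[OF Gn, of x]
  proof (rule AE_mp, intro AE_I2 impI)
    fix \<omega> assume w: "\<omega> \<in> space M" and reg: "\<not> raw_exit G G (x, fut 0 \<omega>)" and "\<omega> \<in> ?Z"
    then obtain s where "exits (\<lambda>q. x + Y q \<omega>) G s" "x + Y s \<omega> \<in> B"
      using raw_exit_regular(1)[OF w order_refl G(1), of x B] by auto
    then show "eventually (\<lambda>k. \<omega> \<in> ?E k) sequentially"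
      by (rule exits_imp_grid_exit[OF w x _ B(1)])
  qed
  have bound: "prob ?Z \<le> T * j r' * V + e * (1 + T * V)" if e: "0 < e" for e
  proof -
    have "eventually (\<lambda>k. prob ?Z - e \<le> prob (?E k)) sequentially"
      by (rule eventually_prob_ge[OF raw_exit_event[OF Bs] grid_union_measurable[OF Gs Bs] ae e])
    with T(2) dens_upper[OF r(1,2) e]
    have "eventually (\<lambda>k. prob ?Z \<le> T * j r' * V + e * (1 + T * V)) sequentially"
    proof eventually_elim
      fix k assume 1: "\<Theta> L k \<le> ennreal T" and 2: "2 ^ k * dens k r \<le> j r' + e" and 3: "prob ?Z - e \<le> prob (?E k)"
      have d: "0 \<le> 2 ^ k * dens k r" using dens_nonneg[OF rp] by simp
      have "emeasure M (?E k) \<le> \<Theta> L k * ennreal (2 ^ k * dens k r) * emeasure lborel B"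
        by (rule grid_exit_upper[OF Gs G(2) Bs rp r(3)])
      also have "\<dots> \<le> ennreal T * ennreal (j r' + e) * ennreal V"
        using 1 2 emeasure_lborel_bounded[OF B(2)] by (intro mult_mono ennreal_leI) (auto simp: V_def)
      also have "\<dots> = ennreal (T * (j r' + e) * V)"
        using T(1) V0 j_nonneg[OF r(1)] e by (simp add: ennreal_mult)
      finally have "prob (?E k) \<le> T * (j r' + e) * V"
        using T(1) V0 j_nonneg[OF r(1)] e by (simp add: emeasure_eq_measure)
      then show "prob ?Z \<le> T * j r' * V + e * (1 + T * V)" using 3 by (simp add: algebra_simps)
    qed
    then show ?thesis by (auto dest: eventually_happens)
  qed
  have "prob ?Z \<le> T * j r' * V"
  proof (rule field_le_epsilon)
    fix e :: real assume e: "0 < e"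
    have c: "0 < 1 + T * V" using T(1) V0 by (simp add: add_pos_nonneg)
    then show "prob ?Z \<le> T * j r' * V + e" using bound[of "e / (1 + T * V)"] e by simp
  qed
  then show ?thesis unfolding exit_prob_raw[OF Gn Bs] V_def .
qed

text \<open>A path with grid exits on infinitely many grids hits \<open>B\<close> after staying in
  the closed ball; \<open>Z\<close> stands for any event containing such paths. A bound on
  \<open>\<Theta>\<close> for infinitely many \<open>k\<close> suffices, since the other estimates
  hold eventually.\<close>

lemma exit_lower:
  assumes B: "compact B" "B \<inter> ball x L = {}"
    and r: "0 < r" "r < r'" "\<And>u v. u \<in> ball x L \<Longrightarrow> v \<in> B \<Longrightarrow> dist u v \<le> r"
    and T: "0 \<le> T" "frequently (\<lambda>k. ennreal T \<le> \<Theta> L k) sequentially"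
    and Z: "Z \<in> sets M" "\<And>\<omega> t. \<omega> \<in> space M \<Longrightarrow> 0 \<le> t \<Longrightarrow> x + Y t \<omega> \<in> B \<Longrightarrow>
      (\<And>s. 0 \<le> s \<Longrightarrow> s < t \<Longrightarrow> x + Y s \<omega> \<in> cball x L) \<Longrightarrow> \<omega> \<in> Z"
  shows "T * j r' * measure lborel B \<le> prob Z"
proof -
  have cl: "closed B" and bd: "bounded B" using B by (auto intro: compact_imp_closed compact_imp_bounded)
  have Bs: "B \<in> sets borel" and Gs: "ball x L \<in> sets borel" using cl by auto
  define V where "V = measure lborel B"
  have V0: "0 \<le> V" by (simp add: V_def)
  have rp: "0 < r'" using r by simp
  let ?E = "\<lambda>k. \<Union>i. grid_exit x (ball x L) B k i"
  have E: "?E k \<in> sets M" for k by (rule grid_union_measurable[OF Gs Bs])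
  have ae: "AE \<omega> in M. \<omega> \<in> space M - Z \<longrightarrow> eventually (\<lambda>k. \<omega> \<in> space M - ?E k) sequentially"
  proof (intro AE_I2 impI)
    fix \<omega> assume w: "\<omega> \<in> space M" and nZ: "\<omega> \<in> space M - Z"
    show "eventually (\<lambda>k. \<omega> \<in> space M - ?E k) sequentially"
    proof (rule ccontr)
      assume "\<not> ?thesis"
      then have "frequently (\<lambda>k. \<omega> \<in> ?E k) sequentially"
        unfolding frequently_def using w by simp
      from frequently_grid_exit[OF w cl B(2) this]
      obtain t where t: "t \<ge> 0" "x + Y t \<omega> \<in> B" "\<And>s. 0 \<le> s \<Longrightarrow> s < t \<Longrightarrow> x + Y s \<omega> \<in> closure (ball x L)" by blast
      have "closure (ball x L) \<subseteq> cball x L" by (rule closure_minimal) auto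
      then have "\<omega> \<in> Z" using t by (intro Z(2)[OF w t(1,2)]) blast
      then show False using nZ by simp
    qed
  qed
  have bound: "T * j r' * V \<le> prob Z + e * (1 + T * V)" if e: "0 < e" for e
  proof -
    have "eventually (\<lambda>k. prob (space M - Z) - e \<le> prob (space M - ?E k)) sequentially"
      by (rule eventually_prob_ge[OF sets.Diff[OF sets.top Z(1)] sets.Diff[OF sets.top E] ae e])
    then have "eventually (\<lambda>k. prob (?E k) \<le> prob Z + e \<and> j r' - e \<le> 2 ^ k * dens k r) sequentially"
      using dens_lower[OF r(1,2) e]
    proof eventually_elim
      fix k assume 1: "prob (space M - Z) - e \<le> prob (space M - ?E k)" and 2: "j r' - e \<le> 2 ^ k * dens k r"
      show "prob (?E k) \<le> prob Z + e \<and> j r' - e \<le> 2 ^ k * dens k r"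
        using 1 2 unfolding prob_compl[OF Z(1)] prob_compl[OF E] by linarith
    qed
    then obtain k where k: "ennreal T \<le> \<Theta> L k" "prob (?E k) \<le> prob Z + e" "j r' - e \<le> 2 ^ k * dens k r"
      using frequently_ex[OF frequently_eventually_conj[OF T(2)]] by blast
    have d: "0 \<le> 2 ^ k * dens k r" using dens_nonneg[OF r(1)] by simp
    have "ennreal (T * (2 ^ k * dens k r) * V) = ennreal T * ennreal (2 ^ k * dens k r) * ennreal V"
      using T(1) d V0 by (simp add: ennreal_mult del: ennreal_numeral)
    also have "\<dots> \<le> \<Theta> L k * ennreal (2 ^ k * dens k r) * emeasure lborel B"
      using k(1) emeasure_lborel_bounded[OF bd] by (intro mult_mono) (auto simp: V_def)
    also have "\<dots> \<le> emeasure M (?E k)" by (rule grid_exit_lower[OF Bs B(2) r(1,3)])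
    finally have "T * (2 ^ k * dens k r) * V \<le> prob (?E k)" by (simp add: emeasure_eq_measure)
    moreover have "T * (j r' - e) * V \<le> T * (2 ^ k * dens k r) * V"
      using k(3) T(1) V0 by (intro mult_right_mono mult_left_mono) auto
    ultimately have "T * (j r' - e) * V \<le> prob Z + e" using k(2) by linarith
    then show ?thesis by (simp add: algebra_simps)
  qed
  have "T * j r' * V \<le> prob Z"
  proof (rule field_le_epsilon)
    fix e :: real assume e: "0 < e"
    have c: "0 < 1 + T * V" using T(1) V0 by (simp add: add_pos_nonneg)
    then show "T * j r' * V \<le> prob Z + e" using bound[of "e / (1 + T * V)"] e by simp
  qed
  then show ?thesis by (simp add: V_def)
qed

text \<open>With probability above 1/2 the path stays within L/2 until some fixed time
  \<open>s > 0\<close>. At least s 2^k grid points come before \<open>s\<close>, and each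
  contributes at least 1/2 to the sum.\<close>

lemma \<Theta>_lower_bound:
  assumes L: "0 < L"
  shows "\<exists>c>0. \<forall>k. ennreal c \<le> \<Theta> L k"
proof -
  let ?V = "\<lambda>n. {w \<in> space W. \<exists>q\<in>{q \<in> \<rat>. 0 \<le> q \<and> q < inverse (real (Suc n))}. L / 2 < norm (w q)}"
  have "eventually (\<lambda>n. emeasure PW (?V n) < ennreal (1 / 2)) sequentially"
  proof (rule order_tendstoD(2)[OF small_time_move])
    show "0 < L / 2" using L by simp
    show "0 < ennreal (1 / 2)" by (subst ennreal_less_zero_iff) simp
  qed
  then obtain n where n: "emeasure PW (?V n) < ennreal (1 / 2)"
    unfolding eventually_sequentially by blast
  define s where "s = inverse (real (Suc n))"
  have s: "0 < s" by (simp add: s_def)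
  let ?A = "{\<omega> \<in> space M. \<exists>q\<in>{q \<in> \<rat>. 0 \<le> q \<and> q < s}. L / 2 < norm (fut 0 \<omega> q)}"
  have A: "?A \<in> sets M"
  proof -
    have "fut 0 -` ?V n \<inter> space M \<in> sets M"
      by (rule measurable_sets[OF fut_measurable[OF order_refl] large_move_pred[unfolded pred_def]])
    moreover have "fut 0 -` ?V n \<inter> space M = ?A"
      using measurable_space[OF fut_measurable[of 0]] by (auto simp: s_def)
    ultimately show ?thesis by simp
  qed
  have "emeasure M ?A < ennreal (1 / 2)" using n unfolding prob_fut0[OF large_move_pred] s_def .
  then have pA: "prob ?A < 1 / 2" by (simp only: emeasure_eq_measure ennreal_less_iff[OF measure_nonneg])
  have st: "ennreal (1 / 2) \<le> emeasure M (stay 0 (ball 0 L) k i)" if "real i / 2 ^ k < s" for k i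
  proof -
    have "space M - ?A \<subseteq> stay 0 (ball 0 L) k i"
    proof
      fix \<omega> assume w: "\<omega> \<in> space M - ?A"
      have "0 + Y (real l / 2 ^ k) \<omega> \<in> ball 0 L" if "l \<le> i" for l
      proof -
        let ?q = "real l / 2 ^ k"
        have "?q \<le> real i / 2 ^ k" using that by (simp add: divide_right_mono)
        then have "?q \<in> {q \<in> \<rat>. 0 \<le> q \<and> q < s}" using \<open>real i / 2 ^ k < s\<close> by auto
        then have "\<not> L / 2 < norm (fut 0 \<omega> ?q)" using w by blast
        then have "norm (Y ?q \<omega>) \<le> L / 2" by (simp add: fut_def)
        then show ?thesis using L by simp
      qed
      then show "\<omega> \<in> stay 0 (ball 0 L) k i" using w unfolding stay_def by blast
    qed
    then have "prob (space M - ?A) \<le> prob (stay 0 (ball 0 L) k i)"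
      by (rule finite_measure_mono) (rule stay_measurable, simp)
    moreover have "1 / 2 \<le> prob (space M - ?A)" using pA prob_compl[OF A] by simp
    ultimately have "1 / 2 \<le> prob (stay 0 (ball 0 L) k i)" by linarith
    then show ?thesis unfolding emeasure_eq_measure by (rule ennreal_leI)
  qed
  have "ennreal (s / 2) \<le> \<Theta> L k" for k
  proof -
    define m where "m = nat \<lceil>s * 2 ^ k\<rceil>"
    have m: "s * 2 ^ k \<le> real m" "\<And>i. i < m \<Longrightarrow> real i < s * 2 ^ k"
      unfolding m_def by linarith+
    have "ennreal (s / 2) \<le> ennreal (real m * (1 / 2) * (1 / 2 ^ k))"
      using m(1) by (intro ennreal_leI) (simp add: field_simps)
    also have "\<dots> = ennreal (real m * (1 / 2)) * ennreal (1 / 2 ^ k)"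
      by (rule ennreal_mult) simp_all
    also have "ennreal (real m * (1 / 2)) = (\<Sum>i<m. ennreal (1 / 2))"
    proof -
      have "(\<Sum>i<m. ennreal (1 / 2)) = ennreal (\<Sum>i<m. 1 / 2)" by (rule sum_ennreal) simp
      moreover have "(\<Sum>i<m. 1 / 2 :: real) = real m * (1 / 2)" by simp
      ultimately show ?thesis by (simp only:)
    qed
    also have "(\<Sum>i<m. ennreal (1 / 2)) * ennreal (1 / 2 ^ k) \<le> (\<Sum>i<m. emeasure M (stay 0 (ball 0 L) k i)) * ennreal (1 / 2 ^ k)"
      using m(2) by (intro mult_right_mono sum_mono st) (auto simp: field_simps)
    also have "\<dots> \<le> \<Theta> L k"
      unfolding \<Theta>_def by (intro mult_right_mono sum_le_suminf) auto
    finally show ?thesis .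
  qed
  then show ?thesis using s by (intro exI[of _ "s / 2"]) simp
qed

text \<open>
  A surrogate \<open>T\<close> for the mean exit time from a ball of radius \<open>L\<close>. Mean exit times along the dyadic
  grids need not converge to the true one (the path may leave the open ball and return between grid
  points), but only their size up to a factor matters.
\<close>

lemma exit_time_scale:
  fixes B :: "'a set"
  assumes L: "0 < L" and B: "compact B" "B \<inter> ball x L = {}" "0 < measure lborel B"
    and r: "0 < r" "r < r'" "\<And>u v. u \<in> ball x L \<Longrightarrow> v \<in> B \<Longrightarrow> dist u v \<le> r" and j: "0 < j r'"
  obtains T where "0 < T" "eventually (\<lambda>k. \<Theta> L k \<le> ennreal (2 * T)) sequentially"
    "frequently (\<lambda>k. ennreal (T / 2) \<le> \<Theta> L k) sequentially"
proof -
  define S where "S = limsup (\<Theta> L)"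
  obtain c where c: "0 < c" "\<And>k. ennreal c \<le> \<Theta> L k" using \<Theta>_lower_bound[OF L] by blast
  have "ennreal c \<le> S"
    unfolding S_def by (rule le_Limsup) (use c in auto)
  then have S0: "0 < S" using c(1) by (metis ennreal_eq_0_iff less_le_trans not_le zero_less_iff_neq_zero)
  have Sfin: "S < top"
  proof (rule ccontr)
    assume "\<not> S < top"
    then have St: "S = top" using top.not_eq_extremum by blast
    \<comment> \<open>Chosen so that the lower estimate would yield an event of probability 2;
      positivity of \<open>j r'\<close> is what keeps the mean exit time finite.\<close>
    define \<tau> where "\<tau> = 2 / (j r' * measure lborel B)"
    have \<tau>: "0 \<le> \<tau>" using j B(3) by (simp add: \<tau>_def)
    have "ennreal \<tau> < limsup (\<Theta> L)" using St unfolding S_def by simp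
    then have "frequently (\<lambda>k. ennreal \<tau> < \<Theta> L k) sequentially" by (rule frequently_gt_limsup)
    then have fr: "frequently (\<lambda>k. ennreal \<tau> \<le> \<Theta> L k) sequentially" by (rule frequently_elim1) simp
    have "\<tau> * j r' * measure lborel B \<le> prob (space M)"
      by (rule exit_lower[OF B(1,2) r \<tau> fr sets.top])
    then show False using j B(3) prob_space by (simp add: \<tau>_def)
  qed
  define T where "T = enn2real S"
  have ST: "S = ennreal T" using Sfin by (simp add: T_def)
  have T: "0 < T" using S0 unfolding ST by simp
  show ?thesis
  proof (rule that[OF T])
    have "limsup (\<Theta> L) < ennreal (2 * T)" using T ST unfolding S_def by (simp add: ennreal_less_iff)
    then have "eventually (\<lambda>k. \<Theta> L k < ennreal (2 * T)) sequentially" by (rule Limsup_lessD)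
    then show "eventually (\<lambda>k. \<Theta> L k \<le> ennreal (2 * T)) sequentially" by (rule eventually_mono) simp
    have "ennreal (T / 2) < limsup (\<Theta> L)" using T ST unfolding S_def by (simp add: ennreal_less_iff)
    then have "frequently (\<lambda>k. ennreal (T / 2) < \<Theta> L k) sequentially" by (rule frequently_gt_limsup)
    then show "frequently (\<lambda>k. ennreal (T / 2) \<le> \<Theta> L k) sequentially" by (rule frequently_elim1) simp
  qed
qed

end

section \<open>Harnack chains\<close>

text \<open>
  Being comparable with a constant uniform over the family is an equivalence relation with open classes.
\<close>

lemma harnack_chain:
  fixes K :: "'a::metric_space set" and H :: "('a \<Rightarrow> real) \<Rightarrow> bool"
  assumes K: "compact K" "connected K" and r: "0 < r" and C: "0 \<le> C"
    and nonneg: "\<And>f u. H f \<Longrightarrow> u \<in> K \<Longrightarrow> 0 \<le> f u"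
    and step: "\<And>f u v. H f \<Longrightarrow> u \<in> K \<Longrightarrow> v \<in> K \<Longrightarrow> dist u v < r \<Longrightarrow> f u \<le> C * f v"
  shows "\<exists>N\<ge>0. \<forall>f u v. H f \<longrightarrow> u \<in> K \<longrightarrow> v \<in> K \<longrightarrow> f u \<le> N * f v"
proof -
  \<comment> \<open>The constant is quantified before \<open>f\<close>: it has to serve the whole
    family at once.\<close>
  define R where "R u v \<longleftrightarrow> (\<exists>N\<ge>0. \<forall>f. H f \<longrightarrow> f u \<le> N * f v \<and> f v \<le> N * f u)" for u v
  have R: "R u v" if "u \<in> K" "v \<in> K" for u v
  proof (rule connected_equivalence_relation[OF K(2) that])
    show "R y x" if "R x y" for x y using that unfolding R_def by blast
    show "R x z" if "R x y" "R y z" for x y z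
    proof -
      from that(1)[unfolded R_def] obtain N where N: "0 \<le> N \<and> (\<forall>f. H f \<longrightarrow> f x \<le> N * f y \<and> f y \<le> N * f x)" ..
      from that(2)[unfolded R_def] obtain N' where N': "0 \<le> N' \<and> (\<forall>f. H f \<longrightarrow> f y \<le> N' * f z \<and> f z \<le> N' * f y)" ..
      have "f x \<le> (N * N') * f z \<and> f z \<le> (N * N') * f x" if "H f" for f
      proof
        have "f x \<le> N * f y" using N that by simp
        also have "\<dots> \<le> N * (N' * f z)" using N' that N by (intro mult_left_mono) simp_all
        finally show "f x \<le> (N * N') * f z" by (simp add: mult.assoc)
        have "f z \<le> N' * f y" using N' that by simp
        also have "\<dots> \<le> N' * (N * f x)" using N that N' by (intro mult_left_mono) simp_all
        finally show "f z \<le> (N * N') * f x" by (simp add: ac_simps)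
      qed
      then show ?thesis unfolding R_def using N N' by (intro exI[of _ "N * N'"]) simp
    qed
    show "\<exists>T. openin (top_of_set K) T \<and> a \<in> T \<and> (\<forall>x\<in>T. R a x)" if a: "a \<in> K" for a
    proof (intro exI[of _ "K \<inter> ball a r"] conjI ballI)
      show "openin (top_of_set K) (K \<inter> ball a r)" by (intro openin_open_Int) simp
      show "a \<in> K \<inter> ball a r" using a r by simp
      fix x assume x: "x \<in> K \<inter> ball a r"
      have "f a \<le> C * f x \<and> f x \<le> C * f a" if "H f" for f
        using step[OF that, of a x] step[OF that, of x a] a x by (simp add: dist_commute)
      then show "R a x" unfolding R_def using C by (intro exI[of _ C]) simp
    qed
  qed
  obtain P where P: "P \<subseteq> K" "finite P" "K \<subseteq> (\<Union>p\<in>P. ball p r)"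
    using compactE_image[OF K(1), of K "\<lambda>p. ball p r"] r by (metis (no_types, lifting) UN_I centre_in_ball open_ball subsetI)
  have "\<forall>p\<in>P. \<forall>q\<in>P. \<exists>N\<ge>0. \<forall>f. H f \<longrightarrow> f p \<le> N * f q"
  proof (intro ballI)
    fix p q assume "p \<in> P" "q \<in> P"
    then have "R p q" using R P(1) by blast
    from this[unfolded R_def] obtain N where N: "0 \<le> N \<and> (\<forall>f. H f \<longrightarrow> f p \<le> N * f q \<and> f q \<le> N * f p)" ..
    then show "\<exists>N\<ge>0. \<forall>f. H f \<longrightarrow> f p \<le> N * f q" by (intro exI[of _ N]) simp
  qed
  then obtain N where N: "\<And>p q. p \<in> P \<Longrightarrow> q \<in> P \<Longrightarrow> 0 \<le> N p q \<and> (\<forall>f. H f \<longrightarrow> f p \<le> N p q * f q)"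
    by metis
  \<comment> \<open>There are finitely many pairs of centres, so the sum is a common constant. The
    passage from \<open>u\<close> to \<open>v\<close> goes through centres near them and costs two
    further factors \<open>C\<close>.\<close>
  define N' where "N' = (\<Sum>p\<in>P. \<Sum>q\<in>P. N p q)"
  have N'0: "0 \<le> N'" unfolding N'_def using N by (intro sum_nonneg) auto
  have NN': "N p q \<le> N'" if "p \<in> P" "q \<in> P" for p q
  proof -
    have "N p q \<le> (\<Sum>q\<in>P. N p q)" using N that P(2) by (intro member_le_sum) auto
    also have "\<dots> \<le> N'" unfolding N'_def using N that P(2) by (intro member_le_sum[of p P "\<lambda>p. \<Sum>q\<in>P. N p q"] sum_nonneg) auto
    finally show ?thesis .
  qed
  have "f u \<le> (C * N' * C) * f v" if f: "H f" and u: "u \<in> K" and v: "v \<in> K" for f u v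
  proof -
    obtain p where p: "p \<in> P" "dist u p < r" using P(3) u by (auto simp: dist_commute)
    obtain q where q: "q \<in> P" "dist q v < r" using P(3) v by auto
    have "f u \<le> C * f p" using step[OF f u _ p(2)] p(1) P(1) by blast
    also have "f p \<le> N p q * f q" using N[OF p(1) q(1)] f by blast
    also have "N p q * f q \<le> N' * f q" using NN'[OF p(1) q(1)] nonneg[OF f] q(1) P(1) by (intro mult_right_mono) auto
    also have "f q \<le> C * f v" using step[OF f _ v q(2)] q(1) P(1) by blast
    finally show ?thesis using C N'0 by (simp add: mult_left_mono mult.assoc)
  qed
  then show ?thesis using C N'0 by (intro exI[of _ "C * N' * C"]) simp
qed

lemma norm_eq_abs_inner_if_DIM_1:
  fixes w e :: "'a::euclidean_space"
  assumes "DIM('a) = 1" "e \<in> Basis"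
  shows "norm w = \<bar>w \<bullet> e\<bar>"
proof -
  have B: "(Basis :: 'a set) = {e}" using assms by (metis card_1_singletonE singletonD)
  have "w = (\<Sum>b\<in>Basis. (w \<bullet> b) *\<^sub>R b)" by (rule euclidean_representation[symmetric])
  then have "w = (w \<bullet> e) *\<^sub>R e" unfolding B by simp
  then have "norm w = norm ((w \<bullet> e) *\<^sub>R e)" by simp
  then show ?thesis using assms(2) by simp
qed

text \<open>In dimension one the annulus is disconnected, and one of its two components is used instead.\<close>

definition annulus :: "'a::euclidean_space \<Rightarrow> real \<Rightarrow> real \<Rightarrow> 'a set" where
  "annulus e r s = {w. r \<le> norm w \<and> norm w \<le> s \<and> (DIM('a) = 1 \<longrightarrow> 0 < w \<bullet> e)}"

definition open_annulus :: "'a::euclidean_space \<Rightarrow> real \<Rightarrow> real \<Rightarrow> 'a set" where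
  "open_annulus e r s = {w. r < norm w \<and> norm w < s \<and> (DIM('a) = 1 \<longrightarrow> 0 < w \<bullet> e)}"

lemma open_open_annulus: "open (open_annulus e r s)"
  unfolding open_annulus_def
  by (intro open_Collect_conj open_Collect_less open_Collect_imp closed_Collect_const open_Collect_const continuous_intros)

lemma compact_connected_annulus:
  fixes e :: "'a::euclidean_space"
  assumes e: "e \<in> Basis" and r: "0 < r"
  shows "compact (annulus e r s)" "connected (annulus e r s)"
proof -
  have "compact (annulus e r s) \<and> connected (annulus e r s)"
  proof (cases "DIM('a) = 1")
    case True
    have "annulus e r s = (\<lambda>t. t *\<^sub>R e) ` {r..s}"
    proof (rule set_eqI, rule iffI)
      fix w assume w: "w \<in> annulus e r s"
      have B: "(Basis :: 'a set) = {e}" using True e by (metis card_1_singletonE singletonD)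
      have "w = (\<Sum>b\<in>Basis. (w \<bullet> b) *\<^sub>R b)" by (rule euclidean_representation[symmetric])
      then have we: "w = (w \<bullet> e) *\<^sub>R e" unfolding B by simp
      moreover have "w \<bullet> e \<in> {r..s}"
        using w True norm_eq_abs_inner_if_DIM_1[OF True e, of w] by (auto simp: annulus_def)
      ultimately show "w \<in> (\<lambda>t. t *\<^sub>R e) ` {r..s}" by blast
    next
      fix w assume "w \<in> (\<lambda>t. t *\<^sub>R e) ` {r..s}"
      then show "w \<in> annulus e r s" using r e by (auto simp: annulus_def inner_Basis)
    qed
    then show ?thesis
      by (auto intro!: compact_continuous_image connected_continuous_image continuous_intros)
  next
    case False
    then have D: "2 \<le> DIM('a)" using DIM_positive[where 'a='a] by linarith
    have eq: "annulus e r s = {w. r \<le> norm w \<and> norm w \<le> s}" using False by (simp add: annulus_def)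
    have "connected {w :: 'a. r \<le> norm w \<and> norm w \<le> s}" using connected_annulus(4)[OF D, of r 0 s] by simp
    moreover have "closed {w :: 'a. r \<le> norm w \<and> norm w \<le> s}"
      by (intro closed_Collect_conj closed_Collect_le continuous_intros)
    moreover have "bounded {w :: 'a. r \<le> norm w \<and> norm w \<le> s}" by (rule boundedI[of _ s]) auto
    ultimately show ?thesis unfolding eq by (simp add: compact_eq_bounded_closed)
  qed
  then show "compact (annulus e r s)" "connected (annulus e r s)" by auto
qed

lemma ball_subset_open_annulus:
  fixes e :: "'a::euclidean_space"
  assumes e: "e \<in> Basis" and w: "w \<in> annulus e r s" and d: "d \<le> r - r'" "d \<le> s' - s" "0 \<le> r'"
  shows "ball w d \<subseteq> open_annulus e r' s'"
proof
  fix v assume "v \<in> ball w d"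
  then have v: "norm (w - v) < d" by (simp add: dist_norm)
  have "norm w \<le> norm v + norm (w - v)" by (rule norm_triangle_sub)
  moreover have "norm v \<le> norm w + norm (w - v)" by (metis norm_minus_commute norm_triangle_sub)
  moreover have "0 < v \<bullet> e" if D: "DIM('a) = 1"
  proof -
    have "w \<bullet> e = norm w" using w D norm_eq_abs_inner_if_DIM_1[OF D e, of w] by (simp add: annulus_def)
    moreover have "\<bar>(w - v) \<bullet> e\<bar> \<le> norm (w - v)" using Basis_le_norm[OF e] by blast
    ultimately have "norm w - norm (w - v) \<le> v \<bullet> e" by (simp add: inner_diff_left)
    then show ?thesis using v d w by (simp add: annulus_def)
  qed
  ultimately show "v \<in> open_annulus e r' s'" using v d w by (simp add: open_annulus_def annulus_def)
qed

section \<open>Comparison and translation of exit probabilities\<close>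

context levy
begin

lemma started_at_eq: "started_at x X \<omega> = (\<lambda>t. x + Y t \<omega>)"
  by (simp add: started_at_def Y_def fun_eq_iff)

lemma exit_prob_outside:
  assumes "x \<notin> U"
  shows "exit_prob M X x U A = indicator A x"
proof -
  have "exits (started_at x X \<omega>) U 0" for \<omega> using assms by (auto simp: exits_def started_at_eq)
  from exit_time_exits[OF this]
  have "{\<omega> \<in> space M. exit_time (started_at x X \<omega>) U < \<infinity> \<and> exit_point (started_at x X \<omega>) U \<in> A} =
      (if x \<in> A then space M else {})"
    by (auto simp: started_at_eq)
  then show ?thesis unfolding exit_prob_def by (simp add: prob_space)
qed

lemma exit_prob_mono:
  assumes U: "open U" "- U \<noteq> {}" and U': "open U'" "- U' \<noteq> {}" and A: "A \<in> sets borel" "A' \<in> sets borel"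
    and imp: "\<And>y t. right_cont y \<Longrightarrow> y 0 = x \<Longrightarrow> exits y U t \<Longrightarrow> y t \<in> A \<Longrightarrow> exits y U' t \<and> y t \<in> A'"
  shows "exit_prob M X x U A \<le> exit_prob M X x U' A'"
  unfolding exit_prob_raw[OF U A(1)] exit_prob_raw[OF U' A(2)]
proof (rule finite_measure_mono_AE)
  show "AE \<omega> in M. \<omega> \<in> {\<omega> \<in> space M. raw_exit U A (x, fut 0 \<omega>)} \<longrightarrow> \<omega> \<in> {\<omega> \<in> space M. raw_exit U' A' (x, fut 0 \<omega>)}"
    using AE_not_raw_exit[OF U, of x] AE_not_raw_exit[OF U', of x] AE_space
  proof eventually_elim
    fix \<omega> assume reg: "\<not> raw_exit U U (x, fut 0 \<omega>)" "\<not> raw_exit U' U' (x, fut 0 \<omega>)" and w: "\<omega> \<in> space M"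
    show "\<omega> \<in> {\<omega> \<in> space M. raw_exit U A (x, fut 0 \<omega>)} \<longrightarrow> \<omega> \<in> {\<omega> \<in> space M. raw_exit U' A' (x, fut 0 \<omega>)}"
    proof
      assume "\<omega> \<in> {\<omega> \<in> space M. raw_exit U A (x, fut 0 \<omega>)}"
      then obtain s where s: "exits (\<lambda>q. x + Y q \<omega>) U s" "x + Y s \<omega> \<in> A"
        using raw_exit_regular(1)[OF w order_refl U(1), of x A] reg(1) by auto
      have "exits (\<lambda>q. x + Y q \<omega>) U' s \<and> x + Y s \<omega> \<in> A'"
        by (rule imp[OF right_cont_path[OF w] _ s]) simp
      then show "\<omega> \<in> {\<omega> \<in> space M. raw_exit U' A' (x, fut 0 \<omega>)}"
        using raw_exit_regular(1)[OF w order_refl U'(1), of x A'] reg(2) w by auto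
    qed
  qed
qed (rule raw_exit_event[OF A(2)])

lemma exit_prob_translate: "exit_prob M X (x + z) (ball x L) (ball x L') = exit_prob M X z (ball 0 L) (ball 0 L')"
proof -
  have "exits (started_at (x + z) X \<omega>) (ball x L) t \<longleftrightarrow> exits (started_at z X \<omega>) (ball 0 L) t" for \<omega> t
    by (simp add: exits_def started_at_eq dist_norm algebra_simps)
  then have e: "{t. 0 \<le> t \<and> started_at (x + z) X \<omega> t \<notin> ball x L} = {t. 0 \<le> t \<and> started_at z X \<omega> t \<notin> ball 0 L}" for \<omega>
    by (auto simp: started_at_eq dist_norm algebra_simps)
  have et: "exit_time (started_at (x + z) X \<omega>) (ball x L) = exit_time (started_at z X \<omega>) (ball 0 L)" for \<omega>
    unfolding exit_time_def e ..
  have "exit_point (started_at (x + z) X \<omega>) (ball x L) \<in> ball x L' \<longleftrightarrow> exit_point (started_at z X \<omega>) (ball 0 L) \<in> ball 0 L'" for \<omega>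
    unfolding exit_point_def et by (simp add: started_at_eq dist_norm algebra_simps)
  then show ?thesis unfolding exit_prob_def et by simp
qed

end

context unimodal_levy
begin

text \<open>\<open>exit_lower\<close> needs an event containing every suitable path, whereas
  \<open>raw_exit\<close> recognises exits of regular paths only; the irregular paths are added to
  the event at no cost in probability.\<close>

lemma exit_prob_lower:
  assumes B: "compact B" "B \<inter> ball x L = {}"
    and r: "0 < r" "r < r'" "\<And>u v. u \<in> ball x L \<Longrightarrow> v \<in> B \<Longrightarrow> dist u v \<le> r"
    and T: "0 \<le> T" "frequently (\<lambda>k. ennreal T \<le> \<Theta> L k) sequentially"
    and U: "open U" "- U \<noteq> {}" and A: "A \<in> sets borel"
    and ex: "\<And>y t. right_cont y \<Longrightarrow> 0 \<le> t \<Longrightarrow> y t \<in> B \<Longrightarrow> (\<And>s. 0 \<le> s \<Longrightarrow> s < t \<Longrightarrow> y s \<in> cball x L) \<Longrightarrow>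
      \<exists>s. exits y U s \<and> y s \<in> A"
  shows "T * j r' * measure lborel B \<le> exit_prob M X x U A"
proof -
  define Z where "Z = {\<omega> \<in> space M. raw_exit U A (x, fut 0 \<omega>)} \<union> {\<omega> \<in> space M. raw_exit U U (x, fut 0 \<omega>)}"
  have ev: "{\<omega> \<in> space M. raw_exit U A (x, fut 0 \<omega>)} \<in> sets M" "{\<omega> \<in> space M. raw_exit U U (x, fut 0 \<omega>)} \<in> sets M"
    using U(1) A by (auto intro!: raw_exit_event)
  have "T * j r' * measure lborel B \<le> prob Z"
  proof (rule exit_lower[OF B r T])
    show "Z \<in> sets M" unfolding Z_def using ev by (rule sets.Un)
    fix \<omega> t assume w: "\<omega> \<in> space M" and t: "0 \<le> t" "x + Y t \<omega> \<in> B" "\<And>s. 0 \<le> s \<Longrightarrow> s < t \<Longrightarrow> x + Y s \<omega> \<in> cball x L"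
    have "\<exists>s. exits (\<lambda>q. x + Y q \<omega>) U s \<and> x + Y s \<omega> \<in> A" by (rule ex[OF right_cont_path[OF w] t])
    then show "\<omega> \<in> Z"
      using raw_exit_regular(1)[OF w order_refl U(1), of x A] w by (auto simp: Z_def)
  qed
  also have "prob Z = exit_prob M X x U A"
    unfolding exit_prob_raw[OF U A]
  proof (rule measure_eq_AE)
    show "AE \<omega> in M. \<omega> \<in> Z \<longleftrightarrow> \<omega> \<in> {\<omega> \<in> space M. raw_exit U A (x, fut 0 \<omega>)}"
      using AE_not_raw_exit[OF U, of x] by (rule AE_mp) (auto intro!: AE_I2 simp: Z_def)
  qed (use ev in \<open>auto simp: Z_def\<close>)
  finally show ?thesis .
qed

section \<open>Failure of the Harnack inequality\<close>

text \<open>The lower bound for \<open>h x\<close> and the upper bound for \<open>h\<close> far out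
  carry the same factor \<open>T\<close> and comparable volumes. The Harnack inequality links them,
  and smallness of \<open>\<epsilon>\<close> relative to 1/C lets the re-entry term be absorbed;
  what remains compares two values of \<open>j\<close>.\<close>

lemma harnack_implies_doubling:
  fixes e :: 'a
  defines "d \<equiv> DIM('a)"
  assumes e: "e \<in> Basis" and R: "0 < R" and \<alpha>: "0 < \<alpha>" "5 * \<alpha> < c" "c < 1" and jc: "0 < j (c * R)"
    and eps: "exit_prob M X 0 (ball 0 (\<alpha> * R)) (ball 0 (10 * R)) \<le> \<epsilon>" "\<epsilon> \<le> 1 / 2" "C * \<epsilon> \<le> 1 / 4" and C: "1 \<le> C"
    and harnack: "\<And>u v. u \<in> annulus e (3 * (\<alpha> * R)) (3 * R) \<Longrightarrow> v \<in> annulus e (3 * (\<alpha> * R)) (3 * R) \<Longrightarrow>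
      exit_prob M X u (open_annulus e (5 / 2 * (\<alpha> * R)) (4 * R)) (ball 0 (\<alpha> * R / 10)) \<le>
      C * exit_prob M X v (open_annulus e (5 / 2 * (\<alpha> * R)) (4 * R)) (ball 0 (\<alpha> * R / 10))"
  shows "j (c * R) \<le> 8 * C * (1 + 4 * 30 ^ d) * 2 ^ d * j R"
proof -
  define L where "L = \<alpha> * R"
  \<comment> \<open>Radii in units of \<open>L\<close>: 1/10 for the target, 5/2 for the inner edge
    of \<open>D\<close>, 3 for the region of the Harnack inequality, which thus keeps distance L/2
    from that edge.\<close>
  define D where "D = open_annulus e (5 / 2 * L) (4 * R)"
  define A where "A = (ball 0 (L / 10) :: 'a set)"
  define h where "h z = exit_prob M X z D A" for z
  have L: "0 < L" using \<alpha> R by (simp add: L_def)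
  have Lc: "5 * L < c * R" using \<alpha> R by (simp add: L_def)
  have cR: "c * R < R" using \<alpha> R by simp
  have L5: "5 * L < R" using Lc cR by linarith
  have e1: "norm e = 1" "e \<bullet> e = 1" using e by (auto simp: inner_same_Basis)
  have D: "open D" "- D \<noteq> {}"
  proof -
    show "open D" unfolding D_def by (rule open_open_annulus)
    have "0 \<notin> D" using L by (simp add: D_def open_annulus_def)
    then show "- D \<noteq> {}" by blast
  qed
  have A: "A \<in> sets borel" "open A" "bounded A" by (simp_all add: A_def)
  have Dn: "5 / 2 * L < norm w" "norm w < 4 * R" if "w \<in> D" for w
    using that by (auto simp: D_def open_annulus_def)
  have AD: "w \<notin> D" if "norm w \<le> L" for w using Dn(1)[of w] that L by auto
  have h01: "0 \<le> h z" "h z \<le> 1" for z unfolding h_def using exit_prob_le_1[OF D A(1)] by simp_all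
  have hout: "h w = indicator A w" if "w \<notin> D" for w unfolding h_def by (rule exit_prob_outside[OF that])

  have sum2: "(\<Sum>i\<in>{0, 1::nat}. F i) = F 0 + F 1" for F :: "nat \<Rightarrow> real" by simp
  have sum3: "(\<Sum>i\<in>{0, 1, 2::nat}. F i) = F 0 + F 1 + F 2" for F :: "nat \<Rightarrow> real" by simp

  define y where "y = (2 * R) *\<^sub>R e"
  \<comment> \<open>With 18/5 the ball of radius \<open>L\<close> about \<open>x\<close> occupies
    norms between 13/5 and 23/5 times \<open>L\<close>. It lies in \<open>D\<close>, and its points
    are within 93/20 times \<open>L\<close>, less than \<open>c * R\<close>, of a ball of radius
    L/20 about 0.\<close>
  define x where "x = (18 / 5 * L) *\<^sub>R e"
  have y: "norm y = 2 * R" "y \<in> D" "y \<in> annulus e (3 * L) (3 * R)"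
    using R L L5 e1 by (auto simp: y_def D_def open_annulus_def annulus_def)
  have x: "norm x = 18 / 5 * L" "x \<in> annulus e (3 * L) (3 * R)"
    using R L L5 e1 by (auto simp: x_def annulus_def)

  define U where "U = unit_ball_vol (real d)"
  have U: "0 < U" unfolding U_def by (rule unit_ball_vol_pos) simp
  have vol: "measure lborel (ball z r :: 'a set) = U * r ^ d" "measure lborel (cball z r :: 'a set) = U * r ^ d" if "0 \<le> r" for z r
    using that by (simp_all add: content_ball content_cball U_def d_def)
  define V where "V = U * (L / 10) ^ d"
  have V: "0 < V" using U L by (simp add: V_def)

  \<comment> \<open>A ball with the volume of \<open>A\<close>, placed just outside the ball of
    radius \<open>L\<close>. It is within 23/10 times \<open>L\<close> of points of that ball, while
    points of \<open>D\<close> are at least 12/5 times \<open>L\<close> away from \<open>A\<close>.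
    The intermediate radius 47/20 times \<open>L\<close> serves both, so control of jumps into
    \<open>S\<close> gives control of jumps into \<open>A\<close>.\<close>
  define S where "S = cball ((6 / 5 * L) *\<^sub>R e) (L / 10)"
  have Sn: "11 / 10 * L \<le> norm v" "norm v \<le> 13 / 10 * L" if "v \<in> S" for v
  proof -
    let ?s = "(6 / 5 * L) *\<^sub>R e"
    have "norm (?s - v) \<le> L / 10" using that by (simp add: S_def dist_norm)
    moreover have "norm ?s = 6 / 5 * L" using L e1 by simp
    moreover have "norm ?s \<le> norm v + norm (?s - v)" by (rule norm_triangle_sub)
    moreover have "norm v \<le> norm ?s + norm (?s - v)" by (metis norm_minus_commute norm_triangle_sub)
    ultimately show "11 / 10 * L \<le> norm v" "norm v \<le> 13 / 10 * L" by linarith+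
  qed
  have S: "compact S" "S \<inter> ball 0 L = {}" "measure lborel S = V"
  proof -
    show "compact S" by (simp add: S_def)
    show "S \<inter> ball 0 L = {}" using Sn(1) L by fastforce
    show "measure lborel S = V" unfolding S_def V_def using L by (intro vol) simp
  qed
  have Sd: "dist u v \<le> 23 / 10 * L" if "u \<in> ball 0 L" "v \<in> S" for u v
  proof -
    have "norm u < L" using that by simp
    moreover have "norm v \<le> 13 / 10 * L" by (rule Sn(2)[OF that(2)])
    moreover have "dist u v \<le> norm u + norm v" unfolding dist_norm by (rule norm_triangle_ineq4)
    ultimately show ?thesis by linarith
  qed
  have r1: "0 < 23 / 10 * L" "23 / 10 * L < 47 / 20 * L" "0 < 47 / 20 * L" using L by auto
  have "j (c * R) \<le> j (47 / 20 * L)" using Lc L by (intro j_antimono) auto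
  then have j1: "0 < j (47 / 20 * L)" using jc by linarith
  obtain T where T: "0 < T" "eventually (\<lambda>k. \<Theta> L k \<le> ennreal (2 * T)) sequentially"
    "frequently (\<lambda>k. ennreal (T / 2) \<le> \<Theta> L k) sequentially"
    by (rule exit_time_scale[OF L S(1,2) _ r1(1,2) Sd j1]) (use S(3) V in auto)
  have T2: "0 \<le> T / 2" "0 \<le> 2 * T" using T(1) by auto

  \<comment> \<open>A jump into \<open>S\<close> leaves the \<open>L\<close>-ball but not the ball
    of radius \<open>10 * R\<close>, so the small probability in the hypothesis bounds this
    product.\<close>
  have TS: "T / 2 * j (47 / 20 * L) * V \<le> \<epsilon>"
  proof -
    have "T / 2 * j (47 / 20 * L) * measure lborel S \<le> exit_prob M X 0 (ball 0 L) (ball 0 (10 * R))"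
    proof (rule exit_prob_lower[OF S(1,2) r1(1,2) Sd T2(1) T(3)])
      show "- ball (0::'a) L \<noteq> {}" by (metis Compl_empty_eq bounded_ball double_compl not_bounded_UNIV)
      fix p :: "real \<Rightarrow> 'a" and t
      assume p: "right_cont p" "0 \<le> t" "p t \<in> S" and bef: "\<And>s. 0 \<le> s \<Longrightarrow> s < t \<Longrightarrow> p s \<in> cball 0 L"
      have out: "p t \<notin> ball 0 L" using S(2) p(3) by blast
      obtain s where s: "exits p (ball 0 L) s" using exits_exists[OF p(1) open_ball p(2) out] by blast
      have "p s \<in> ball 0 (10 * R)"
      proof (cases "s < t")
        case True
        then have "p s \<in> cball 0 L" using bef s by (simp add: exits_def)
        then show ?thesis using L5 L by simp
      next
        case False
        moreover have "s \<le> t"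
        proof (rule ccontr)
          assume "\<not> s \<le> t"
          then have "p t \<in> ball 0 L" using s p(2) by (simp add: exits_def del: mem_ball)
          then show False using out by simp
        qed
        ultimately have "s = t" by simp
        then show ?thesis using Sn(2)[OF p(3)] L5 L by simp
      qed
      then show "\<exists>s. exits p (ball 0 L) s \<and> p s \<in> ball 0 (10 * R)" using s by blast
    qed simp_all
    then show ?thesis using eps(1) unfolding S(3) L_def[symmetric] by linarith
  qed

  define G where "G z = D \<inter> ball z L" for z
  have G: "open (G z)" "G z \<subseteq> D" "G z \<subseteq> ball z L" for z using D by (auto simp: G_def)
  have Gn: "- G z \<noteq> {}" for z using D(2) G(2)[of z] by blast
  have pB: "exit_prob M X z (G z) B \<le> 2 * T * j r' * measure lborel B"
    if "z \<in> D" "open B" "bounded B" "0 < r'" "r' < r" "\<And>u v. u \<in> G z \<Longrightarrow> v \<in> B \<Longrightarrow> r \<le> dist u v" for z B r' r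
    using that L by (intro exit_upper[OF G(1,3) _ _ _ _ _ _ T2(2) T(2)]) (auto simp: G_def)
  \<comment> \<open>\<open>D\<close> lies in the ball of radius \<open>4 * R\<close> about 0, so its
    points are within \<open>8 * R\<close> of \<open>z\<close>, inside the radius
    \<open>10 * R\<close> of the hypothesis.\<close>
  have pD: "exit_prob M X z (G z) D \<le> \<epsilon>" if z: "z \<in> D" for z
  proof -
    have "exit_prob M X z (G z) D \<le> exit_prob M X z (ball z L) (ball z (10 * R))"
    proof (rule exit_prob_mono[OF G(1) Gn])
      show "- ball z L \<noteq> {}" by (metis Compl_empty_eq bounded_ball double_compl not_bounded_UNIV)
      fix p t assume p: "right_cont p" "p 0 = z" "exits p (G z) t" "p t \<in> D"
      have "p t \<notin> ball z L" using p(3,4) by (auto simp: exits_def G_def)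
      then have "exits p (ball z L) t" using p(3) G(3)[of z] unfolding exits_def by blast
      moreover have "dist z (p t) \<le> norm z + norm (p t)" unfolding dist_norm by (rule norm_triangle_ineq4)
      ultimately show "exits p (ball z L) t \<and> p t \<in> ball z (10 * R)"
        using Dn(2)[OF z] Dn(2)[OF p(4)] R by simp
    qed (use D in simp_all)
    also have "\<dots> = exit_prob M X 0 (ball 0 L) (ball 0 (10 * R))"
      using exit_prob_translate[of z 0 L "10 * R"] by simp
    finally show ?thesis using eps(1) by (simp add: L_def)
  qed

  define \<sigma> where "\<sigma> = Sup (h ` D)"
  have h\<sigma>: "h z \<le> \<sigma>" if "z \<in> D" for z
    unfolding \<sigma>_def using that h01 by (intro cSUP_upper bdd_aboveI2[of _ _ 1]) auto
  have \<sigma>0: "0 \<le> \<sigma>" using h\<sigma>[OF y(2)] h01(1)[of y] by linarith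
  have volA: "measure lborel A = V" unfolding A_def V_def using L by (intro vol) simp
  \<comment> \<open>A self-improving bound: from \<open>z\<close> in \<open>D\<close> the target is
    reached on leaving \<open>G z\<close> or after re-entering \<open>D\<close>, and the re-entry
    term, at most half of \<open>\<sigma>\<close>, is absorbed on the left.\<close>
  have \<sigma>4: "\<sigma> \<le> 4"
  proof -
    have step: "h z \<le> 2 * T * j (47 / 20 * L) * V + \<sigma> * (1 / 2)" if z: "z \<in> D" for z
    proof -
      have "h z \<le> (\<Sum>i\<in>{0, 1::nat}. (if i = 0 then 1 else \<sigma>) * exit_prob M X z (G z) (if i = 0 then A else D))"
        unfolding h_def
      proof (rule exit_prob_bound[OF D A(1) G(1,2)])
        fix w assume "w \<notin> G z"
        show "exit_prob M X w D A \<le> (\<Sum>i\<in>{0, 1::nat}. (if i = 0 then 1 else \<sigma>) * indicator (if i = 0 then A else D) w)"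
          using h\<sigma>[of w] hout[of w] \<sigma>0 unfolding h_def sum2 by (cases "w \<in> D"; cases "w \<in> A") simp_all
      qed (use A D \<sigma>0 in auto)
      then have "h z \<le> exit_prob M X z (G z) A + \<sigma> * exit_prob M X z (G z) D" unfolding sum2 by simp
      also have "exit_prob M X z (G z) A \<le> 2 * T * j (47 / 20 * L) * V"
        unfolding volA[symmetric]
      proof (rule pB[OF z A(2,3) r1(3)])
        show "47 / 20 * L < 12 / 5 * L" using L by simp
        fix u v assume uv: "u \<in> G z" "v \<in> A"
        have "5 / 2 * L < norm u" using uv Dn(1) by (auto simp: G_def)
        moreover have "norm v < L / 10" using uv by (simp add: A_def)
        moreover have "norm u \<le> norm v + dist u v" unfolding dist_norm by (rule norm_triangle_sub)
        ultimately show "12 / 5 * L \<le> dist u v" by linarith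
      qed
      also have "\<sigma> * exit_prob M X z (G z) D \<le> \<sigma> * (1 / 2)"
        using pD[OF z] eps(2) \<sigma>0 by (intro mult_left_mono) linarith+
      finally show ?thesis by simp
    qed
    have "\<sigma> \<le> 2 * T * j (47 / 20 * L) * V + \<sigma> * (1 / 2)"
      using y(2) step by (subst \<sigma>_def) (intro cSUP_least, auto)
    also have "2 * T * J * V = 4 * (T / 2 * J * V)" for J by simp
    finally have "\<sigma> \<le> 4 * (T / 2 * j (47 / 20 * L) * V) + \<sigma> * (1 / 2)" .
    also have "\<dots> \<le> 4 * \<epsilon> + \<sigma> * (1 / 2)"
      using TS by (intro add_right_mono mult_left_mono) simp_all
    finally show ?thesis using eps(2) by simp
  qed

  define Far where "Far = {z \<in> D. 2 * R \<le> norm z}"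
  define \<mu> where "\<mu> = Sup (h ` Far)"
  have yF: "y \<in> Far" using y by (simp add: Far_def)
  have h\<mu>: "h z \<le> \<mu>" if "z \<in> Far" for z
    unfolding \<mu>_def using that h01 by (intro cSUP_upper bdd_aboveI2[of _ _ 1]) auto
  have \<mu>0: "0 \<le> \<mu>" using h\<mu>[OF yF] h01(1)[of y] by linarith
  have C\<mu>: "0 \<le> C * \<mu>" using C \<mu>0 by simp
  have hK: "h u \<le> C * h v" if "u \<in> annulus e (3 * L) (3 * R)" "v \<in> annulus e (3 * L) (3 * R)" for u v
    using harnack that unfolding h_def D_def A_def L_def .
  define N where "N = (ball 0 (3 * L) :: 'a set)"
  have volN: "measure lborel N = 30 ^ d * V"
  proof -
    have "measure lborel N = U * (3 * L) ^ d" unfolding N_def using L by (intro vol) simp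
    also have "3 * L = 30 * (L / 10)" by simp
    finally show ?thesis unfolding V_def power_mult_distrib by simp
  qed
  \<comment> \<open>Between \<open>N\<close> and \<open>Far\<close> the Harnack inequality compares
    with \<open>y\<close>, which itself belongs to \<open>Far\<close>.\<close>
  have away: "h w \<le> C * \<mu>" if w: "w \<in> D" "w \<notin> N" for w
  proof (cases "w \<in> Far")
    case True
    have "1 * \<mu> \<le> C * \<mu>" using C \<mu>0 by (intro mult_right_mono)
    then show ?thesis using h\<mu>[OF True] by simp
  next
    case False
    then have "w \<in> annulus e (3 * L) (3 * R)"
      using w R by (auto simp: Far_def annulus_def D_def open_annulus_def N_def)
    then have "h w \<le> C * h y" using hK y(3) by blast
    also have "\<dots> \<le> C * \<mu>" using h\<mu>[OF yF] C by (intro mult_left_mono) auto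
    finally show ?thesis .
  qed
  have j0: "0 \<le> j R" using j_nonneg[OF R] .
  \<comment> \<open>Three weights: 1 on the target, 4 on \<open>N\<close> (the bound for
    \<open>\<sigma>\<close>) and \<open>C * \<mu>\<close> on \<open>D\<close>. The first two sets
    are farther than \<open>R\<close> from \<open>G z\<close>; the third term is at most \<mu>/4
    because \<open>C * \<epsilon> \<le> 1 / 4\<close>, and is absorbed. The base 30 is the ratio of
    the radii of \<open>N\<close> and \<open>A\<close>.\<close>
  have \<mu>: "\<mu> \<le> 4 * (1 + 4 * 30 ^ d) * (T * j R * V)"
  proof -
    have step: "h z \<le> 2 * T * j R * V + 4 * (2 * T * j R * (30 ^ d * V)) + \<mu> * (1 / 4)" if z: "z \<in> Far" for z
    proof -
      have zD: "z \<in> D" and z2: "2 * R \<le> norm z" using z by (auto simp: Far_def)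
      have far: "r \<le> dist u v" if u: "u \<in> G z" and v: "norm v < s" and r: "r \<le> 2 * R - L - s" for u v r s
      proof -
        have "norm (z - u) < L" using u by (simp add: G_def dist_norm)
        moreover have "norm z \<le> norm u + norm (z - u)" by (rule norm_triangle_sub)
        moreover have "norm u \<le> norm v + dist u v" unfolding dist_norm by (rule norm_triangle_sub)
        ultimately show ?thesis using v r z2 by linarith
      qed
      have "h z \<le> (\<Sum>i\<in>{0, 1, 2::nat}. (if i = 0 then 1 else if i = 1 then 4 else C * \<mu>) *
          exit_prob M X z (G z) (if i = 0 then A else if i = 1 then N else D))"
        unfolding h_def
      proof (rule exit_prob_bound[OF D A(1) G(1,2)])
        fix w assume "w \<notin> G z"
        show "exit_prob M X w D A \<le> (\<Sum>i\<in>{0, 1, 2::nat}. (if i = 0 then 1 else if i = 1 then 4 else C * \<mu>) *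
            indicator (if i = 0 then A else if i = 1 then N else D) w)"
        proof (cases "w \<in> D")
          case True
          show ?thesis
          proof (cases "w \<in> N")
            case True
            have "h w \<le> 4" using h\<sigma>[OF \<open>w \<in> D\<close>] \<sigma>4 by linarith
            then show ?thesis using True \<open>w \<in> D\<close> C\<mu> unfolding h_def sum3 by (cases "w \<in> A") simp_all
          next
            case False
            then show ?thesis using away[OF True False] \<open>w \<in> D\<close> unfolding h_def sum3 by (cases "w \<in> A") simp_all
          qed
        next
          case False
          then show ?thesis using hout[OF False] C\<mu> unfolding h_def sum3 by (cases "w \<in> A"; cases "w \<in> N") simp_all
        qed
      qed (use A D C\<mu> in \<open>auto simp: N_def\<close>)
      then have "h z \<le> exit_prob M X z (G z) A + (4 * exit_prob M X z (G z) N + C * \<mu> * exit_prob M X z (G z) D)" unfolding sum3 by simp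
      moreover have "exit_prob M X z (G z) A \<le> 2 * T * j R * V"
        unfolding volA[symmetric]
      proof (rule pB[OF zD A(2,3) R])
        show "R < 2 * R - L - L / 10" using L L5 by linarith
        show "2 * R - L - L / 10 \<le> dist u v" if "u \<in> G z" "v \<in> A" for u v
          using that by (intro far[OF that(1), of v "L / 10"]) (simp_all add: A_def)
      qed
      moreover have "exit_prob M X z (G z) N \<le> 2 * T * j R * (30 ^ d * V)"
        unfolding volN[symmetric]
      proof (rule pB[OF zD _ _ R])
        show "R < 2 * R - L - 3 * L" using L L5 by linarith
        show "2 * R - L - 3 * L \<le> dist u v" if "u \<in> G z" "v \<in> N" for u v
          using that by (intro far[OF that(1), of v "3 * L"]) (simp_all add: N_def)
      qed (simp_all add: N_def)
      moreover have "C * \<mu> * exit_prob M X z (G z) D \<le> \<mu> * (1 / 4)"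
      proof -
        have "C * \<mu> * exit_prob M X z (G z) D \<le> C * \<mu> * \<epsilon>" using pD[OF zD] C \<mu>0 by (intro mult_left_mono) auto
        also have "\<dots> = \<mu> * (C * \<epsilon>)" by simp
        also have "\<dots> \<le> \<mu> * (1 / 4)" using eps(3) \<mu>0 by (intro mult_left_mono) auto
        finally show ?thesis .
      qed
      ultimately show ?thesis by linarith
    qed
    have "\<mu> \<le> 2 * T * j R * V + 4 * (2 * T * j R * (30 ^ d * V)) + \<mu> * (1 / 4)"
      using yF step by (subst \<mu>_def) (intro cSUP_least, auto)
    also have "\<dots> = (2 + 8 * 30 ^ d) * (T * j R * V) + \<mu> * (1 / 4)" by (simp add: algebra_simps)
    finally have "3 * \<mu> \<le> 4 * ((2 + 8 * 30 ^ d) * (T * j R * V))" by simp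
    also have "\<dots> \<le> 3 * (4 * (1 + 4 * 30 ^ d) * (T * j R * V))"
    proof -
      have "4 * (2 + 8 * 30 ^ d) \<le> (3 * (4 * (1 + 4 * 30 ^ d)) :: real)" by simp
      moreover have "0 \<le> T * j R * V" using T(1) j0 V by simp
      ultimately have "4 * (2 + 8 * 30 ^ d) * (T * j R * V) \<le> 3 * (4 * (1 + 4 * 30 ^ d)) * (T * j R * V)"
        by (rule mult_right_mono)
      then show ?thesis by (simp only: mult.assoc)
    qed
    finally show ?thesis by simp
  qed

  \<comment> \<open>The lower estimate is for compact targets, so a closed ball inside the open
    \<open>A\<close> is used; halving the radius costs the factor \<open>2 ^ d\<close>.\<close>
  define V' where "V' = U * (L / 20) ^ d"
  have V': "0 < V'" using U L by (simp add: V'_def)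
  have VV': "V = 2 ^ d * V'"
  proof -
    have "L / 10 = 2 * (L / 20)" by simp
    then show ?thesis unfolding V_def V'_def by (simp only: power_mult_distrib) simp
  qed
  have "T / 2 * j (c * R) * V' \<le> h x"
  proof -
    let ?B = "cball 0 (L / 20) :: 'a set"
    have xL: "13 / 5 * L \<le> norm w" "norm w \<le> 23 / 5 * L" "13 / 5 * L \<le> w \<bullet> e" if "w \<in> cball x L" for w
    proof -
      have n: "norm (x - w) \<le> L" using that by (simp add: dist_norm)
      have "norm x \<le> norm w + norm (x - w)" by (rule norm_triangle_sub)
      then show "13 / 5 * L \<le> norm w" using x(1) n by linarith
      have "norm w \<le> norm x + norm (x - w)" by (metis norm_minus_commute norm_triangle_sub)
      then show "norm w \<le> 23 / 5 * L" using x(1) n by linarith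
      have "\<bar>(x - w) \<bullet> e\<bar> \<le> norm (x - w)" using Basis_le_norm[OF e] by blast
      moreover have "x \<bullet> e = 18 / 5 * L" using e1 by (simp add: x_def)
      ultimately show "13 / 5 * L \<le> w \<bullet> e" using n by (simp add: inner_diff_left)
    qed
    have xD: "cball x L \<subseteq> D"
    proof
      fix w assume w: "w \<in> cball x L"
      show "w \<in> D" using xL[OF w] L L5 by (auto simp: D_def open_annulus_def)
    qed
    have "T / 2 * j (c * R) * measure lborel ?B \<le> exit_prob M X x D A"
    proof (rule exit_prob_lower[OF _ _ _ _ _ T2(1) T(3) D A(1)])
      show "compact ?B" by simp
      show "?B \<inter> ball x L = {}"
      proof (rule equals0I)
        fix w assume w: "w \<in> ?B \<inter> ball x L"
        then have "13 / 5 * L \<le> norm w" by (intro xL(1)) auto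
        then show False using w L by simp
      qed
      show "0 < 93 / 20 * L" "93 / 20 * L < c * R" using L Lc by linarith+
      fix u v assume u: "u \<in> ball x L" and v: "v \<in> ?B"
      have "norm u \<le> 23 / 5 * L" using u by (intro xL(2)) auto
      moreover have "norm v \<le> L / 20" using v by simp
      moreover have "dist u v \<le> norm u + norm v" unfolding dist_norm by (rule norm_triangle_ineq4)
      ultimately show "dist u v \<le> 93 / 20 * L" by linarith
    next
      fix p :: "real \<Rightarrow> 'a" and t
      assume p: "right_cont p" "0 \<le> t" "p t \<in> ?B" and bef: "\<And>s. 0 \<le> s \<Longrightarrow> s < t \<Longrightarrow> p s \<in> cball x L"
      have nt: "norm (p t) \<le> L / 20" using p(3) by simp
      then have "p t \<notin> D" using L by (intro AD) linarith
      then have "exits p D t" unfolding exits_def using p(2) bef xD by blast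
      moreover have "p t \<in> A" using nt L by (simp add: A_def)
      ultimately show "\<exists>s. exits p D s \<and> p s \<in> A" by blast
    qed
    moreover have "measure lborel ?B = V'" unfolding V'_def using L by (intro vol) simp
    ultimately show ?thesis by (simp add: h_def)
  qed
  also have "h x \<le> C * h y" by (rule hK[OF x(2) y(3)])
  also have "C * h y \<le> C * (4 * (1 + 4 * 30 ^ d) * (T * j R * V))"
    using h\<mu>[OF yF] \<mu> C by (intro mult_left_mono) auto
  also have "\<dots> = (T / 2 * V') * (8 * C * (1 + 4 * 30 ^ d) * 2 ^ d * j R)"
    unfolding VV' by simp
  finally have "(T / 2 * V') * j (c * R) \<le> (T / 2 * V') * (8 * C * (1 + 4 * 30 ^ d) * 2 ^ d * j R)"
    by (simp add: mult.commute mult.left_commute)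
  moreover have "0 < T / 2 * V'" using T(1) V' by simp
  ultimately show ?thesis by (rule mult_left_le_imp_le)
qed

text \<open>A ball of radius \<open>\<alpha> * R / 2\<close> about a point of the closed annulus
  stays in the open one, where the exit probability is harmonic. EHI compares values within such
  balls, and a chain extends the comparison to the whole annulus.\<close>

lemma EHI_imp_harnack_annulus:
  fixes e :: 'a
  assumes ehi: "EHI M X" and e: "e \<in> Basis" and \<alpha>: "0 < \<alpha>" "\<alpha> < 1"
  obtains C where "1 \<le> C" "\<And>R u v. 0 < R \<Longrightarrow> u \<in> annulus e (3 * (\<alpha> * R)) (3 * R) \<Longrightarrow> v \<in> annulus e (3 * (\<alpha> * R)) (3 * R) \<Longrightarrow>
      exit_prob M X u (open_annulus e (5 / 2 * (\<alpha> * R)) (4 * R)) (ball 0 (\<alpha> * R / 10)) \<le>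
      C * exit_prob M X v (open_annulus e (5 / 2 * (\<alpha> * R)) (4 * R)) (ball 0 (\<alpha> * R / 10))"
proof -
  obtain C0 \<kappa> where C0: "0 < C0" and \<kappa>: "0 < \<kappa>" "\<kappa> < 1"
    and har: "\<And>x0 r h x y. 0 < r \<Longrightarrow> (\<And>x. 0 \<le> h x) \<Longrightarrow> harmonic_on M X h (ball x0 r) \<Longrightarrow>
      x \<in> ball x0 (\<kappa> * r) \<Longrightarrow> y \<in> ball x0 (\<kappa> * r) \<Longrightarrow> h x \<le> C0 * h y"
    using ehi unfolding EHI_def by metis
  define K where "K = annulus e (3 * \<alpha>) 3"
  define f where "f R u = exit_prob M X (R *\<^sub>R u) (open_annulus e (5 / 2 * (\<alpha> * R)) (4 * R)) (ball 0 (\<alpha> * R / 10))" for R u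
  \<comment> \<open>All scales are rescaled to the fixed compact set \<open>K\<close> and form one
    family of functions. EHI has the same constants for every radius, so the chain yields one
    constant for all \<open>R\<close>.\<close>
  define H where "H g \<longleftrightarrow> (\<exists>R>0. g = f R)" for g
  have scale: "R *\<^sub>R u \<in> annulus e (3 * (\<alpha> * R)) (3 * R)" if "0 < R" "u \<in> K" for R u
  proof -
    have "R * (3 * \<alpha>) \<le> R * norm u" "R * norm u \<le> R * 3"
      using that by (auto simp: K_def annulus_def)
    then show ?thesis using that by (auto simp: K_def annulus_def algebra_simps)
  qed
  have "\<exists>N\<ge>0. \<forall>g u v. H g \<longrightarrow> u \<in> K \<longrightarrow> v \<in> K \<longrightarrow> g u \<le> N * g v"
  proof (rule harnack_chain)
    show "compact K" "connected K" unfolding K_def using compact_connected_annulus[OF e] \<alpha> by auto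
    show "0 < \<kappa> * (\<alpha> / 2)" using \<kappa> \<alpha> by simp
    show "0 \<le> C0" using C0 by simp
    show "0 \<le> g u" if "H g" for g u using that by (auto simp: H_def f_def)
    fix g u v assume "H g" and uv: "u \<in> K" "v \<in> K" "dist u v < \<kappa> * (\<alpha> / 2)"
    then obtain R where R: "0 < R" "g = f R" by (auto simp: H_def)
    let ?D = "open_annulus e (5 / 2 * (\<alpha> * R)) (4 * R)"
    have D: "open ?D" "- ?D \<noteq> {}"
    proof -
      show "open ?D" by (rule open_open_annulus)
      have "0 < \<alpha> * R" using \<alpha> R by simp
      then have "\<not> 5 / 2 * (\<alpha> * R) < norm (0 :: 'a)" unfolding norm_zero by linarith
      then have "0 \<notin> ?D" unfolding open_annulus_def by blast
      then show "- ?D \<noteq> {}" by blast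
    qed
    have sub: "ball (R *\<^sub>R u) (\<alpha> * R / 2) \<subseteq> ?D"
    proof (rule ball_subset_open_annulus[OF e scale[OF R(1) uv(1)]])
      have "\<alpha> * R \<le> 1 * R" using \<alpha> R by (intro mult_right_mono) auto
      then show "\<alpha> * R / 2 \<le> 4 * R - 3 * R" using R by simp
      show "0 \<le> 5 / 2 * (\<alpha> * R)" using \<alpha> R by simp
    qed simp
    show "g u \<le> C0 * g v"
      unfolding R(2) f_def
    proof (rule har[of "\<alpha> * R / 2" _ "R *\<^sub>R u"])
      show "0 < \<alpha> * R / 2" using \<alpha> R by simp
      show "harmonic_on M X (\<lambda>z. exit_prob M X z ?D (ball 0 (\<alpha> * R / 10))) (ball (R *\<^sub>R u) (\<alpha> * R / 2))"
        by (rule exit_prob_harmonic[OF D _ sub]) simp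
      show "R *\<^sub>R u \<in> ball (R *\<^sub>R u) (\<kappa> * (\<alpha> * R / 2))" using \<kappa> \<alpha> R by simp
      have "dist (R *\<^sub>R u) (R *\<^sub>R v) = R * dist u v"
        using R by (simp add: dist_norm flip: scaleR_diff_right)
      also have "\<dots> < R * (\<kappa> * (\<alpha> / 2))" using uv(3) R by simp
      finally show "R *\<^sub>R v \<in> ball (R *\<^sub>R u) (\<kappa> * (\<alpha> * R / 2))" by (simp add: ac_simps)
    qed simp
  qed
  then obtain N where N: "0 \<le> N" "\<And>g u v. H g \<Longrightarrow> u \<in> K \<Longrightarrow> v \<in> K \<Longrightarrow> g u \<le> N * g v" by metis
  show ?thesis
  proof (rule that[of "max N 1"])
    fix R u v assume R: "0 < R" and u: "u \<in> annulus e (3 * (\<alpha> * R)) (3 * R)" and v: "v \<in> annulus e (3 * (\<alpha> * R)) (3 * R)"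
    have inK: "inverse R *\<^sub>R w \<in> K" if "w \<in> annulus e (3 * (\<alpha> * R)) (3 * R)" for w
      using that R by (auto simp: K_def annulus_def field_simps)
    have "f R (inverse R *\<^sub>R u) \<le> N * f R (inverse R *\<^sub>R v)"
      using R by (intro N(2) inK u v) (auto simp: H_def)
    also have "\<dots> \<le> max N 1 * f R (inverse R *\<^sub>R v)"
      by (intro mult_right_mono) (auto simp: f_def)
    finally show "exit_prob M X u (open_annulus e (5 / 2 * (\<alpha> * R)) (4 * R)) (ball 0 (\<alpha> * R / 10)) \<le>
      max N 1 * exit_prob M X v (open_annulus e (5 / 2 * (\<alpha> * R)) (4 * R)) (ball 0 (\<alpha> * R / 10))"
      using R by (simp add: f_def)
  qed simp
qed

end

text \<open>The condition \<open>j (c * R n) \<noteq> 0\<close> gives the quotient its intended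
  meaning, since division by 0 yields 0 in HOL; with \<open>j\<close> nonnegative it makes
  \<open>j (c * R n)\<close> positive.\<close>

theorem theorem1p1:
  fixes M :: "'w measure"
    and X :: "real \<Rightarrow> 'w \<Rightarrow> 'a::euclidean_space"
    and j :: "real \<Rightarrow> real"
    and c \<alpha> :: real
    and R :: "nat \<Rightarrow> real"
  assumes "0 < sqrt 29 * \<alpha>" and "sqrt 29 * \<alpha> \<le> c" and "c < 1"
    and "levy_process M X"
    and "isotropic_unimodal M X"
    and "radial_jump_density M X j"
    and "\<And>n. 0 < R n"
    and "\<And>n. j (c * R n) \<noteq> 0"
    and "(\<lambda>n. j (R n) / j (c * R n)) \<longlonglongrightarrow> 0"
    and "(\<lambda>n. exit_prob M X 0 (ball 0 (\<alpha> * R n)) (ball 0 (10 * R n))) \<longlonglongrightarrow> 0"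
  shows "\<not> EHI M X"
proof
  assume ehi: "EHI M X"
  interpret unimodal_levy M X j
    using assms(4-6) by unfold_locales
  \<comment> \<open>The hypothesis enters in the form \<open>5 * \<alpha> < c\<close>, the geometric
    margin of the lower bound for \<open>h x\<close>.\<close>
  have "sqrt 25 < sqrt 29" by (rule real_sqrt_less_mono) simp
  then have s5: "5 < sqrt 29" by simp
  have \<alpha>0: "0 < \<alpha>" using assms(1) by (simp add: zero_less_mult_iff)
  then have "5 * \<alpha> < sqrt 29 * \<alpha>" using s5 by simp
  then have \<alpha>5: "5 * \<alpha> < c" using assms(2) by linarith
  have \<alpha>1: "\<alpha> < 1" using \<alpha>5 \<alpha>0 assms(3) by linarith
  have c0: "0 < c" using \<alpha>5 \<alpha>0 by linarith
  obtain e :: 'a where e: "e \<in> Basis" using nonempty_Basis by blast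
  obtain C where C: "1 \<le> C" "\<And>R u v. 0 < R \<Longrightarrow> u \<in> annulus e (3 * (\<alpha> * R)) (3 * R) \<Longrightarrow> v \<in> annulus e (3 * (\<alpha> * R)) (3 * R) \<Longrightarrow>
      exit_prob M X u (open_annulus e (5 / 2 * (\<alpha> * R)) (4 * R)) (ball 0 (\<alpha> * R / 10)) \<le>
      C * exit_prob M X v (open_annulus e (5 / 2 * (\<alpha> * R)) (4 * R)) (ball 0 (\<alpha> * R / 10))"
    using EHI_imp_harnack_annulus[OF ehi e \<alpha>0 \<alpha>1] by blast
  define Q where "Q = 8 * C * (1 + 4 * 30 ^ DIM('a)) * 2 ^ DIM('a)"
  have Q: "0 < Q" unfolding Q_def using C(1) by (intro mult_pos_pos) (auto simp: add_pos_pos)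
  \<comment> \<open>The two thresholds required by \<open>harnack_implies_doubling\<close> for
    absorbing its re-entry terms. The ratio is taken below \<open>1 / (2 * Q)\<close> to contradict
    the bound with factor \<open>Q\<close>.\<close>
  have "0 < min (1 / 2) (1 / (4 * C))" using C(1) by simp
  with assms(10) have "eventually (\<lambda>n. exit_prob M X 0 (ball 0 (\<alpha> * R n)) (ball 0 (10 * R n)) < min (1 / 2) (1 / (4 * C))) sequentially"
    by (rule order_tendstoD(2))
  moreover have "eventually (\<lambda>n. j (R n) / j (c * R n) < 1 / (2 * Q)) sequentially"
    using assms(9) by (rule order_tendstoD(2)) (use Q in simp)
  ultimately have "eventually (\<lambda>n. False) sequentially"
  proof eventually_elim
    fix n
    assume small: "exit_prob M X 0 (ball 0 (\<alpha> * R n)) (ball 0 (10 * R n)) < min (1 / 2) (1 / (4 * C))"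
      and ratio: "j (R n) / j (c * R n) < 1 / (2 * Q)"
    let ?\<epsilon> = "exit_prob M X 0 (ball 0 (\<alpha> * R n)) (ball 0 (10 * R n))"
    have "0 \<le> j (c * R n)" using c0 assms(7) by (intro j_nonneg) simp
    then have jc: "0 < j (c * R n)" using assms(8)[of n] by linarith
    have "C * ?\<epsilon> \<le> 1 / 4" using small C(1) by (simp add: field_simps)
    then have "j (c * R n) \<le> Q * j (R n)"
      unfolding Q_def using small
      by (intro harnack_implies_doubling[OF e assms(7) \<alpha>0 \<alpha>5 assms(3) jc order_refl _ _ C(1) C(2)[OF assms(7)]]) auto
    moreover have "2 * (Q * j (R n)) < j (c * R n)" using ratio jc Q by (simp add: field_simps)
    ultimately show False using jc by linarith
  qed
  then show False by simp
qed

end
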